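(* Let $\varepsilon\in[0,1]$, $\delta\in[0,1]$, $\{\varepsilon_m\}_{m\in\mathbb{N}}\subset(0,1]$, $\{\delta_m\}_{m\in\mathbb{N}}\subset(0,1]$, $u\in\mathbb{X}$, $\{u^m\}_{m\in\mathbb{N}}\subset\mathbb{X}$, $w_0\in Y$ and $\{w_0^m\}_{m\in\mathbb{N}}\subset Y$ be such that, as $m\to\infty$, $$\varepsilon_m\to\varepsilon,\quad \delta_m\to\delta,\quad u^m\to u \text{ weakly in } \mathbb{X},\quad w_0^m\to w_0 \text{ weakly in } Y,$$ and $$\hat K_* := \sup_{m\in\mathbb{N}}\int_\Omega \hat K^{\delta_m}(w_0^m)\,dx<\infty .$$ Let $w=[w_1,\dots,w_n]\in\mathbb{X}$ be the unique solution to $(\mathrm{AC})^{(\varepsilon,\delta)}$ for the forcing term $u$ and initial data $w_0$, and for each $m\in\mathbb{N}$ let $w^m=[w_1^m,\dots,w_n^m]\in\mathbb{X}$ be the unique solution to $(\mathrm{AC})^{(\varepsilon_m,\delta_m)}$ for the forcing term $u^m$ and initial data $w_0^m$. Then $$w^m\to w \text{ in } \mathbb{Y}, \text{ in } [C^1(\overline\Omega)]^n, \text{ and weakly in } [H^2(\Omega)]^n,\ \text{ as } m\to\infty,$$ and in particular, for every $i=1,\dots,n$, $$f^{\varepsilon_m}(\partial_x w_i^m)\to f^{\varepsilon}(\partial_x w_i) \text{ in } X \text{ and pointwise on } \overline\Omega,\ \text{ as } m\to\infty.$$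
   Context: Let $0<L,T<\infty$, $\Omega := (-L,L)$, $X := L^2(\Omega)$, $Y := H^1(\Omega)\ (\subset C(\overline\Omega))$, $n\in\mathbb{N}$, $\mathbb{X} := [X]^n$, $\mathbb{Y} := [Y]^n$; $\partial_x$ is the distributional derivative. $\nu>0$ and $M_u\ge 0$ are fixed constants. Mosco convergence: for proper l.s.c. convex functions $\psi_n,\psi$ on a Hilbert space $H$, $\psi_n \to \psi$ in the sense of Mosco iff (M1) $\liminf_n \psi_n(w_n) \ge \psi(w)$ whenever $w_n \to w$ weakly in $H$; (M2) for every $w \in D(\psi)$ there are $w_n \to w$ in $H$ with $\psi_n(w_n) \to \psi(w)$. For a family with a continuous parameter, convergence is meant along every sequence of parameters converging to the given limit. Assumption on $f^\varepsilon$: $f^0(r) := |r|$; $\{f^\varepsilon\}_{\varepsilon\in(0,1]} \subset C^2(\mathbb{R})$ are convex functions with $f^\varepsilon(0)=0$, $f^\varepsilon \ge 0$ on $\mathbb{R}$; for every $\varepsilon_0 \in [0,1]$, as $\varepsilon \to \varepsilon_0$, $f^\varepsilon(r) \to f^{\varepsilon_0}(r)$ for every $r\in\mathbb{R}$ and $f^\varepsilon \to f^{\varepsilon_0}$ on $\mathbb{R}$ in the sense of Mosco; there is $C_0>0$ independent of $\varepsilon$ with $|(f^\varepsilon)'(r)| \le C_0(1+|r|)$ for all $r \in \mathbb{R}$, $\varepsilon\in(0,1]$; and for every $\lambda>0$, $(f^\varepsilon)'' \to 0$ uniformly on $\{|r| \ge \lambda\}$ as $\varepsilon \to 0$. For $\varepsilon\in(0,1]$,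 $\partial f^\varepsilon(r) = \{(f^\varepsilon)'(r)\}$; $\partial f^0(r) = \{r/|r|\}$ if $r\neq 0$, $\partial f^0(0)=[-1,1]$. Assumption on $g$: $g\in C^1(\mathbb{R})$, there is $C_g>0$ such that $r\mapsto g(r)+C_g r$ is monotone (nondecreasing), and $g$ has a nonnegative primitive $0\le G\in C^2(\mathbb{R})$, $G'=g$. Assumption on $K^\delta$: $\hat K^0 := I_{[-1,1]}$ (equal to $0$ on $[-1,1]$ and $+\infty$ elsewhere) and $K^0 := \partial I_{[-1,1]}$ (set-valued subdifferential). $\{\hat K^\delta\}_{\delta\in(0,1]} \subset C^2(\mathbb{R})$ and $\{K^\delta\}_{\delta\in(0,1]} \subset C^1(\mathbb{R})$ satisfy: $K^\delta = (\hat K^\delta)'$ and $\hat K^\delta \equiv 0$ on $[-1,1]$ for all $\delta\in(0,1]$; for each $\delta\in(0,1]$ there is $C_K^\delta>0$ with $0 \le (K^\delta)' \le C_K^\delta$ on $\mathbb{R}$; for every $\delta_0\in[0,1]$, $\hat K^\delta \to \hat K^{\delta_0}$ on $\mathbb{R}$ in the sense of Mosco as $\delta\to\delta_0$, and if $\delta_0 \in (0,1]$ also $\hat K^\delta \to \hat K^{\delta_0}$ in $C_{\mathrm{loc}}(\mathbb{R})$. Time step: $\tau := T/n$ with $0<\tau<\tau^* := \frac{1}{8(C_g+1)}$. Functional: for $\varepsilon,\delta\in[0,1]$, $\Psi^{(\varepsilon,\delta)}(z) := \int_\Omega f^\varepsilon(\partial_x z)\,dx + \frac{\nu^2}{2}\int_\Omega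 |\partial_x z|^2\,dx + \int_\Omega \hat K^\delta(z)\,dx$ if $z\in Y$, and $:=\infty$ if $z\in X\setminus Y$; $D(\Psi^{(\varepsilon,\delta)})$ is its effective domain. State-system $(\mathrm{AC})^{(\varepsilon,\delta)}$ for forcing $u\in\mathbb{X}$ and initial value $w_0\in Y$ with $\hat K^\delta(w_0)\in L^1(\Omega)$: find $w=[w_1,\dots,w_n]$ with $$\frac1\tau(w_i-w_{i-1}) - \partial_x\big(\partial f^\varepsilon(\partial_x w_i)+\nu^2\partial_x w_i\big) + K^\delta(w_i) + g(w_i) \ni M_u u_i \text{ in } \Omega,\quad \partial_x w_i(\pm L)=0,\quad i=1,\dots,n.$$ Being a solution means: $w_i\in D(\Psi^{(\varepsilon,\delta)})$ and, for all $z\in D(\Psi^{(\varepsilon,\delta)})$ and $i=1,\dots,n$, $$\frac1\tau(w_i-w_{i-1},w_i-z)_X+(g(w_i)-M_uu_i,w_i-z)_X+\Psi^{(\varepsilon,\delta)}(w_i)-\Psi^{(\varepsilon,\delta)}(z)\le 0.$$ A unique solution exists, and it belongs to $[H^2(\Omega)]^n$. *)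

theory Defs
  imports "HOL-Analysis.Analysis"
begin

section \<open>Convergence in Hilbert spaces of functions\<close>

text \<open>
  The spaces below consist of functions that are identified when they agree almost everywhere.
  They are represented by the set \<open>V\<close> of all representatives together with a (semidefinite)
  inner product \<open>ip\<close>. Limits are thus determined up to null sets only.
\<close>

definition converges_in ::
  "'a::minus set \<Rightarrow> ('a \<Rightarrow> 'a \<Rightarrow> real) \<Rightarrow> (nat \<Rightarrow> 'a) \<Rightarrow> 'a \<Rightarrow> bool" where
  "converges_in V ip z z0 \<longleftrightarrow>
     (\<forall>m. z m \<in> V) \<and> z0 \<in> V \<and> (\<lambda>m. sqrt (ip (z m - z0) (z m - z0))) \<longlonglongrightarrow> 0"

definition weakly_converges_in ::
  "'a set \<Rightarrow> ('a \<Rightarrow> 'a \<Rightarrow> real) \<Rightarrow> (nat \<Rightarrow> 'a) \<Rightarrow> 'a \<Rightarrow> bool" where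
  "weakly_converges_in V ip z z0 \<longleftrightarrow>
     (\<forall>m. z m \<in> V) \<and> z0 \<in> V \<and> (\<forall>v\<in>V. (\<lambda>m. ip (z m) v) \<longlonglongrightarrow> ip z0 v)"

text \<open>The product Hilbert space \<open>[V]\<^sup>n\<close>; only the components \<open>1, \<dots>, n\<close> matter.\<close>

definition power_space :: "'a set \<Rightarrow> nat \<Rightarrow> (nat \<Rightarrow> 'a) set" where
  "power_space V n = {z. \<forall>i\<in>{1..n}. z i \<in> V}"

definition power_inner ::
  "('a \<Rightarrow> 'a \<Rightarrow> real) \<Rightarrow> nat \<Rightarrow> (nat \<Rightarrow> 'a) \<Rightarrow> (nat \<Rightarrow> 'a) \<Rightarrow> real" where
  "power_inner ip n z v = (\<Sum>i=1..n. ip (z i) (v i))"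


section \<open>Mosco convergence\<close>

definition mosco_converges ::
  "(nat \<Rightarrow> 'h::{real_inner, complete_space} \<Rightarrow> ereal) \<Rightarrow> ('h \<Rightarrow> ereal) \<Rightarrow> bool" where
  "mosco_converges \<psi> \<psi>0 \<longleftrightarrow>
     (\<forall>z z0. weakly_converges_in UNIV inner z z0 \<longrightarrow> \<psi>0 z0 \<le> liminf (\<lambda>m. \<psi> m (z m))) \<and>
     (\<forall>z0. \<psi>0 z0 < \<infinity> \<longrightarrow> (\<exists>z. z \<longlonglongrightarrow> z0 \<and> (\<lambda>m. \<psi> m (z m)) \<longlonglongrightarrow> \<psi>0 z0))"

definition mosco_continuous_on ::
  "real set \<Rightarrow> (real \<Rightarrow> 'h::{real_inner, complete_space} \<Rightarrow> ereal) \<Rightarrow> bool" where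
  "mosco_continuous_on I \<psi> \<longleftrightarrow>
     (\<forall>a\<in>I. \<forall>s. (\<forall>m. s m \<in> I) \<longrightarrow> s \<longlonglongrightarrow> a \<longrightarrow> mosco_converges (\<lambda>m. \<psi> (s m)) (\<psi> a))"


section \<open>Function spaces on the interval \<open>(-L, L)\<close>\<close>

definition Ck :: "nat \<Rightarrow> (real \<Rightarrow> real) \<Rightarrow> bool" where
  "Ck k h \<longleftrightarrow> (\<forall>j<k. \<forall>x. (deriv ^^ j) h field_differentiable at x) \<and>
     continuous_on UNIV ((deriv ^^ k) h)"

abbreviation Omega_measure :: "real \<Rightarrow> real measure" where
  "Omega_measure L \<equiv> lebesgue_on {-L<..<L}"

definition L2 :: "real \<Rightarrow> (real \<Rightarrow> real) set" where
  "L2 L = {z. z \<in> borel_measurable (Omega_measure L) \<and>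
     integrable (Omega_measure L) (\<lambda>x. (z x)\<^sup>2)}"

definition L2_inner :: "real \<Rightarrow> (real \<Rightarrow> real) \<Rightarrow> (real \<Rightarrow> real) \<Rightarrow> real" where
  "L2_inner L z v = (\<integral>x. z x * v x \<partial>Omega_measure L)"

text \<open>The support condition makes the support compact, since the interval is bounded.\<close>

definition test_function :: "real \<Rightarrow> (real \<Rightarrow> real) \<Rightarrow> bool" where
  "test_function L \<phi> \<longleftrightarrow> (\<forall>k. Ck k \<phi>) \<and> closure {x. \<phi> x \<noteq> 0} \<subseteq> {-L<..<L}"

definition has_weak_deriv :: "real \<Rightarrow> (real \<Rightarrow> real) \<Rightarrow> (real \<Rightarrow> real) \<Rightarrow> bool" where
  "has_weak_deriv L z v \<longleftrightarrow>
     (\<forall>\<phi>. test_function L \<phi> \<longrightarrow> L2_inner L z (deriv \<phi>) = - L2_inner L v \<phi>)"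

definition H1 :: "real \<Rightarrow> (real \<Rightarrow> real) set" where
  "H1 L = {z \<in> L2 L. \<exists>v\<in>L2 L. has_weak_deriv L z v}"

text \<open>For \<open>z \<in> H1 L\<close> this is a representative of the distributional derivative, which is unique
  up to null sets.\<close>

definition weak_deriv :: "real \<Rightarrow> (real \<Rightarrow> real) \<Rightarrow> real \<Rightarrow> real" where
  "weak_deriv L z = (SOME v. v \<in> L2 L \<and> has_weak_deriv L z v)"

definition H1_inner :: "real \<Rightarrow> (real \<Rightarrow> real) \<Rightarrow> (real \<Rightarrow> real) \<Rightarrow> real" where
  "H1_inner L z v = L2_inner L z v + L2_inner L (weak_deriv L z) (weak_deriv L v)"

definition H2 :: "real \<Rightarrow> (real \<Rightarrow> real) set" where
  "H2 L = {z \<in> H1 L. weak_deriv L z \<in> H1 L}"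

definition H2_inner :: "real \<Rightarrow> (real \<Rightarrow> real) \<Rightarrow> (real \<Rightarrow> real) \<Rightarrow> real" where
  "H2_inner L z v = H1_inner L z v +
     L2_inner L (weak_deriv L (weak_deriv L z)) (weak_deriv L (weak_deriv L v))"

text \<open>
  An element of \<open>L2 L\<close> belongs to \<open>C\<^sup>1\<close> of the closed interval when it agrees almost everywhere
  with such a function. That function is unique on \<open>{-L..L}\<close>, and it is the one to which uniform
  and pointwise statements on the closed interval refer.
\<close>

definition cont_rep :: "real \<Rightarrow> (real \<Rightarrow> real) \<Rightarrow> real \<Rightarrow> real" where
  "cont_rep L z = (SOME p. continuous_on {-L..L} p \<and> (AE x in Omega_measure L. z x = p x))"

definition cont_deriv :: "real \<Rightarrow> (real \<Rightarrow> real) \<Rightarrow> real \<Rightarrow> real" where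
  "cont_deriv L z x = vector_derivative (cont_rep L z) (at x within {-L..L})"

definition C1_closed :: "real \<Rightarrow> (real \<Rightarrow> real) set" where
  "C1_closed L = {z. \<exists>p q. (AE x in Omega_measure L. z x = p x) \<and> continuous_on {-L..L} q \<and>
     (\<forall>x\<in>{-L..L}. (p has_real_derivative q x) (at x within {-L..L}))}"

definition converges_in_C1 :: "real \<Rightarrow> (nat \<Rightarrow> real \<Rightarrow> real) \<Rightarrow> (real \<Rightarrow> real) \<Rightarrow> bool" where
  "converges_in_C1 L z z0 \<longleftrightarrow>
     (\<forall>m. z m \<in> C1_closed L) \<and> z0 \<in> C1_closed L \<and>
     uniform_limit {-L..L} (\<lambda>m. cont_rep L (z m)) (cont_rep L z0) sequentially \<and>
     uniform_limit {-L..L} (\<lambda>m. cont_deriv L (z m)) (cont_deriv L z0) sequentially"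


section \<open>Assumptions on the nonlinearities\<close>

definition f_assumption :: "(real \<Rightarrow> real \<Rightarrow> real) \<Rightarrow> bool" where
  "f_assumption f \<longleftrightarrow>
     f 0 = (\<lambda>r. \<bar>r\<bar>) \<and>
     (\<forall>\<epsilon>\<in>{0<..1}. Ck 2 (f \<epsilon>) \<and> convex_on UNIV (f \<epsilon>) \<and> f \<epsilon> 0 = 0 \<and> (\<forall>r. 0 \<le> f \<epsilon> r)) \<and>
     (\<forall>\<epsilon>0\<in>{0..1}. \<forall>r. ((\<lambda>\<epsilon>. f \<epsilon> r) \<longlongrightarrow> f \<epsilon>0 r) (at \<epsilon>0 within {0..1})) \<and>
     mosco_continuous_on {0..1} (\<lambda>\<epsilon> r. ereal (f \<epsilon> r)) \<and>
     (\<exists>C0>0. \<forall>\<epsilon>\<in>{0<..1}. \<forall>r. \<bar>deriv (f \<epsilon>) r\<bar> \<le> C0 * (1 + \<bar>r\<bar>)) \<and>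
     (\<forall>c>0. uniform_limit {r. c \<le> \<bar>r\<bar>} (\<lambda>\<epsilon>. deriv (deriv (f \<epsilon>))) (\<lambda>r. 0)
        (at 0 within {0<..1}))"

definition g_assumption :: "(real \<Rightarrow> real) \<Rightarrow> real \<Rightarrow> bool" where
  "g_assumption g Cg \<longleftrightarrow>
     Ck 1 g \<and> 0 < Cg \<and> mono (\<lambda>r. g r + Cg * r) \<and>
     (\<exists>G. Ck 2 G \<and> (\<forall>r. 0 \<le> G r) \<and> (\<forall>r. (G has_real_derivative g r) (at r)))"

text \<open>
  \<open>Khat \<delta>\<close> and \<open>K \<delta>\<close> are given data for \<open>0 < \<delta> \<le> 1\<close> only. The extended real valued family,
  which contains the indicator function of \<open>[-1, 1]\<close> for \<open>\<delta> = 0\<close>, is \<open>Khat_ext Khat\<close>.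
\<close>

definition Khat_ext :: "(real \<Rightarrow> real \<Rightarrow> real) \<Rightarrow> real \<Rightarrow> real \<Rightarrow> ereal" where
  "Khat_ext Khat \<delta> r =
     (if \<delta> = 0 then (if r \<in> {-1..1} then 0 else \<infinity>) else ereal (Khat \<delta> r))"

definition K_assumption :: "(real \<Rightarrow> real \<Rightarrow> real) \<Rightarrow> (real \<Rightarrow> real \<Rightarrow> real) \<Rightarrow> bool" where
  "K_assumption Khat K \<longleftrightarrow>
     (\<forall>\<delta>\<in>{0<..1}. Ck 2 (Khat \<delta>) \<and> Ck 1 (K \<delta>) \<and>
        (\<forall>r. (Khat \<delta> has_real_derivative K \<delta> r) (at r)) \<and>
        (\<forall>r\<in>{-1..1}. Khat \<delta> r = 0) \<and>
        (\<exists>CK>0. \<forall>r. 0 \<le> deriv (K \<delta>) r \<and> deriv (K \<delta>) r \<le> CK)) \<and>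
     mosco_continuous_on {0..1} (Khat_ext Khat) \<and>
     (\<forall>\<delta>0\<in>{0<..1}. \<forall>S. compact S \<longrightarrow>
        uniform_limit S Khat (Khat \<delta>0) (at \<delta>0 within {0<..1}))"


section \<open>The energy and the state system\<close>

text \<open>The integrands of the two nonnegative integrals below are nonnegative under the assumptions
  above (\<open>Khat \<delta>\<close> is convex and vanishes on \<open>[-1, 1]\<close>), so \<open>ennreal\<close> and \<open>e2ennreal\<close> truncate
  nothing.\<close>

definition Khat_integral ::
  "real \<Rightarrow> (real \<Rightarrow> real \<Rightarrow> real) \<Rightarrow> real \<Rightarrow> (real \<Rightarrow> real) \<Rightarrow> ereal" where
  "Khat_integral L Khat \<delta> z =
     enn2ereal (\<integral>\<^sup>+x. e2ennreal (Khat_ext Khat \<delta> (z x)) \<partial>Omega_measure L)"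

definition Psi ::
  "real \<Rightarrow> real \<Rightarrow> (real \<Rightarrow> real \<Rightarrow> real) \<Rightarrow> (real \<Rightarrow> real \<Rightarrow> real) \<Rightarrow> real \<Rightarrow> real \<Rightarrow>
   (real \<Rightarrow> real) \<Rightarrow> ereal" where
  "Psi L \<nu> f Khat \<epsilon> \<delta> z =
     (if z \<in> H1 L then
        enn2ereal (\<integral>\<^sup>+x. ennreal (f \<epsilon> (weak_deriv L z x)) \<partial>Omega_measure L) +
        ereal (\<nu>\<^sup>2 / 2 * (\<integral>x. (weak_deriv L z x)\<^sup>2 \<partial>Omega_measure L)) +
        Khat_integral L Khat \<delta> z
      else \<infinity>)"

definition Psi_dom ::
  "real \<Rightarrow> real \<Rightarrow> (real \<Rightarrow> real \<Rightarrow> real) \<Rightarrow> (real \<Rightarrow> real \<Rightarrow> real) \<Rightarrow> real \<Rightarrow> real \<Rightarrow>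
   (real \<Rightarrow> real) set" where
  "Psi_dom L \<nu> f Khat \<epsilon> \<delta> = {z \<in> L2 L. Psi L \<nu> f Khat \<epsilon> \<delta> z < \<infinity>}"

definition AC_solution ::
  "real \<Rightarrow> real \<Rightarrow> real \<Rightarrow> (real \<Rightarrow> real \<Rightarrow> real) \<Rightarrow> (real \<Rightarrow> real \<Rightarrow> real) \<Rightarrow> (real \<Rightarrow> real) \<Rightarrow>
   nat \<Rightarrow> real \<Rightarrow> real \<Rightarrow> real \<Rightarrow> (nat \<Rightarrow> real \<Rightarrow> real) \<Rightarrow> (real \<Rightarrow> real) \<Rightarrow>
   (nat \<Rightarrow> real \<Rightarrow> real) \<Rightarrow> bool" where
  "AC_solution L \<nu> Mu f Khat g n \<tau> \<epsilon> \<delta> u w0 w \<longleftrightarrow>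
     (\<forall>i\<in>{1..n}.
        w i \<in> Psi_dom L \<nu> f Khat \<epsilon> \<delta> \<and>
        (\<forall>z\<in>Psi_dom L \<nu> f Khat \<epsilon> \<delta>.
           ereal (1 / \<tau> * L2_inner L (w i - (if i = 1 then w0 else w (i - 1))) (w i - z) +
                  L2_inner L (\<lambda>x. g (w i x) - Mu * u i x) (w i - z)) +
           Psi L \<nu> f Khat \<epsilon> \<delta> (w i) - Psi L \<nu> f Khat \<epsilon> \<delta> z \<le> 0))"

end

theory Submission
  imports Defs "HOL-Complex_Analysis.Great_Picard"
begin

text \<open>
  With \<open>\<kappa> = 1 / \<tau>\<close>, the state \<open>w\<^sub>i\<close> of the time-discrete system solves a single variational inequality,
  in which the forcing and the previous state enter only through \<open>h = M\<^sub>u u\<^sub>i + \<kappa> w\<^sub>i\<^sub>-\<^sub>1\<close>. The theorem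
  therefore follows by induction over the time steps from a statement about one step: if \<open>h\<^sub>m\<close>
  converges weakly in \<open>L\<^sup>2\<close> to \<open>h\<close>, then the solutions converge in \<open>C\<^sup>1\<close> and weakly in \<open>H\<^sup>2\<close>
  (\<open>step_convergence\<close>). The new states then converge in \<open>L\<^sup>2\<close>, which feeds the next step; for
  the initial data, weak \<open>H\<^sup>1\<close> convergence gives weak \<open>L\<^sup>2\<close> convergence (\<open>weakly_converges_H1_imp_L2\<close>).

  One step rests on a compactness argument in three parts.

  \<^item> A bound in \<open>H\<^sup>2\<close> that is uniform in the parameters \<open>\<epsilon>, \<delta> \<in> (0, 1]\<close> (\<open>step_solution_H2_bound\<close>). Testing
    with \<open>0\<close> bounds the solution in \<open>H\<^sup>1\<close>, because \<open>\<kappa>\<close> exceeds the constant \<open>C\<^sub>g\<close> of \<open>g\<close>. The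
    Euler-Lagrange equation then says that the flux \<open>(f\<^sup>\<epsilon>)' (\<partial>\<^sub>x w) + \<nu>\<^sup>2 \<partial>\<^sub>x w\<close> has the weak derivative
    \<open>R = \<kappa> w + g w - h + K\<^sup>\<delta> w\<close> and vanishes at the end points. Testing with \<open>K\<^sup>\<delta> w\<close> bounds the last summand by
    the others, since \<open>(f\<^sup>\<epsilon>)'\<close> and \<open>K\<^sup>\<delta>\<close> are monotone. The flux is a function of \<open>\<partial>\<^sub>x w\<close> whose derivative is at
    least \<open>\<nu>\<^sup>2\<close>, whatever \<open>\<epsilon>\<close> is, so that \<open>\<bar>\<partial>\<^sub>x\<^sub>x w\<bar> \<le> \<bar>R\<bar> / \<nu>\<^sup>2\<close>.

  \<^item> By the theorem of Arzela and Ascoli each subsequence has a subsequence that converges in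
    \<open>C\<^sup>1\<close>. Its limit solves the limiting problem when tested with the given solution \<open>w\<close>
    (\<open>step_limit\<close>): the constant sequence \<open>w\<close> is a recovery sequence, Fatou's lemma and the Mosco
    convergence of \<open>K\<^sup>\<delta>\<close> give lower semicontinuity of the penalty, and the remaining terms converge.
    Comparison with the inequality for \<open>w\<close> shows that the limit is \<open>w\<close>, again because \<open>\<kappa> > C\<^sub>g\<close>.
    Hence the whole sequence converges.

  \<^item> The second derivatives converge weakly, because they are bounded in \<open>L\<^sup>2\<close> and their primitives
    converge uniformly (\<open>L2_weak_limit_of_primitives\<close>).

  Everything is expressed by primitives. In one dimension a function has a weak derivative \<open>v\<close> in \<open>L\<^sup>2\<close>
  exactly if it agrees almost everywhere with \<open>c + \<integral> v\<close> (lemma of du Bois-Reymond), and for such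
  functions the chain rule and integration by parts are elementary. The two facts about \<open>L\<^sup>2\<close>
  that are needed, the uniform boundedness principle and the existence of weak limits, come from its
  completeness.
\<close>


section \<open>The semi-inner-product space of square integrable functions\<close>

lemma finite_measure_Omega: "finite_measure (Omega_measure L)"
  by (intro finite_measure_lebesgue_on) simp

lemma Omega_integrable_const [simp]: "integrable (Omega_measure L) (\<lambda>x. c::real)"
  using finite_measure.integrable_const[OF finite_measure_Omega] .

lemma Omega_measurable_id [measurable]: "(\<lambda>x. x) \<in> borel_measurable (Omega_measure L)"
  using id_borel_measurable_lebesgue_on[of "{-L<..<L}"] by (simp add: id_def)

lemma measurable_continuous_on_Omega:
  fixes p :: "real \<Rightarrow> real"
  assumes "continuous_on {-L..L} p"
  shows "p \<in> borel_measurable (Omega_measure L)"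
proof -
  have "continuous_on {-L<..<L} p"
    using assms by (rule continuous_on_subset) auto
  then show ?thesis
    by (intro continuous_imp_measurable_on_sets_lebesgue) auto
qed

lemma L2_measurable: "z \<in> L2 L \<Longrightarrow> z \<in> borel_measurable (Omega_measure L)"
  by (simp add: L2_def)

lemma integrable_mult_L2:
  assumes "z \<in> L2 L" "v \<in> L2 L"
  shows "integrable (Omega_measure L) (\<lambda>x. z x * v x)"
proof (rule Bochner_Integration.integrable_bound)
  show "integrable (Omega_measure L) (\<lambda>x. (z x)\<^sup>2 + (v x)\<^sup>2)"
    using assms by (auto simp: L2_def)
  show "(\<lambda>x. z x * v x) \<in> borel_measurable (Omega_measure L)"
    using assms by (auto simp: L2_def)
  have "\<bar>a * b\<bar> \<le> a\<^sup>2 + b\<^sup>2" for a b :: real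
  proof -
    have "0 \<le> (\<bar>a\<bar> - \<bar>b\<bar>)\<^sup>2" "0 \<le> \<bar>a\<bar> * \<bar>b\<bar>"
      by auto
    then show ?thesis
      unfolding power2_diff power2_abs abs_mult by linarith
  qed
  then show "AE x in Omega_measure L. norm (z x * v x) \<le> norm ((z x)\<^sup>2 + (v x)\<^sup>2)"
    by (intro always_eventually allI) (simp add: abs_of_nonneg)
qed

lemma L2_dominated:
  assumes "z \<in> borel_measurable (Omega_measure L)" "v \<in> L2 L"
    "AE x in Omega_measure L. \<bar>z x\<bar> \<le> \<bar>v x\<bar>"
  shows "z \<in> L2 L"
  unfolding L2_def
proof (intro CollectI conjI assms)
  show "integrable (Omega_measure L) (\<lambda>x. (z x)\<^sup>2)"
  proof (rule Bochner_Integration.integrable_bound)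
    show "integrable (Omega_measure L) (\<lambda>x. (v x)\<^sup>2)"
      using assms by (auto simp: L2_def)
    show "(\<lambda>x. (z x)\<^sup>2) \<in> borel_measurable (Omega_measure L)"
      using assms by auto
    show "AE x in Omega_measure L. norm ((z x)\<^sup>2) \<le> norm ((v x)\<^sup>2)"
      using assms(3) by eventually_elim (simp add: abs_le_square_iff)
  qed
qed

lemma L2_const [simp]: "(\<lambda>x. c) \<in> L2 L"
  by (simp add: L2_def)

lemma L2_add: 
  assumes "z \<in> L2 L" "v \<in> L2 L" shows "(\<lambda>x. z x + v x) \<in> L2 L"
proof -
  have "(\<lambda>x. (z x + v x)\<^sup>2) = (\<lambda>x. (z x)\<^sup>2 + (v x)\<^sup>2 + 2 * (z x * v x))"
    by (auto simp: power2_eq_square algebra_simps)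
  then show ?thesis
    using assms integrable_mult_L2[OF assms] by (auto simp: L2_def)
qed

lemma L2_cmult: 
  assumes "z \<in> L2 L" shows "(\<lambda>x. c * z x) \<in> L2 L"
  using assms by (auto simp: L2_def power_mult_distrib)

lemma L2_diff: 
  assumes "z \<in> L2 L" "v \<in> L2 L" shows "(\<lambda>x. z x - v x) \<in> L2 L"
  using L2_add[OF assms(1) L2_cmult[OF assms(2), of "-1"]] by simp

lemma L2_abs: 
  assumes "z \<in> L2 L" shows "(\<lambda>x. \<bar>z x\<bar>) \<in> L2 L"
  using assms by (auto simp: L2_def)

lemma L2_integrable:
  assumes "z \<in> L2 L" shows "integrable (Omega_measure L) z"
  using integrable_mult_L2[OF assms L2_const[of 1]] by simp

text \<open>The Lebesgue measure is complete, so measurability is inherited by any function that agrees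
  almost everywhere with a measurable one.\<close>

lemma measurable_AE_Omega:
  assumes "v \<in> borel_measurable (Omega_measure L)" "AE x in Omega_measure L. z x = v x"
  shows "(z :: real \<Rightarrow> real) \<in> borel_measurable (Omega_measure L)"
proof -
  let ?S = "{-L<..<L}"
  have "(\<lambda>x. if x \<in> ?S then v x else 0) \<in> borel_measurable lebesgue"
    using assms(1) borel_measurable_if_lebesgue_on[of ?S UNIV v] by (simp add: lebesgue_on_UNIV_eq)
  moreover have "AE x in lebesgue. (if x \<in> ?S then v x else 0) = (if x \<in> ?S then z x else 0)"
    using assms(2) by (subst (asm) AE_restrict_space_iff) (auto elim!: eventually_mono)
  ultimately have "(\<lambda>x. if x \<in> ?S then z x else 0) \<in> borel_measurable lebesgue"
    by (rule borel_measurable_AE)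
  then show ?thesis
    using borel_measurable_if_lebesgue_on[of ?S UNIV z] by (simp add: lebesgue_on_UNIV_eq)
qed

lemma L2_cong_AE:
  assumes "z \<in> L2 L" "AE x in Omega_measure L. v x = z x"
  shows "v \<in> L2 L"
  by (rule L2_dominated[OF measurable_AE_Omega[OF L2_measurable[OF assms(1)] assms(2)] assms(1)])
    (use assms(2) in eventually_elim, simp)

lemma L2_bounded:
  assumes "z \<in> borel_measurable (Omega_measure L)" "AE x in Omega_measure L. \<bar>z x\<bar> \<le> B"
  shows "z \<in> L2 L"
  by (rule L2_dominated[OF assms(1) L2_const[of B]]) (use assms(2) in eventually_elim, simp)

lemma L2_bounded_mult:
  assumes "z \<in> borel_measurable (Omega_measure L)" "AE x in Omega_measure L. \<bar>z x\<bar> \<le> B" 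
    "v \<in> L2 L"
  shows "(\<lambda>x. z x * v x) \<in> L2 L"
proof (rule L2_dominated[OF _ L2_cmult[OF assms(3), of B]])
  show "(\<lambda>x. z x * v x) \<in> borel_measurable (Omega_measure L)"
    using assms by (auto simp: L2_def)
  show "AE x in Omega_measure L. \<bar>z x * v x\<bar> \<le> \<bar>B * v x\<bar>"
    using assms(2) by eventually_elim (auto simp: abs_mult intro!: mult_right_mono)
qed

lemma continuous_on_Icc_bounded:
  fixes p :: "real \<Rightarrow> real"
  assumes "continuous_on {a..b} p"
  obtains B where "\<And>x. x \<in> {a..b} \<Longrightarrow> \<bar>p x\<bar> \<le> B"
proof -
  have "bounded (p ` {a..b})"
    by (intro compact_imp_bounded compact_continuous_image assms) auto
  then show thesis
    using that unfolding bounded_iff by (metis imageI real_norm_def)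
qed

lemma L2_continuous:
  assumes "continuous_on {-L..L} p"
  shows "p \<in> L2 L"
proof -
  obtain B where "\<And>x. x \<in> {-L..L} \<Longrightarrow> \<bar>p x\<bar> \<le> B"
    by (rule continuous_on_Icc_bounded[OF assms]) blast
  then have "AE x in Omega_measure L. \<bar>p x\<bar> \<le> B"
    by (intro AE_I2) auto
  then show ?thesis
    by (intro L2_bounded measurable_continuous_on_Omega assms)
qed

lemma L2_mult_continuous:
  assumes "continuous_on {-L..L} p" "v \<in> L2 L"
  shows "(\<lambda>t. p t * v t) \<in> L2 L"
proof -
  obtain B where "\<And>x. x \<in> {-L..L} \<Longrightarrow> \<bar>p x\<bar> \<le> B"
    by (rule continuous_on_Icc_bounded[OF assms(1)]) blast
  then show ?thesis
    by (intro L2_bounded_mult[OF measurable_continuous_on_Omega[OF assms(1)] _ assms(2), of B] AE_I2) auto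
qed

definition L2_norm :: "real \<Rightarrow> (real \<Rightarrow> real) \<Rightarrow> real" where
  "L2_norm L z = sqrt (L2_inner L z z)"

lemma L2_inner_commute: "L2_inner L z v = L2_inner L v z"
  by (simp add: L2_inner_def mult.commute)

lemma L2_inner_cong_AE:
  assumes "AE x in Omega_measure L. z x = z' x" "AE x in Omega_measure L. v x = v' x"
  shows "L2_inner L z v = L2_inner L z' v'"
proof -
  have AE: "AE x in Omega_measure L. z x * v x = z' x * v' x"
    using assms by eventually_elim simp
  show ?thesis
  proof (cases "(\<lambda>x. z' x * v' x) \<in> borel_measurable (Omega_measure L)")
    case True
    with AE show ?thesis
      unfolding L2_inner_def using measurable_AE_Omega[OF True AE] by (intro integral_cong_AE)
  next
    case False
    moreover have "AE x in Omega_measure L. z' x * v' x = z x * v x"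
      using AE by eventually_elim simp
    ultimately have "(\<lambda>x. z x * v x) \<notin> borel_measurable (Omega_measure L)"
      using measurable_AE_Omega[of "\<lambda>x. z x * v x" L "\<lambda>x. z' x * v' x"] by auto
    with False have "\<not> integrable (Omega_measure L) (\<lambda>x. z x * v x)"
      "\<not> integrable (Omega_measure L) (\<lambda>x. z' x * v' x)"
      by (auto dest: borel_measurable_integrable)
    then show ?thesis
      by (simp add: L2_inner_def not_integrable_integral_eq)
  qed
qed

lemma L2_inner_add_left:
  assumes "z \<in> L2 L" "z' \<in> L2 L" "v \<in> L2 L"
  shows "L2_inner L (\<lambda>x. z x + z' x) v = L2_inner L z v + L2_inner L z' v"
  using assms by (simp add: L2_inner_def distrib_right integrable_mult_L2)

lemma L2_inner_diff_left:
  assumes "z \<in> L2 L" "z' \<in> L2 L" "v \<in> L2 L"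
  shows "L2_inner L (\<lambda>x. z x - z' x) v = L2_inner L z v - L2_inner L z' v"
  using assms by (simp add: L2_inner_def left_diff_distrib integrable_mult_L2)

lemma L2_inner_cmult_left: "L2_inner L (\<lambda>x. c * z x) v = c * L2_inner L z v"
  by (simp add: L2_inner_def mult.assoc)

lemma L2_inner_add_right:
  assumes "z \<in> L2 L" "v \<in> L2 L" "v' \<in> L2 L"
  shows "L2_inner L z (\<lambda>x. v x + v' x) = L2_inner L z v + L2_inner L z v'"
  using assms by (simp add: L2_inner_def distrib_left integrable_mult_L2)

lemma L2_inner_diff_right:
  assumes "z \<in> L2 L" "v \<in> L2 L" "v' \<in> L2 L"
  shows "L2_inner L z (\<lambda>x. v x - v' x) = L2_inner L z v - L2_inner L z v'"
  using assms by (simp add: L2_inner_def right_diff_distrib integrable_mult_L2)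

lemma L2_inner_cmult_right: "L2_inner L z (\<lambda>x. c * v x) = c * L2_inner L z v"
  using L2_inner_cmult_left by (simp add: L2_inner_commute)

lemma L2_inner_self_nonneg [simp]: "0 \<le> L2_inner L z z"
  by (simp add: L2_inner_def)

lemma L2_norm_nonneg [simp]: "0 \<le> L2_norm L z"
  by (simp add: L2_norm_def)

lemma L2_norm_square: "(L2_norm L z)\<^sup>2 = L2_inner L z z"
  by (simp add: L2_norm_def)

lemma L2_norm_cmult: "L2_norm L (\<lambda>x. c * z x) = \<bar>c\<bar> * L2_norm L z"
proof -
  have "L2_inner L (\<lambda>x. c * z x) (\<lambda>x. c * z x) = c\<^sup>2 * L2_inner L z z"
    by (simp add: L2_inner_cmult_left L2_inner_cmult_right power2_eq_square)
  then show ?thesis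
    by (simp add: L2_norm_def real_sqrt_mult)
qed

lemma L2_norm_abs: "L2_norm L (\<lambda>x. \<bar>z x\<bar>) = L2_norm L z"
  by (simp add: L2_norm_def L2_inner_def)

lemma L2_norm_diff_commute: "L2_norm L (\<lambda>x. z x - v x) = L2_norm L (\<lambda>x. v x - z x)"
  using L2_norm_cmult[of L "-1" "\<lambda>x. z x - v x"] by simp

lemma L2_norm_const: 
  assumes "0 < L" shows "L2_norm L (\<lambda>x. c) = \<bar>c\<bar> * sqrt (2 * L)"
  using assms by (simp add: L2_norm_def L2_inner_def measure_restrict_space real_sqrt_mult)

lemma L2_norm_add_square:
  assumes "z \<in> L2 L" "v \<in> L2 L"
  shows "(L2_norm L (\<lambda>x. z x + v x))\<^sup>2 = (L2_norm L z)\<^sup>2 + 2 * L2_inner L z v + (L2_norm L v)\<^sup>2"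
  unfolding L2_norm_square using assms L2_inner_commute[of L v z]
  by (simp add: L2_inner_add_left L2_inner_add_right L2_add)

lemma L2_norm_diff_square:
  assumes "z \<in> L2 L" "v \<in> L2 L"
  shows "(L2_norm L (\<lambda>x. z x - v x))\<^sup>2 = (L2_norm L z)\<^sup>2 - 2 * L2_inner L z v + (L2_norm L v)\<^sup>2"
  unfolding L2_norm_square using assms L2_inner_commute[of L v z]
  by (simp add: L2_inner_diff_left L2_inner_diff_right L2_diff)

lemma L2_Cauchy_Schwarz:
  assumes "z \<in> L2 L" "v \<in> L2 L"
  shows "\<bar>L2_inner L z v\<bar> \<le> L2_norm L z * L2_norm L v"
proof -
  let ?a = "L2_norm L z" and ?b = "L2_inner L z v" and ?c = "L2_norm L v"
  have nonneg: "0 \<le> ?a\<^sup>2 - 2 * t * ?b + t\<^sup>2 * ?c\<^sup>2" for t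
    using L2_norm_diff_square[OF assms(1) L2_cmult[OF assms(2), of t]]
      zero_le_power2[of "L2_norm L (\<lambda>x. z x - t * v x)"]
    by (simp add: L2_inner_cmult_right L2_norm_cmult power_mult_distrib)
  have "?b\<^sup>2 \<le> (?a * ?c)\<^sup>2"
  proof (cases "?c = 0")
    case True
    have "?b = 0"
    proof (rule ccontr)
      assume "?b \<noteq> 0"
      then show False
        using nonneg[of "(?a\<^sup>2 + 1) / (2 * ?b)"] True by simp
    qed
    then show ?thesis by simp
  next
    case False
    then have "0 \<le> ?a\<^sup>2 - ?b\<^sup>2 / ?c\<^sup>2"
      using nonneg[of "?b / ?c\<^sup>2"] by (simp add: power2_eq_square field_simps)
    then show ?thesis
      using False by (simp add: field_simps power_mult_distrib)
  qed
  then show ?thesis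
    by (metis L2_norm_nonneg abs_le_square_iff abs_of_nonneg mult_nonneg_nonneg)
qed

lemma L2_norm_triangle:
  assumes "z \<in> L2 L" "v \<in> L2 L"
  shows "L2_norm L (\<lambda>x. z x + v x) \<le> L2_norm L z + L2_norm L v"
proof (rule power2_le_imp_le)
  show "(L2_norm L (\<lambda>x. z x + v x))\<^sup>2 \<le> (L2_norm L z + L2_norm L v)\<^sup>2"
    using L2_Cauchy_Schwarz[OF assms] by (simp add: L2_norm_add_square[OF assms] power2_sum)
qed simp

lemma L2_norm_triangle_diff:
  assumes "z \<in> L2 L" "v \<in> L2 L"
  shows "L2_norm L (\<lambda>x. z x - v x) \<le> L2_norm L z + L2_norm L v"
  using L2_norm_triangle[OF assms(1) L2_cmult[OF assms(2), of "-1"]] L2_norm_cmult[of L "-1" v]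
  by simp

lemma L2_norm_mono:
  assumes "z \<in> borel_measurable (Omega_measure L)" "v \<in> L2 L"
    "AE x in Omega_measure L. \<bar>z x\<bar> \<le> \<bar>v x\<bar>"
  shows "L2_norm L z \<le> L2_norm L v"
proof -
  have "z \<in> L2 L"
    using assms by (rule L2_dominated)
  then have "L2_inner L z z \<le> L2_inner L v v"
    unfolding L2_inner_def
  proof (intro integral_mono_AE integrable_mult_L2 assms)
    show "AE x in Omega_measure L. z x * z x \<le> v x * v x"
      using assms(3) by eventually_elim (metis abs_le_square_iff power2_eq_square)
  qed
  then show ?thesis
    by (simp add: L2_norm_def)
qed

lemma L2_norm_eq_0_AE:
  assumes "z \<in> L2 L" "L2_norm L z = 0"
  shows "AE x in Omega_measure L. z x = 0"
proof -
  have "(\<integral>x. z x * z x \<partial>Omega_measure L) = 0"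
    using assms(2) by (simp add: L2_norm_def L2_inner_def)
  then show ?thesis
    using integral_nonneg_eq_0_iff_AE[OF integrable_mult_L2[OF assms(1,1)]] by simp
qed

lemma L2_integral_abs_le:
  assumes "0 < L" "z \<in> L2 L"
  shows "(\<integral>x. \<bar>z x\<bar> \<partial>Omega_measure L) \<le> L2_norm L z * sqrt (2 * L)"
  using L2_Cauchy_Schwarz[OF L2_abs[OF assms(2)] L2_const[of 1]] assms(1)
  by (simp add: L2_norm_abs L2_norm_const L2_inner_def)

text \<open>The error splits into \<open>(h m, v m - v0)\<close>, which the bound on the norms of \<open>h m\<close> makes small, and
  \<open>(h m - h0, v0)\<close>, which weak convergence makes small.\<close>

lemma L2_inner_weak_strong:
  assumes h: "\<And>m. h m \<in> L2 L" "h0 \<in> L2 L" "\<And>v. v \<in> L2 L \<Longrightarrow> (\<lambda>m. L2_inner L (h m) v) \<longlonglongrightarrow> L2_inner L h0 v"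
    and bound: "\<And>m. L2_norm L (h m) \<le> B"
    and v: "\<And>m. v m \<in> L2 L" "v0 \<in> L2 L" "(\<lambda>m. L2_norm L (\<lambda>x. v m x - v0 x)) \<longlonglongrightarrow> 0"
  shows "(\<lambda>m. L2_inner L (h m) (v m)) \<longlonglongrightarrow> L2_inner L h0 v0"
proof -
  have "(\<lambda>m. L2_inner L (h m) (\<lambda>x. v m x - v0 x)) \<longlonglongrightarrow> 0"
  proof (rule Lim_null_comparison)
    show "\<forall>\<^sub>F m in sequentially. norm (L2_inner L (h m) (\<lambda>x. v m x - v0 x)) \<le> 
        B * L2_norm L (\<lambda>x. v m x - v0 x)"
      using order_trans[OF L2_Cauchy_Schwarz[OF h(1) L2_diff[OF v(1,2)]] 
          mult_right_mono[OF bound L2_norm_nonneg]] by (auto intro!: always_eventually)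
    show "(\<lambda>m. B * L2_norm L (\<lambda>x. v m x - v0 x)) \<longlonglongrightarrow> 0"
      using tendsto_mult_right_zero[OF v(3)] .
  qed
  from tendsto_add[OF this h(3)[OF v(2)]] show ?thesis
    by (simp add: L2_inner_diff_right h v)
qed


section \<open>Completeness, weak limits and uniform boundedness\<close>

text \<open>Fatou's lemma for the squares: balls are closed under convergence almost everywhere.\<close>

lemma L2_tendsto_norm_le:
  assumes s: "\<And>k. s k \<in> L2 L" and z: "z \<in> borel_measurable (Omega_measure L)"
    and lim: "AE x in Omega_measure L. (\<lambda>k. s k x) \<longlonglongrightarrow> z x"
    and bound: "\<forall>\<^sub>F k in sequentially. L2_norm L (s k) \<le> B"
  shows "z \<in> L2 L" "L2_norm L z \<le> B"
proof -
  have nn: "(\<integral>\<^sup>+x. ennreal ((v x)\<^sup>2) \<partial>Omega_measure L) = ennreal ((L2_norm L v)\<^sup>2)" 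
    if "v \<in> L2 L" for v
    using that unfolding L2_norm_square L2_inner_def
    by (subst nn_integral_eq_integral) (auto simp: L2_def power2_eq_square)
  obtain k where "L2_norm L (s k) \<le> B"
    using bound by (auto simp: eventually_sequentially)
  then have B: "0 \<le> B"
    using L2_norm_nonneg order_trans by blast
  have "(\<integral>\<^sup>+x. ennreal ((z x)\<^sup>2) \<partial>Omega_measure L) = 
      (\<integral>\<^sup>+x. liminf (\<lambda>k. ennreal ((s k x)\<^sup>2)) \<partial>Omega_measure L)"
  proof (intro nn_integral_cong_AE)
    show "AE x in Omega_measure L. ennreal ((z x)\<^sup>2) = liminf (\<lambda>k. ennreal ((s k x)\<^sup>2))"
      using lim
    proof eventually_elim
      case (elim x)
      then have "(\<lambda>k. ennreal ((s k x)\<^sup>2)) \<longlonglongrightarrow> ennreal ((z x)\<^sup>2)"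
        by (intro tendsto_intros)
      then show ?case
        by (intro lim_imp_Liminf[symmetric]) auto
    qed
  qed
  also have "\<dots> \<le> liminf (\<lambda>k. \<integral>\<^sup>+x. ennreal ((s k x)\<^sup>2) \<partial>Omega_measure L)"
    using L2_measurable[OF s] by (intro nn_integral_liminf) auto
  also have "\<dots> \<le> liminf (\<lambda>k. ennreal (B\<^sup>2))"
  proof (rule Liminf_mono)
    show "\<forall>\<^sub>F k in sequentially. (\<integral>\<^sup>+x. ennreal ((s k x)\<^sup>2) \<partial>Omega_measure L) \<le> ennreal (B\<^sup>2)"
      using bound by eventually_elim (auto simp: nn[OF s] intro!: ennreal_leI power_mono)
  qed
  finally have le: "(\<integral>\<^sup>+x. ennreal ((z x)\<^sup>2) \<partial>Omega_measure L) \<le> ennreal (B\<^sup>2)"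
    by (simp add: Liminf_const)
  then show "z \<in> L2 L"
    using z by (auto simp: L2_def integrable_iff_bounded intro: le_less_trans)
  from le[unfolded nn[OF this]] have "(L2_norm L z)\<^sup>2 \<le> B\<^sup>2"
    by (simp add: ennreal_le_iff)
  then show "L2_norm L z \<le> B"
    using B by (rule power2_le_imp_le)
qed

text \<open>The explicit rate of convergence is what the gliding hump argument below requires.\<close>

lemma L2_fast_Cauchy_convergent:
  assumes L: "0 < L" and r: "0 < r" "r < 1" and s: "\<And>k. s k \<in> L2 L"
    and fast: "\<And>k. L2_norm L (\<lambda>x. s (Suc k) x - s k x) \<le> c * r^k"
  shows "\<exists>z\<in>L2 L. \<forall>k. L2_norm L (\<lambda>x. z x - s k x) \<le> c / (1 - r) * r^k"
proof -
  let ?d = "\<lambda>k x. \<bar>s (Suc k) x - s k x\<bar>"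
  have d: "?d k \<in> L2 L" for k
    by (intro L2_abs L2_diff s)
  have c: "0 \<le> c"
    using order_trans[OF L2_norm_nonneg fast[of 0]] by simp
  have sm[measurable]: "s k \<in> borel_measurable (Omega_measure L)" for k
    using s by (rule L2_measurable)
  \<comment> \<open>The increments are summable in \<open>L\<^sup>1\<close>, hence almost everywhere.\<close>
  have "(\<integral>\<^sup>+x. (\<Sum>k. ennreal (?d k x)) \<partial>Omega_measure L) = 
      (\<Sum>k. \<integral>\<^sup>+x. ennreal (?d k x) \<partial>Omega_measure L)"
    by (intro nn_integral_suminf) auto
  also have "\<dots> = (\<Sum>k. ennreal (\<integral>x. ?d k x \<partial>Omega_measure L))"
    using L2_integrable[OF d] by (subst nn_integral_eq_integral) auto
  also have "\<dots> \<le> (\<Sum>k. ennreal (c * sqrt (2 * L) * r^k))"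
  proof (intro suminf_le summableI ennreal_leI)
    fix k
    have "(\<integral>x. ?d k x \<partial>Omega_measure L) \<le> L2_norm L (\<lambda>x. s (Suc k) x - s k x) * sqrt (2 * L)"
      by (intro L2_integral_abs_le L L2_diff s)
    also have "\<dots> \<le> c * r^k * sqrt (2 * L)"
      using L by (intro mult_right_mono fast) auto
    finally show "(\<integral>x. ?d k x \<partial>Omega_measure L) \<le> c * sqrt (2 * L) * r^k"
      by (simp add: mult_ac)
  qed
  also have "\<dots> < \<infinity>"
    using c L r by (subst suminf_ennreal2) (auto intro!: summable_mult summable_geometric)
  finally have "AE x in Omega_measure L. (\<Sum>k. ennreal (?d k x)) \<noteq> \<infinity>"
    by (intro nn_integral_noteq_infinite) auto
  then have lim: "AE x in Omega_measure L. (\<lambda>k. s k x) \<longlonglongrightarrow> lim (\<lambda>k. s k x)"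
  proof eventually_elim
    case (elim x)
    then have "summable (\<lambda>k. ?d k x)"
      by (intro summable_suminf_not_top) (auto simp: top_ennreal_def)
    then have "summable (\<lambda>k. s (Suc k) x - s k x)"
      by (rule summable_rabs_cancel)
    then have "convergent (\<lambda>n. \<Sum>k<n. s (Suc k) x - s k x)"
      by (simp add: summable_iff_convergent)
    then have "convergent (\<lambda>n. s n x - s 0 x)"
      by (simp only: sum_lessThan_telescope[of "\<lambda>n. s n x"])
    then show ?case
      by (simp add: convergent_diff_const_right_iff convergent_LIMSEQ_iff)
  qed
  define z where "z = (\<lambda>x. lim (\<lambda>k. s k x))"
  have zm: "z \<in> borel_measurable (Omega_measure L)"
    unfolding z_def by measurable
  have step: "L2_norm L (\<lambda>x. s (k + j) x - s k x) \<le> c / (1 - r) * (r^k - r^(k+j))" for k j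
  proof (induction j)
    case 0
    show ?case by (simp add: L2_norm_const[OF L])
  next
    case (Suc j)
    have "L2_norm L (\<lambda>x. s (k + Suc j) x - s k x) = 
        L2_norm L (\<lambda>x. (s (Suc (k + j)) x - s (k + j) x) + (s (k + j) x - s k x))"
      by simp
    also have "\<dots> \<le> c * r^(k+j) + c / (1 - r) * (r^k - r^(k+j))"
      by (intro order_trans[OF L2_norm_triangle] L2_diff s add_mono fast Suc)
    finally show ?case using r by (simp add: field_simps)
  qed
  have "(\<lambda>x. z x - s k x) \<in> L2 L \<and> L2_norm L (\<lambda>x. z x - s k x) \<le> c / (1 - r) * r^k" for k
  proof -
    have AE: "AE x in Omega_measure L. (\<lambda>j. s (k + j) x - s k x) \<longlonglongrightarrow> z x - s k x"
      using lim
    proof eventually_elim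
      case (elim x)
      then have "(\<lambda>j. s (j + k) x) \<longlonglongrightarrow> z x"
        unfolding z_def by (rule LIMSEQ_ignore_initial_segment)
      then show ?case
        by (intro tendsto_intros) (simp add: add.commute)
    qed
    have "L2_norm L (\<lambda>x. s (k + j) x - s k x) \<le> c / (1 - r) * r^k" for j
    proof -
      have "0 \<le> c / (1 - r) * r^(k+j)"
        using c r by simp
      then show ?thesis
        using step[of k j] unfolding right_diff_distrib by linarith
    qed
    then have bound: "\<forall>\<^sub>F j in sequentially. L2_norm L (\<lambda>x. s (k + j) x - s k x) \<le> c / (1 - r) * r^k"
      by simp
    show ?thesis
      using zm by (intro conjI L2_tendsto_norm_le[OF _ _ AE bound] L2_diff s) auto
  qed
  moreover from this[of 0] have "z \<in> L2 L"
    using L2_add[OF _ s[of 0], of "\<lambda>x. z x - s 0 x"] by simp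
  ultimately show ?thesis by blast
qed


text \<open>Elements of almost minimal norm in a decreasing sequence of convex sets form a Cauchy sequence, by
  the parallelogram law. This replaces weak compactness: a weak limit of a bounded sequence is obtained
  as a strong limit in the convex sets that describe closeness to the limit.\<close>

lemma L2_nested_midpoint_convex:
  assumes L: "0 < L" and A: "\<And>k. A k \<subseteq> L2 L" and decr: "\<And>k. A (Suc k) \<subseteq> A k"
    and mid: "\<And>k y z. y \<in> A k \<Longrightarrow> z \<in> A k \<Longrightarrow> (\<lambda>x. 1/2 * (y x + z x)) \<in> A k"
    and bound: "\<And>k. \<exists>z\<in>A k. L2_norm L z \<le> C"
  shows "\<exists>s q. q \<in> L2 L \<and> (\<forall>k. s k \<in> A k) \<and> (\<lambda>k. L2_norm L (\<lambda>x. s k x - q x)) \<longlonglongrightarrow> 0"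
proof -
  have decr': "A j \<subseteq> A i" if "i \<le> j" for i j
    using decr that by (rule lift_Suc_antimono_le)
  \<comment> \<open>\<open>D\<close> is the limit of the minimal squared norms of the sets.\<close>
  define S where "S = {c. \<exists>k. \<forall>z\<in>A k. c \<le> (L2_norm L z)\<^sup>2}"
  define D where "D = Sup S"
  have "0 \<in> S"
    by (auto simp: S_def)
  have bdd: "bdd_above S"
  proof (rule bdd_aboveI)
    fix c assume "c \<in> S"
    then obtain k where "\<forall>z\<in>A k. c \<le> (L2_norm L z)\<^sup>2"
      by (auto simp: S_def)
    moreover obtain z where "z \<in> A k" "L2_norm L z \<le> C"
      using bound by blast
    ultimately show "c \<le> C\<^sup>2"
      by (meson L2_norm_nonneg order_trans power_mono)
  qed
  have "\<exists>i. \<forall>z\<in>A i. D - (1/4)^k \<le> (L2_norm L z)\<^sup>2" for k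
  proof -
    obtain c where "c \<in> S" "D - (1/4)^k < c"
      using less_cSupD[of S "D - (1/4)^k"] \<open>0 \<in> S\<close> by (auto simp: D_def)
    then show ?thesis
      unfolding S_def by (auto intro: order_trans[OF less_imp_le])
  qed
  then obtain i where i: "\<And>k z. z \<in> A (i k) \<Longrightarrow> D - (1/4)^k \<le> (L2_norm L z)\<^sup>2"
    by metis
  \<comment> \<open>An increasing choice of indices, so that consecutive elements lie in a common set.\<close>
  define j where "j k = k + (\<Sum>l\<le>k. i l)" for k
  have j: "i k \<le> j k" "k \<le> j k" "j k \<le> j (Suc k)" for k
    unfolding j_def by (auto intro!: trans_le_add2 member_le_sum)
  have "\<exists>z. z \<in> A (j k) \<and> (L2_norm L z)\<^sup>2 \<le> D + (1/4)^k" for k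
  proof (rule ccontr)
    assume "\<not> ?thesis"
    then have "D + (1/4)^k \<in> S"
      unfolding S_def by (auto intro!: exI[of _ "j k"] simp: not_le less_imp_le)
    from cSup_upper[OF this bdd] have "(1/4)^k \<le> (0::real)"
      by (simp add: D_def)
    moreover have "0 < (1/4::real)^k"
      by simp
    ultimately show False
      by linarith
  qed
  then obtain s where s: "\<And>k. s k \<in> A (j k)" "\<And>k. (L2_norm L (s k))\<^sup>2 \<le> D + (1/4)^k"
    by metis
  then have sL: "s k \<in> L2 L" for k
    using A by blast
  have "L2_norm L (\<lambda>x. s (Suc k) x - s k x) \<le> 3 * (1/2)^k" for k
  proof (rule power2_le_imp_le)
    let ?m = "\<lambda>x. 1/2 * (s (Suc k) x + s k x)"
    have "?m \<in> A (i k)"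
      using s(1)[of k] s(1)[of "Suc k"] j[of k] decr' by (intro mid) (meson subsetD order_trans)+
    then have "D - (1/4)^k \<le> (L2_norm L ?m)\<^sup>2"
      by (rule i)
    moreover have "(L2_norm L ?m)\<^sup>2 = 1/4 * (L2_norm L (\<lambda>x. s (Suc k) x + s k x))\<^sup>2"
      unfolding L2_norm_cmult by (simp add: power2_eq_square)
    ultimately have "(L2_norm L (\<lambda>x. s (Suc k) x - s k x))\<^sup>2 \<le> 
        2 * (D + (1/4)^Suc k) + 2 * (D + (1/4)^k) - 4 * (D - (1/4)^k)"
      using s(2)[of k] s(2)[of "Suc k"] 
      unfolding L2_norm_add_square[OF sL sL] L2_norm_diff_square[OF sL sL] by argo
    also have "\<dots> \<le> 9 * (1/4)^k"
      by simp
    also have "\<dots> = (3 * (1/2)^k)\<^sup>2"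
      by (simp add: power_mult_distrib power2_eq_square flip: power_mult_distrib)
    finally show "(L2_norm L (\<lambda>x. s (Suc k) x - s k x))\<^sup>2 \<le> (3 * (1/2)^k)\<^sup>2" .
  qed simp
  from L2_fast_Cauchy_convergent[OF L _ _ sL this] obtain q 
    where q: "q \<in> L2 L" "\<And>k. L2_norm L (\<lambda>x. q x - s k x) \<le> 6 * (1/2)^k"
    by auto
  have "(\<lambda>k. L2_norm L (\<lambda>x. s k x - q x)) \<longlonglongrightarrow> 0"
  proof (rule Lim_null_comparison)
    show "\<forall>\<^sub>F k in sequentially. norm (L2_norm L (\<lambda>x. s k x - q x)) \<le> 6 * (1/2)^k"
      using q(2) L2_norm_diff_commute[of L _ q] by (auto intro!: always_eventually)
    show "(\<lambda>k. 6 * (1/2)^k) \<longlonglongrightarrow> (0::real)"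
      by (intro tendsto_mult_right_zero LIMSEQ_power_zero) auto
  qed
  moreover have "s k \<in> A k" for k
    using s(1) j(2) decr' by blast
  ultimately show ?thesis
    using q(1) by blast
qed

text \<open>The uniform boundedness principle, by a gliding hump: if the norm of \<open>h (m k)\<close> exceeds \<open>8\<^sup>k\<close>,
  then a step of length \<open>(1/4)\<^sup>k\<close> from any point in one of the two directions \<open>\<plusminus>h (m k)\<close> makes
  the functional \<open>h (m k)\<close> large, and the sum of all later steps is too short to undo it.\<close>

lemma L2_weakly_bounded_imp_bounded:
  assumes L: "0 < L" and h: "\<And>m::nat. h m \<in> L2 L"
    and weak: "\<And>v. v \<in> L2 L \<Longrightarrow> Bseq (\<lambda>m. L2_inner L (h m) v)"
  shows "\<exists>B. \<forall>m. L2_norm L (h m) \<le> B"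
proof (rule ccontr)
  assume "\<not> ?thesis"
  then have "\<exists>m. 8^k < L2_norm L (h m)" for k :: nat
    by (auto simp: not_le)
  then obtain m where m: "\<And>k::nat. 8^k < L2_norm L (h (m k))"
    by metis
  define N where "N k = L2_norm L (h (m k))" for k
  have N: "0 < N k" for k
    using m[of k] unfolding N_def by (rule less_trans[rotated]) simp
  have "\<exists>x. \<forall>k. x k \<in> L2 L \<and> (L2_norm L (\<lambda>t. x (Suc k) t - x k t) \<le> (1/4)^k \<and>
      (1/4)^k * N k \<le> \<bar>L2_inner L (h (m k)) (x (Suc k))\<bar>)"
  proof (rule dependent_nat_choice)
    show "\<exists>x. x \<in> L2 L"
      using L2_const by blast
    fix x k assume x: "x \<in> L2 L"
    define c where "c = (if 0 \<le> L2_inner L (h (m k)) x then (1/4)^k / N k else - ((1/4)^k / N k))"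
    let ?y = "\<lambda>t. x t + c * h (m k) t"
    have "L2_norm L (\<lambda>t. ?y t - x t) = (1/4)^k"
      using N[of k] by (simp add: L2_norm_cmult c_def abs_mult flip: N_def)
    moreover have "L2_inner L (h (m k)) ?y = L2_inner L (h (m k)) x + c * (N k)\<^sup>2"
      using x h by (simp add: L2_inner_add_right L2_inner_cmult_right L2_cmult N_def L2_norm_square)
    then have "(1/4)^k * N k \<le> \<bar>L2_inner L (h (m k)) ?y\<bar>"
      using N[of k] by (auto simp: c_def power2_eq_square)
    ultimately show "\<exists>y. y \<in> L2 L \<and> L2_norm L (\<lambda>t. y t - x t) \<le> (1/4)^k \<and>
        (1/4)^k * N k \<le> \<bar>L2_inner L (h (m k)) y\<bar>"
      using x h by (intro exI[of _ ?y]) (auto intro!: L2_add L2_cmult)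
  qed
  then obtain x where x: "\<And>k. x k \<in> L2 L" "\<And>k. L2_norm L (\<lambda>t. x (Suc k) t - x k t) \<le> 1 * (1/4)^k"
    "\<And>k. (1/4)^k * N k \<le> \<bar>L2_inner L (h (m k)) (x (Suc k))\<bar>"
    by auto
  obtain v where v: "v \<in> L2 L" "\<And>k. L2_norm L (\<lambda>t. v t - x k t) \<le> 1 / (1 - 1/4) * (1/4)^k"
    using L2_fast_Cauchy_convergent[OF L _ _ x(1,2)] by auto
  obtain B where B: "\<And>m. \<bar>L2_inner L (h m) v\<bar> \<le> B"
    using weak[OF v(1)] by (auto simp: Bseq_def)
  have "2^k \<le> 3/2 * B" for k :: nat
  proof -
    let ?h = "h (m k)"
    have "\<bar>L2_inner L ?h (\<lambda>t. v t - x (Suc k) t)\<bar> \<le> N k * (1 / (1 - 1/4) * (1/4)^Suc k)"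
      unfolding N_def
      by (intro order_trans[OF L2_Cauchy_Schwarz] mult_left_mono v(2) h L2_diff v(1) x(1)) simp
    then have "\<bar>L2_inner L ?h v - L2_inner L ?h (x (Suc k))\<bar> \<le> 1/3 * ((1/4)^k * N k)"
      using h v x by (simp add: L2_inner_diff_right mult.commute)
    then have "2/3 * ((1/4)^k * N k) \<le> B"
      using x(3)[of k] B[of "m k"] by linarith
    moreover have "2^k = (1/4)^k * (8::real)^k"
      by (simp flip: power_mult_distrib)
    then have "2^k \<le> (1/4)^k * N k"
      using m[of k] by (simp add: N_def)
    ultimately show ?thesis
      by linarith
  qed
  then show False
    using real_arch_pow[of 2 "3/2 * B"] by (auto simp: not_less[symmetric])
qed

section \<open>Primitives of square integrable functions\<close>

text \<open>The primitive that vanishes at \<open>-L\<close>. As an inner product with an indicator function it inherits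
  linearity and the Cauchy-Schwarz inequality.\<close>

definition prim :: "real \<Rightarrow> (real \<Rightarrow> real) \<Rightarrow> real \<Rightarrow> real" where
  "prim L v x = L2_inner L (indicator {..<x}) v"

lemma L2_indicator:
  fixes A :: "real set"
  assumes "A \<in> sets borel"
  shows "(indicator A :: real \<Rightarrow> real) \<in> L2 L"
proof (rule L2_bounded)
  have "indicator A \<in> borel_measurable (borel :: real measure)"
    using assms by simp
  from measurable_compose[OF Omega_measurable_id this]
  show "(indicator A :: real \<Rightarrow> real) \<in> borel_measurable (Omega_measure L)" .
  show "AE x in Omega_measure L. \<bar>indicator A x :: real\<bar> \<le> 1"
    by (auto simp: indicator_def)
qed

lemma L2_norm_indicator:
  assumes "x \<le> y" "-L \<le> x" "y \<le> L"
  shows "L2_norm L (indicator {x..<y}) = sqrt (y - x)"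
proof -
  have sets: "{x..<y} \<inter> {-L<..<L} \<in> sets lebesgue"
    by (metis lmeasurable_interval sets.Int sets_completionI_sets borel_singleton
        atLeastLessThan_borel greaterThanLessThan_borel sets_lborel)
  have "L2_inner L (indicator {x..<y}) (indicator {x..<y}) = 
      (\<integral>t. indicator {x..<y} t \<partial>Omega_measure L)"
    unfolding L2_inner_def by (intro Bochner_Integration.integral_cong) (auto simp: indicator_def)
  also have "\<dots> = measure (Omega_measure L) ({x..<y} \<inter> {-L<..<L})"
    by (subst Bochner_Integration.integral_indicator) auto
  also have "\<dots> = measure lebesgue ({x..<y} \<inter> {-L<..<L})"
    by (subst measure_restrict_space) auto
  also have "\<dots> = measure lebesgue {x<..<y}"
  proof (rule measure_eq_AE)
    show "AE t in lebesgue. (t \<in> {x..<y} \<inter> {-L<..<L}) = (t \<in> {x<..<y})"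
    proof -
      have "AE t in lebesgue. t \<noteq> x"
        by (rule AE_completion) (rule AE_lborel_singleton)
      then show ?thesis
        by eventually_elim (use assms in auto)
    qed
  qed (use sets in auto)
  also have "\<dots> = y - x"
    using assms by simp
  finally show ?thesis
    by (simp add: L2_norm_def)
qed

lemma prim_add: "v \<in> L2 L \<Longrightarrow> w \<in> L2 L \<Longrightarrow> prim L (\<lambda>x. v x + w x) x = prim L v x + prim L w x"
  by (simp add: prim_def L2_inner_add_right L2_indicator)

lemma prim_diff: "v \<in> L2 L \<Longrightarrow> w \<in> L2 L \<Longrightarrow> prim L (\<lambda>x. v x - w x) x = prim L v x - prim L w x"
  by (simp add: prim_def L2_inner_diff_right L2_indicator)

lemma prim_cmult: "prim L (\<lambda>x. c * v x) x = c * prim L v x"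
  by (simp add: prim_def L2_inner_cmult_right)

lemma prim_cong_AE: "AE x in Omega_measure L. v x = w x \<Longrightarrow> prim L v x = prim L w x"
  unfolding prim_def by (intro L2_inner_cong_AE) auto

lemma prim_eq_0_left: 
  assumes "x \<le> -L" shows "prim L v x = 0"
proof -
  have "prim L v x = (\<integral>t. 0 \<partial>Omega_measure L)"
    unfolding prim_def L2_inner_def 
    using assms by (intro Bochner_Integration.integral_cong) (auto simp: indicator_def)
  then show ?thesis by simp
qed

lemma prim_right: 
  assumes "L \<le> x" shows "prim L v x = (\<integral>t. v t \<partial>Omega_measure L)"
  unfolding prim_def L2_inner_def 
  using assms by (intro Bochner_Integration.integral_cong) (auto simp: indicator_def)

lemma prim_increment:
  assumes "v \<in> L2 L" "x \<le> y"
  shows "prim L v y - prim L v x = L2_inner L (indicator {x..<y}) v"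
proof -
  have "indicator {..<y} = (\<lambda>t. indicator {x..<y} t + (indicator {..<x} t :: real))"
    using assms(2) by (auto simp: indicator_def)
  then show ?thesis
    using assms(1) by (simp add: prim_def L2_inner_add_left L2_indicator)
qed

lemma prim_const:
  assumes "-L \<le> x" "x \<le> y" "y \<le> L"
  shows "prim L (\<lambda>t. c) y - prim L (\<lambda>t. c) x = c * (y - x)"
proof -
  have "L2_inner L (indicator {x..<y}) (\<lambda>t. c * 1) = 
      c * L2_inner L (indicator {x..<y}) (\<lambda>t. 1)"
    by (rule L2_inner_cmult_right)
  also have "L2_inner L (indicator {x..<y}) (\<lambda>t. 1) = 
      L2_inner L (indicator {x..<y}) (indicator {x..<y})"
    unfolding L2_inner_def by (intro Bochner_Integration.integral_cong) (auto simp: indicator_def)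
  also have "\<dots> = y - x"
    using L2_norm_square[of L "indicator {x..<y}"] assms by (simp add: L2_norm_indicator)
  finally show ?thesis
    using assms by (simp add: prim_increment)
qed

lemma prim_Hoelder_le:
  assumes "v \<in> L2 L" "x \<le> y"
  shows "\<bar>prim L v y - prim L v x\<bar> \<le> L2_norm L v * sqrt (y - x)"
proof -
  \<comment> \<open>The primitive is constant outside of the interval, so the points may be moved into it.\<close>
  define x' y' where "x' = min L (max (-L) x)" and "y' = min L (max (-L) y)"
  have clip: "prim L v t = prim L v (min L (max (-L) t))" for t
    using prim_eq_0_left[of t L v] prim_eq_0_left[of "-L" L v] prim_eq_0_left[of L L v] 
      prim_right[of L t v] prim_right[of L L v]
    by (auto simp: min_def max_def prim_eq_0_left)
  show ?thesis
  proof (cases "0 \<le> L")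
    case True
    have xy: "x' \<le> y'" "-L \<le> x'" "y' \<le> L" "y' - x' \<le> y - x"
      using assms(2) True by (auto simp: x'_def y'_def)
    have "\<bar>prim L v y' - prim L v x'\<bar> \<le> L2_norm L v * sqrt (y' - x')"
      using L2_Cauchy_Schwarz[OF L2_indicator[of "{x'..<y'}"] assms(1)] xy
      by (simp add: prim_increment[OF assms(1)] L2_norm_indicator mult.commute)
    also have "\<dots> \<le> L2_norm L v * sqrt (y - x)"
      using xy by (intro mult_left_mono) auto
    finally show ?thesis
      using clip[of x] clip[of y] by (simp add: x'_def y'_def)
  next
    case False
    then have "prim L v t = 0" for t
      by (simp add: prim_def L2_inner_def)
    then show ?thesis
      using assms by simp
  qed
qed

lemma prim_Hoelder:
  assumes "v \<in> L2 L"
  shows "\<bar>prim L v x - prim L v y\<bar> \<le> L2_norm L v * sqrt \<bar>x - y\<bar>"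
  using prim_Hoelder_le[OF assms, of x y] prim_Hoelder_le[OF assms, of y x]
  by (cases "x \<le> y") (auto simp: abs_minus_commute)

lemma prim_bound:
  assumes "v \<in> L2 L" "x \<in> {-L..L}"
  shows "\<bar>prim L v x\<bar> \<le> L2_norm L v * sqrt (2 * L)"
proof -
  have "\<bar>prim L v x\<bar> \<le> L2_norm L v * sqrt \<bar>x - (- L)\<bar>"
    using prim_Hoelder[OF assms(1), of x "-L"] by (simp add: prim_eq_0_left)
  also have "\<dots> \<le> L2_norm L v * sqrt (2 * L)"
    using assms(2) by (intro mult_left_mono) auto
  finally show ?thesis .
qed

lemma prim_continuous: 
  assumes "v \<in> L2 L" shows "continuous_on S (prim L v)"
proof (rule continuous_on_subset[OF _ subset_UNIV], unfold continuous_on_def, intro ballI)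
  fix x
  have "((\<lambda>y. prim L v y - prim L v x) \<longlongrightarrow> 0) (at x)"
  proof (rule Lim_null_comparison)
    show "\<forall>\<^sub>F y in at x. norm (prim L v y - prim L v x) \<le> L2_norm L v * sqrt \<bar>y - x\<bar>"
      using prim_Hoelder[OF assms] by simp
    have "((\<lambda>y. L2_norm L v * sqrt \<bar>y - x\<bar>) \<longlongrightarrow> L2_norm L v * sqrt \<bar>x - x\<bar>) (at x)"
      by (intro tendsto_intros)
    then show "((\<lambda>y. L2_norm L v * sqrt \<bar>y - x\<bar>) \<longlongrightarrow> 0) (at x)"
      by simp
  qed
  then show "(prim L v \<longlongrightarrow> prim L v x) (at x within UNIV)"
    by (simp add: LIM_zero_iff)
qed

lemma prim_L2: "v \<in> L2 L \<Longrightarrow> prim L v \<in> L2 L"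
  by (rule L2_continuous[OF prim_continuous])

lemma prim_has_real_derivative:
  assumes "continuous_on {-L..L} v" "x \<in> {-L..L}"
  shows "(prim L v has_real_derivative v x) (at x within {-L..L})"
  unfolding has_field_derivative_def has_derivative_within_alt
proof (intro conjI allI impI)
  show "bounded_linear ((*) (v x))"
    by (rule bounded_linear_mult_right)
  fix e :: real assume "0 < e"
  then obtain d where d: "0 < d" "\<And>t. t \<in> {-L..L} \<Longrightarrow> \<bar>t - x\<bar> < d \<Longrightarrow> \<bar>v t - v x\<bar> \<le> e"
    using assms unfolding continuous_on_iff dist_real_def by (meson less_imp_le)
  have main: "\<bar>prim L v b - prim L v a - v x * (b - a)\<bar> \<le> e * (b - a)"
    if ab: "a \<le> b" "{a..b} \<subseteq> {-L..L}" "\<And>t. t \<in> {a..b} \<Longrightarrow> \<bar>t - x\<bar> < d" for a b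
  proof -
    have v: "v \<in> L2 L"
      using assms by (intro L2_continuous)
    have "\<bar>L2_inner L (indicator {a..<b}) (\<lambda>t. v t - v x)\<bar> \<le> 
        (\<integral>t. \<bar>indicator {a..<b} t * (v t - v x)\<bar> \<partial>Omega_measure L)"
      unfolding L2_inner_def by (rule integral_abs_bound)
    also have "\<dots> \<le> (\<integral>t. indicator {a..<b} t * e \<partial>Omega_measure L)"
    proof (rule integral_mono)
      show "integrable (Omega_measure L) (\<lambda>t. \<bar>indicator {a..<b} t * (v t - v x)\<bar>)"
        by (intro integrable_abs integrable_mult_L2 L2_indicator L2_diff v) auto
      show "integrable (Omega_measure L) (\<lambda>t. indicator {a..<b} t * e)"
        by (intro integrable_mult_L2 L2_indicator) auto
      fix t assume "t \<in> space (Omega_measure L)"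
      then show "\<bar>indicator {a..<b} t * (v t - v x)\<bar> \<le> indicator {a..<b} t * e"
        using ab d(2)[of t] by (auto simp: indicator_def)
    qed
    also have "\<dots> = L2_inner L (indicator {a..<b}) (\<lambda>t. e)"
      by (simp add: L2_inner_def)
    finally have "\<bar>(prim L v b - prim L v a) - (prim L (\<lambda>t. v x) b - prim L (\<lambda>t. v x) a)\<bar> \<le> 
        prim L (\<lambda>t. e) b - prim L (\<lambda>t. e) a"
      using v ab(1) by (simp add: prim_increment L2_inner_diff_right L2_indicator)
    then show ?thesis
      using ab by (simp add: prim_const)
  qed
  show "\<exists>d>0. \<forall>y\<in>{-L..L}. norm (y - x) < d \<longrightarrow>
      norm (prim L v y - prim L v x - v x * (y - x)) \<le> e * norm (y - x)"
  proof (intro exI[of _ d] conjI ballI impI d(1))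
    fix y assume y: "y \<in> {-L..L}" "norm (y - x) < d"
    show "norm (prim L v y - prim L v x - v x * (y - x)) \<le> e * norm (y - x)"
    proof (cases "x \<le> y")
      case True
      then show ?thesis
        using main[of x y] y assms(2) by auto
    next
      case False
      then have "\<bar>prim L v x - prim L v y - v x * (x - y)\<bar> \<le> e * (x - y)"
        using y assms(2) by (intro main) auto
      then show ?thesis
        using False by (simp add: algebra_simps abs_if split: if_splits)
    qed
  qed
qed

text \<open>Subdivision into short intervals and summation bound the increment of \<open>E\<close> by every positive multiple
  of that of \<open>A\<close>. The chain rule is proved in this way.\<close>

lemma const_if_locally_small_increments:
  fixes E A :: "real \<Rightarrow> real"
  assumes "a \<le> b"
    and local: "\<And>e x. 0 < e \<Longrightarrow> a \<le> x \<Longrightarrow> x \<le> b \<Longrightarrow> 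
      \<exists>d>0. \<forall>s t. s \<le> x \<and> x \<le> t \<and> t - s < d \<longrightarrow> \<bar>E t - E s\<bar> \<le> e * (A t - A s)"
  shows "E b = E a"
proof -
  have "\<bar>E b - E a\<bar> \<le> e * (A b - A a)" if "0 < e" for e
    using \<open>a \<le> b\<close>
  proof (induction rule: Bolzano)
    case (trans r s t)
    have "\<bar>E t - E r\<bar> \<le> \<bar>E s - E r\<bar> + \<bar>E t - E s\<bar>"
      by simp
    also have "\<dots> \<le> e * (A s - A r) + e * (A t - A s)"
      using trans by (intro add_mono)
    finally show ?case by (simp add: algebra_simps)
  qed (use local[OF that] in blast)
  then have "\<forall>\<^sub>F e in at_right 0. \<bar>E b - E a\<bar> \<le> e * (A b - A a)"
    by (intro eventually_at_rightI[of 0 1]) auto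
  moreover have "((\<lambda>e. e * (A b - A a)) \<longlongrightarrow> 0 * (A b - A a)) (at_right 0)"
    by (intro tendsto_intros)
  ultimately have "\<bar>E b - E a\<bar> \<le> 0 * (A b - A a)"
    by (intro tendsto_lowerbound) auto
  then show ?thesis
    by simp
qed

text \<open>The chain rule for a function of class \<open>C\<^sup>1\<close> and a primitive. Near a point \<open>x\<close> both increments
  differ from \<open>\<Phi>' (S x)\<close> times the increment of \<open>S\<close> by a small multiple of the increment of the
  primitive of \<open>\<bar>F\<bar>\<close>.\<close>

lemma prim_chain_rule:
  fixes c :: real
  assumes F: "F \<in> L2 L" and \<Phi>: "\<And>s. (\<Phi> has_real_derivative \<Phi>' s) (at s)" "continuous_on UNIV \<Phi>'"
  defines "S \<equiv> \<lambda>x. c + prim L F x"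
  shows "(\<lambda>t. \<Phi>' (S t) * F t) \<in> L2 L" (is "?G \<in> _")
    and "\<Phi> (S x) = \<Phi> c + prim L (\<lambda>t. \<Phi>' (S t) * F t) x"
proof -
  have S: "continuous_on A S" for A
    unfolding S_def by (intro continuous_intros prim_continuous F)
  have cS: "continuous_on {-L..L} (\<lambda>t. \<Phi>' (S t))"
    using continuous_on_compose2[OF \<Phi>(2) S] by simp
  then show G: "?G \<in> L2 L"
    using F by (rule L2_mult_continuous)
  define A where "A = prim L (\<lambda>t. \<bar>F t\<bar>)"
  define E where "E = (\<lambda>x. \<Phi> (S x) - prim L ?G x)"
  have "E x = E (-L)" if "-L \<le> x"
    using that
  proof (rule const_if_locally_small_increments)
    fix e x :: real assume "0 < e"
    obtain r where r: "0 < r" "\<And>s. \<bar>s - S x\<bar> < r \<Longrightarrow> \<bar>\<Phi>' s - \<Phi>' (S x)\<bar> < e / 2"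
      using \<Phi>(2) \<open>0 < e\<close> unfolding continuous_on_iff dist_real_def 
      by (metis UNIV_I half_gt_zero)
    obtain d where d: "0 < d" "\<And>t. \<bar>t - x\<bar> < d \<Longrightarrow> \<bar>S t - S x\<bar> < r"
      using S[of UNIV] r(1) unfolding continuous_on_iff dist_real_def by (metis UNIV_I)
    have "\<bar>E t - E s\<bar> \<le> e * (A t - A s)" if st: "s \<le> x" "x \<le> t" "t - s < d" for s t
    proof -
      have near: "\<bar>S u - S x\<bar> < r" if "u \<in> {s..t}" for u
        using that st by (intro d(2)) auto
      obtain \<xi> where \<xi>: "\<bar>\<xi> - S x\<bar> < r" "\<Phi> (S t) - \<Phi> (S s) = \<Phi>' \<xi> * (S t - S s)"
      proof (cases "S s = S t")
        case True
        then show ?thesis using that[of "S x"] r(1) by auto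
      next
        case False
        have "\<exists>\<xi>. min (S s) (S t) < \<xi> \<and> \<xi> < max (S s) (S t) \<and> 
            \<Phi> (max (S s) (S t)) - \<Phi> (min (S s) (S t)) = 
            (max (S s) (S t) - min (S s) (S t)) * \<Phi>' \<xi>"
          using False by (intro MVT2 \<Phi>(1)) (auto simp: min_def max_def)
        then obtain \<xi> where \<xi>: "min (S s) (S t) < \<xi>" "\<xi> < max (S s) (S t)"
          "\<Phi> (max (S s) (S t)) - \<Phi> (min (S s) (S t)) = 
            (max (S s) (S t) - min (S s) (S t)) * \<Phi>' \<xi>"
          by blast
        show ?thesis
          by (rule that[of \<xi>])
            (use \<xi> near[of s] near[of t] st in \<open>auto simp: min_def max_def algebra_simps split: if_splits\<close>)
      qed
      have "E t - E s = \<Phi>' \<xi> * (prim L F t - prim L F s) - (prim L ?G t - prim L ?G s)"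
        using \<xi>(2) by (simp add: E_def S_def algebra_simps)
      also have "\<dots> = L2_inner L (indicator {s..<t}) (\<lambda>u. \<Phi>' \<xi> * F u - \<Phi>' (S u) * F u)"
        using st F G by (simp add: prim_increment L2_inner_diff_right L2_inner_cmult_right 
            L2_indicator L2_cmult)
      finally have "\<bar>E t - E s\<bar> \<le> 
          (\<integral>u. \<bar>indicator {s..<t} u * (\<Phi>' \<xi> * F u - \<Phi>' (S u) * F u)\<bar> \<partial>Omega_measure L)"
        using integral_abs_bound by (simp add: L2_inner_def)
      also have "\<dots> \<le> (\<integral>u. indicator {s..<t} u * (e * \<bar>F u\<bar>) \<partial>Omega_measure L)"
      proof (rule integral_mono)
        show "integrable (Omega_measure L) 
            (\<lambda>u. \<bar>indicator {s..<t} u * (\<Phi>' \<xi> * F u - \<Phi>' (S u) * F u)\<bar>)"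
          by (intro integrable_abs integrable_mult_L2 L2_indicator L2_diff L2_cmult F G) auto
        show "integrable (Omega_measure L) (\<lambda>u. indicator {s..<t} u * (e * \<bar>F u\<bar>))"
          by (intro integrable_mult_L2 L2_indicator L2_cmult L2_abs F) auto
        fix u
        have "\<bar>\<Phi>' \<xi> - \<Phi>' (S u)\<bar> \<le> e" if "u \<in> {s..t}"
          using r(2)[OF near[OF that]] r(2)[OF \<xi>(1)] by linarith
        then have "\<bar>(\<Phi>' \<xi> - \<Phi>' (S u)) * F u\<bar> \<le> e * \<bar>F u\<bar>" if "u \<in> {s..t}"
          using that by (auto simp: abs_mult intro!: mult_right_mono)
        then show "\<bar>indicator {s..<t} u * (\<Phi>' \<xi> * F u - \<Phi>' (S u) * F u)\<bar> \<le> 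
            indicator {s..<t} u * (e * \<bar>F u\<bar>)"
          by (auto simp: indicator_def left_diff_distrib)
      qed
      also have "\<dots> = e * (A t - A s)"
        using st F unfolding A_def 
        by (simp add: prim_increment L2_abs flip: L2_inner_cmult_right) (simp add: L2_inner_def)
      finally show ?thesis .
    qed
    then show "\<exists>d>0. \<forall>s t. s \<le> x \<and> x \<le> t \<and> t - s < d \<longrightarrow> \<bar>E t - E s\<bar> \<le> e * (A t - A s)"
      using d(1) by blast
  qed
  moreover have "E x = E (-L)" if "x \<le> -L"
    using that by (simp add: E_def S_def prim_eq_0_left)
  ultimately have "E x = E (-L)"
    by linarith
  then show "\<Phi> (S x) = \<Phi> c + prim L ?G x"
    by (simp add: E_def S_def prim_eq_0_left)
qed

text \<open>\<open>P\<close> is absolutely continuous on the closed interval, and \<open>F\<close> is a representative of its derivative.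
  Thus \<open>P\<close> is the continuous representative of a function in \<open>H\<^sup>1\<close>, while \<open>F\<close> may be changed on null sets.\<close>

definition has_L2_deriv :: "real \<Rightarrow> (real \<Rightarrow> real) \<Rightarrow> (real \<Rightarrow> real) \<Rightarrow> bool" where
  "has_L2_deriv L P F \<longleftrightarrow> F \<in> L2 L \<and> (\<forall>x\<in>{-L..L}. P x = P (-L) + prim L F x)"

lemma has_L2_deriv_L2: "has_L2_deriv L P F \<Longrightarrow> F \<in> L2 L"
  by (simp add: has_L2_deriv_def)

lemma has_L2_derivD: "has_L2_deriv L P F \<Longrightarrow> x \<in> {-L..L} \<Longrightarrow> P x = P (-L) + prim L F x"
  unfolding has_L2_deriv_def by blast

lemma has_L2_deriv_prim: "F \<in> L2 L \<Longrightarrow> has_L2_deriv L (\<lambda>x. c + prim L F x) F"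
  by (simp add: has_L2_deriv_def prim_eq_0_left)

lemma has_L2_deriv_continuous:
  assumes "has_L2_deriv L P F" shows "continuous_on {-L..L} P"
proof -
  have "continuous_on {-L..L} (\<lambda>x. P (-L) + prim L F x)"
    by (intro continuous_intros prim_continuous has_L2_deriv_L2[OF assms])
  then show ?thesis
    by (rule continuous_on_eq) (rule has_L2_derivD[OF assms, symmetric])
qed

lemma has_L2_deriv_in_L2: "has_L2_deriv L P F \<Longrightarrow> P \<in> L2 L"
  by (rule L2_continuous[OF has_L2_deriv_continuous])

lemma has_L2_deriv_add:
  assumes "has_L2_deriv L P F" "has_L2_deriv L Q G"
  shows "has_L2_deriv L (\<lambda>x. P x + Q x) (\<lambda>x. F x + G x)"
proof -
  have FG: "F \<in> L2 L" "G \<in> L2 L"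
    using assms by (simp_all add: has_L2_deriv_L2)
  moreover have "P x + Q x = P (-L) + Q (-L) + prim L (\<lambda>x. F x + G x) x" if "x \<in> {-L..L}" for x
    using has_L2_derivD[OF assms(1) that] has_L2_derivD[OF assms(2) that] prim_add[OF FG, of x] by linarith
  ultimately show ?thesis
    unfolding has_L2_deriv_def by (blast intro: L2_add)
qed

lemma has_L2_deriv_cmult:
  assumes "has_L2_deriv L P F"
  shows "has_L2_deriv L (\<lambda>x. c * P x) (\<lambda>x. c * F x)"
proof -
  have "c * P x = c * P (-L) + prim L (\<lambda>x. c * F x) x" if "x \<in> {-L..L}" for x
    unfolding has_L2_derivD[OF assms that] prim_cmult by (rule distrib_left)
  then show ?thesis
    using L2_cmult[OF has_L2_deriv_L2[OF assms]] unfolding has_L2_deriv_def by blast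
qed

lemma has_L2_deriv_diff:
  assumes "has_L2_deriv L P F" "has_L2_deriv L Q G"
  shows "has_L2_deriv L (\<lambda>x. P x - Q x) (\<lambda>x. F x - G x)"
  using has_L2_deriv_add[OF assms(1) has_L2_deriv_cmult[OF assms(2), of "-1"]] by simp

lemma has_L2_deriv_AE_cong:
  assumes "has_L2_deriv L P F" "AE x in Omega_measure L. F x = G x" "\<And>x. x \<in> {-L..L} \<Longrightarrow> P x = Q x"
    "0 < L"
  shows "has_L2_deriv L Q G"
proof -
  have "AE x in Omega_measure L. G x = F x"
    using assms(2) by eventually_elim simp
  then have "G \<in> L2 L"
    by (rule L2_cong_AE[OF has_L2_deriv_L2[OF assms(1)]])
  moreover have "prim L F = prim L G"
    using prim_cong_AE[OF assms(2)] by auto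
  moreover have "Q x = Q (-L) + prim L G x" if "x \<in> {-L..L}" for x
  proof -
    have "P x = Q x" "P (-L) = Q (-L)"
      using assms(3)[of x] assms(3)[of "-L"] assms(4) that by auto
    then show ?thesis
      using has_L2_derivD[OF assms(1) that] \<open>prim L F = prim L G\<close> by metis
  qed
  ultimately show ?thesis
    unfolding has_L2_deriv_def by blast
qed

lemma has_L2_deriv_chain:
  assumes L: "0 < L" and P: "has_L2_deriv L P F" 
    and \<Phi>: "\<And>s. (\<Phi> has_real_derivative \<Phi>' s) (at s)" "continuous_on UNIV \<Phi>'"
  shows "has_L2_deriv L (\<lambda>x. \<Phi> (P x)) (\<lambda>x. \<Phi>' (P x) * F x)"
proof (rule has_L2_deriv_AE_cong[OF _ _ _ L])
  let ?S = "\<lambda>x. P (-L) + prim L F x"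
  have F: "F \<in> L2 L" 
    using P by (rule has_L2_deriv_L2)
  have PS: "?S x = P x" if "x \<in> {-L..L}" for x
    using has_L2_derivD[OF P that] by simp
  show "has_L2_deriv L (\<lambda>x. \<Phi> (?S x)) (\<lambda>x. \<Phi>' (?S x) * F x)"
    unfolding has_L2_deriv_def
  proof (intro conjI ballI)
    show "(\<lambda>x. \<Phi>' (?S x) * F x) \<in> L2 L"
      by (rule prim_chain_rule(1)[OF F \<Phi>])
    fix x
    have "\<Phi> (?S x) = \<Phi> (P (-L)) + prim L (\<lambda>x. \<Phi>' (?S x) * F x) x"
      by (rule prim_chain_rule(2)[OF F \<Phi>])
    moreover have "\<Phi> (?S (-L)) = \<Phi> (P (-L))"
      by (simp add: prim_eq_0_left)
    ultimately show "\<Phi> (?S x) = \<Phi> (?S (-L)) + prim L (\<lambda>x. \<Phi>' (?S x) * F x) x"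
      by simp
  qed
  show "AE x in Omega_measure L. \<Phi>' (?S x) * F x = \<Phi>' (P x) * F x"
    by (intro AE_I2) (use PS in simp)
  show "\<Phi> (?S x) = \<Phi> (P x)" if "x \<in> {-L..L}" for x
    using PS[OF that] by simp
qed

text \<open>The product rule follows by polarization from the chain rule for \<open>s \<mapsto> s\<^sup>2\<close>.\<close>

lemma has_L2_deriv_mult:
  assumes L: "0 < L" and P: "has_L2_deriv L P F" and Q: "has_L2_deriv L Q G"
  shows "has_L2_deriv L (\<lambda>x. P x * Q x) (\<lambda>x. F x * Q x + P x * G x)"
proof -
  have sq: "has_L2_deriv L (\<lambda>x. (R x)\<^sup>2) (\<lambda>x. 2 * R x * H x)" if "has_L2_deriv L R H" for R H
    by (rule has_L2_deriv_chain[OF L that, where \<Phi> = "\<lambda>s. s\<^sup>2" and \<Phi>' = "\<lambda>s. 2 * s"]) 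
      (auto intro!: derivative_eq_intros continuous_intros)
  have "has_L2_deriv L (\<lambda>x. 1/4 * ((P x + Q x)\<^sup>2 - (P x - Q x)\<^sup>2)) 
      (\<lambda>x. 1/4 * (2 * (P x + Q x) * (F x + G x) - 2 * (P x - Q x) * (F x - G x)))"
    by (intro has_L2_deriv_cmult has_L2_deriv_diff has_L2_deriv_add sq P Q)
  moreover have "(\<lambda>x. 1/4 * ((P x + Q x)\<^sup>2 - (P x - Q x)\<^sup>2)) = (\<lambda>x. P x * Q x)"
    by (simp add: fun_eq_iff power2_sum power2_diff)
  moreover have "(\<lambda>x. 1/4 * (2 * (P x + Q x) * (F x + G x) - 2 * (P x - Q x) * (F x - G x))) = 
      (\<lambda>x. F x * Q x + P x * G x)"
    by (simp add: fun_eq_iff algebra_simps)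
  ultimately show ?thesis by simp
qed

lemma L2_integration_by_parts:
  assumes L: "0 < L" and P: "has_L2_deriv L P F" and Q: "has_L2_deriv L Q G"
  shows "L2_inner L F Q + L2_inner L P G = P L * Q L - P (-L) * Q (-L)"
proof -
  have "P L * Q L = P (-L) * Q (-L) + prim L (\<lambda>x. F x * Q x + P x * G x) L"
    using has_L2_derivD[OF has_L2_deriv_mult[OF assms], of L] L by simp
  moreover have "prim L (\<lambda>x. F x * Q x + P x * G x) L = L2_inner L F Q + L2_inner L P G"
    using has_L2_deriv_in_L2[OF P] has_L2_deriv_in_L2[OF Q] has_L2_deriv_L2[OF P] has_L2_deriv_L2[OF Q]
    by (simp add: prim_right L2_inner_def integrable_mult_L2)
  ultimately show ?thesis by simp
qed

lemma has_L2_deriv_C1: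
  assumes q: "continuous_on {-L..L} q" 
    and p: "\<And>x. x \<in> {-L..L} \<Longrightarrow> (p has_real_derivative q x) (at x within {-L..L})"
  shows "has_L2_deriv L p q"
  unfolding has_L2_deriv_def
proof (intro conjI ballI L2_continuous q)
  fix x assume x: "x \<in> {-L..L}"
  have "\<exists>c. \<forall>t\<in>{-L..L}. p t - prim L q t = c"
  proof (rule has_field_derivative_zero_constant)
    show "((\<lambda>t. p t - prim L q t) has_field_derivative 0) (at t within {-L..L})" if "t \<in> {-L..L}" for t
      using DERIV_diff[OF p prim_has_real_derivative[OF q], OF that that] by simp
  qed simp
  then have "p x - prim L q x = p (-L) - prim L q (-L)"
    using x by (metis atLeastAtMost_iff order_refl order_trans)
  then show "p x = p (-L) + prim L q x"
    by (simp add: prim_eq_0_left)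
qed

text \<open>A square integrable function is determined by its primitive: intervals generate the Borel
  sets.\<close>

lemma prim_eq_0_imp_AE:
  assumes v: "v \<in> L2 L" and zero: "\<And>x. prim L v x = 0"
  shows "AE x in Omega_measure L. v x = 0"
proof -
  let ?M = "Omega_measure L"
  have iv: "set_integrable ?M A v" if "A \<in> sets ?M" for A
    unfolding set_integrable_def using that L2_integrable[OF v] by (rule integrable_mult_indicator)
  have borel_sets: "B \<inter> {-L<..<L} \<in> sets ?M" if "B \<in> sets borel" for B :: "real set"
    unfolding sets_restrict_space using that by (intro image_eqI[of _ _ B]) auto
  have borel: "set_lebesgue_integral ?M (B \<inter> {-L<..<L}) v = 0" if "B \<in> sets borel" for B
    using that
  proof (induction rule: borel_set_induct)
    case empty
    then show ?case by (simp add: set_lebesgue_integral_def)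
  next
    case (interval a b)
    have "AE t in lebesgue. t \<noteq> b"
      by (rule AE_completion) (rule AE_lborel_singleton)
    then have "AE t in ?M. t \<noteq> b"
      by (subst AE_restrict_space_iff) (auto elim: eventually_mono)
    then have "AE t in ?M. indicator ({a..b} \<inter> {-L<..<L}) t = (indicator {a..<b} t :: real)"
      using AE_space by eventually_elim (auto simp: indicator_def)
    then have "L2_inner L (indicator ({a..b} \<inter> {-L<..<L})) v = L2_inner L (indicator {a..<b}) v"
      by (intro L2_inner_cong_AE) auto
    also have "\<dots> = 0"
      using prim_increment[OF v interval] by (simp add: zero)
    finally show ?case
      by (simp add: set_lebesgue_integral_def L2_inner_def)
  next
    case (compl B)
    have "set_lebesgue_integral ?M ((B \<inter> {-L<..<L}) \<union> (-B \<inter> {-L<..<L})) v = 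
        set_lebesgue_integral ?M (B \<inter> {-L<..<L}) v + set_lebesgue_integral ?M (-B \<inter> {-L<..<L}) v"
      using compl by (intro set_integral_Un iv borel_sets) auto
    also have "(B \<inter> {-L<..<L}) \<union> (-B \<inter> {-L<..<L}) = space ?M"
      by auto
    also have "set_lebesgue_integral ?M (space ?M) v = 0"
      unfolding set_integral_space[OF L2_integrable[OF v]] using zero[of L] prim_right[of L L v] 
      by simp
    finally show ?case
      using compl by simp
  next
    case (union f)
    have "set_lebesgue_integral ?M (\<Union>i. f i \<inter> {-L<..<L}) v = 
        (\<Sum>i. set_lebesgue_integral ?M (f i \<inter> {-L<..<L}) v)"
    proof (rule lebesgue_integral_countable_add)
      show "f i \<inter> {-L<..<L} \<in> sets ?M" for i
        by (intro borel_sets union)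
      show "(f i \<inter> {-L<..<L}) \<inter> (f j \<inter> {-L<..<L}) = {}" if "i \<noteq> j" for i j
        using union(1) that by (auto simp: disjoint_family_on_def)
      show "set_integrable ?M (\<Union>i. f i \<inter> {-L<..<L}) v"
        by (intro iv sets.countable_UN) (auto intro!: borel_sets union)
    qed
    moreover have "(\<Union>i. f i \<inter> {-L<..<L}) = (\<Union>i. f i) \<inter> {-L<..<L}"
      by auto
    ultimately show ?case
      by (simp only: union(3)) simp
  qed
  show ?thesis
  proof (rule sigma_finite_measure.density_zero[OF finite_measure.axioms(1)[OF finite_measure_Omega] 
        L2_integrable[OF v]])
    fix A assume A: "A \<in> sets ?M"
    then have "A \<in> sets lebesgue" and sub: "A \<subseteq> {-L<..<L}"
      by (simp_all add: sets_restrict_space_iff)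
    then obtain B N N' where "A = B \<union> N" and B: "B \<in> sets borel" 
      and N: "N \<subseteq> N'" "N' \<in> null_sets lborel"
      by (auto elim!: sets_completionE)
    then have "AE x in lebesgue. x \<notin> N"
      by (intro AE_completion) (auto intro: eventually_mono[OF AE_not_in[OF N(2)]])
    then have "AE x in ?M. x \<notin> N"
      by (subst AE_restrict_space_iff) (auto elim: eventually_mono)
    then have "AE x in ?M. indicator A x = (indicator (B \<inter> {-L<..<L}) x :: real)"
      using AE_space by eventually_elim (use \<open>A = B \<union> N\<close> sub in \<open>auto simp: indicator_def\<close>)
    then have "L2_inner L (indicator A) v = L2_inner L (indicator (B \<inter> {-L<..<L})) v"
      by (intro L2_inner_cong_AE) auto
    then show "set_lebesgue_integral ?M A v = 0"
      using borel[OF B] by (simp add: set_lebesgue_integral_def L2_inner_def)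
  qed
qed

section \<open>Smooth bump functions and the fundamental lemma of the calculus of variations\<close>

text \<open>A derivative is chosen at each stage, so that closure under products and substitutions is a plain
  induction that does not unfold iterated \<open>deriv\<close>.\<close>

primrec smooth_upto :: "nat \<Rightarrow> (real \<Rightarrow> real) \<Rightarrow> bool" where
  "smooth_upto 0 f = continuous_on UNIV f"
| "smooth_upto (Suc k) f = (\<exists>f'. (\<forall>x. (f has_real_derivative f' x) (at x)) \<and> smooth_upto k f')"

lemma smooth_upto_SucI:
  "(\<And>x. (f has_real_derivative f' x) (at x)) \<Longrightarrow> smooth_upto k f' \<Longrightarrow> smooth_upto (Suc k) f"
  by auto

lemma smooth_upto_SucD: "smooth_upto (Suc k) f \<Longrightarrow> smooth_upto k f"
proof (induction k arbitrary: f)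
  case 0
  then show ?case
    by (auto intro!: continuous_at_imp_continuous_on intro: DERIV_isCont)
next
  case (Suc k)
  then show ?case
    using smooth_upto.simps(2) by metis
qed

lemma smooth_upto_add: "smooth_upto k f \<Longrightarrow> smooth_upto k g \<Longrightarrow> smooth_upto k (\<lambda>x. f x + g x)"
proof (induction k arbitrary: f g)
  case (Suc k)
  then obtain f' g' where f': "\<And>x. (f has_real_derivative f' x) (at x)" "smooth_upto k f'" 
    and g': "\<And>x. (g has_real_derivative g' x) (at x)" "smooth_upto k g'"
    by auto
  show ?case
    by (rule smooth_upto_SucI[OF DERIV_add[OF f'(1) g'(1)] Suc.IH[OF f'(2) g'(2)]])
qed (auto intro: continuous_intros)

lemma smooth_upto_cmult: "smooth_upto k f \<Longrightarrow> smooth_upto k (\<lambda>x. c * f x)"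
proof (induction k arbitrary: f)
  case (Suc k)
  then obtain f' where f': "\<And>x. (f has_real_derivative f' x) (at x)" "smooth_upto k f'"
    by auto
  show ?case
    by (rule smooth_upto_SucI[OF DERIV_cmult[OF f'(1)] Suc.IH[OF f'(2)]])
qed (auto intro: continuous_intros)

lemma smooth_upto_mult: "smooth_upto k f \<Longrightarrow> smooth_upto k g \<Longrightarrow> smooth_upto k (\<lambda>x. f x * g x)"
proof (induction k arbitrary: f g)
  case (Suc k)
  then obtain f' g' where f': "\<And>x. (f has_real_derivative f' x) (at x)" "smooth_upto k f'" 
    and g': "\<And>x. (g has_real_derivative g' x) (at x)" "smooth_upto k g'"
    by auto
  have "smooth_upto k (\<lambda>x. f' x * g x + g' x * f x)"
    by (rule smooth_upto_add[OF Suc.IH[OF f'(2) smooth_upto_SucD[OF Suc.prems(2)]] 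
          Suc.IH[OF g'(2) smooth_upto_SucD[OF Suc.prems(1)]]])
  then show ?case
    by (rule smooth_upto_SucI[OF DERIV_mult[OF f'(1) g'(1)]])
qed (auto intro: continuous_intros)

lemma smooth_upto_affine: "smooth_upto k f \<Longrightarrow> smooth_upto k (\<lambda>x. f (c * x + d))"
proof (induction k arbitrary: f)
  case 0
  then show ?case
    by (auto intro!: continuous_on_compose2[of UNIV f] continuous_intros)
next
  case (Suc k)
  then obtain f' where f': "\<And>x. (f has_real_derivative f' x) (at x)" "smooth_upto k f'"
    by auto
  have "((\<lambda>x. f (c * x + d)) has_real_derivative c * f' (c * x + d)) (at x)" for x
    by (rule DERIV_cong[OF DERIV_chain2[OF f'(1)]]) (auto intro!: derivative_eq_intros)
  from smooth_upto_SucI[OF this smooth_upto_cmult[OF Suc.IH[OF f'(2)]]] show ?case .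
qed

lemma smooth_upto_imp_Ck: "smooth_upto k f \<Longrightarrow> Ck k f"
proof (induction k arbitrary: f)
  case 0
  then show ?case by (simp add: Ck_def)
next
  case (Suc k)
  then obtain f' where f': "\<And>x. (f has_real_derivative f' x) (at x)" "smooth_upto k f'"
    by auto
  have deriv: "deriv f = f'"
    using f'(1) by (auto intro!: DERIV_imp_deriv)
  have IH: "Ck k f'"
    using Suc.IH f'(2) .
  have "(deriv ^^ j) f field_differentiable at x" if "j < Suc k" for j x
  proof (cases j)
    case 0
    then show ?thesis
      using f'(1) by (auto simp: field_differentiable_def)
  next
    case (Suc i)
    then show ?thesis
      using IH that by (simp add: Ck_def funpow_Suc_right deriv del: funpow.simps)
  qed
  then show ?case
    using IH by (simp add: Ck_def funpow_Suc_right deriv del: funpow.simps)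
qed

lemma tendsto_poly_inverse_exp:
  fixes c :: real
  assumes "0 < c"
  shows "((\<lambda>x. poly P (1 / x) * exp (- c / x)) \<longlongrightarrow> 0) (at_right 0)"
proof -
  have "((\<lambda>t. poly P t * exp (- (c * t))) \<longlongrightarrow> (\<Sum>i\<le>degree P. coeff P i / c ^ i * 0)) at_top"
  proof -
    have lin: "filterlim (\<lambda>t. c * t) at_top at_top"
      using assms by (intro filterlim_tendsto_pos_mult_at_top[OF tendsto_const _ filterlim_ident])
    have "((\<lambda>t. (\<Sum>i\<le>degree P. coeff P i / c ^ i * ((c * t) ^ i / exp (c * t)))) \<longlongrightarrow> 
        (\<Sum>i\<le>degree P. coeff P i / c ^ i * 0)) at_top"
      by (intro tendsto_intros filterlim_compose[OF tendsto_power_div_exp_0 lin])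
    moreover have "(\<Sum>i\<le>degree P. coeff P i / c ^ i * ((c * t) ^ i / exp (c * t))) = 
        poly P t * exp (- (c * t))" for t
      unfolding poly_altdef sum_distrib_right
      using assms by (intro sum.cong) (auto simp: power_mult_distrib exp_minus field_simps)
    ultimately show ?thesis by simp
  qed
  then have "((\<lambda>t. poly P t * exp (- (c * t))) \<longlongrightarrow> 0) at_top"
    by simp
  from filterlim_compose[OF this filterlim_inverse_at_top_right] show ?thesis
    by (simp add: field_simps)
qed

text \<open>The class of these functions is closed under differentiation, hence all of them are smooth.\<close>

lemma DERIV_poly_inverse_exp:
  fixes c :: real
  assumes "0 < c"
  shows "((\<lambda>x. if 0 < x then poly P (1 / x) * exp (- c / x) else 0) has_real_derivative
    (if 0 < x then poly ([:0, 0, 1:] * (smult c P - pderiv P)) (1 / x) * exp (- c / x) else 0)) (at x)"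
proof -
  define Q where "Q = [:0, 0, 1:] * (smult c P - pderiv P)"
  let ?f = "\<lambda>P x. if 0 < x then poly P (1 / x) * exp (- c / x) else 0 :: real"
  have "(?f P has_real_derivative ?f Q x) (at x)"
  proof -
    consider "x < 0" | "x = 0" | "0 < x" by linarith
    then show ?thesis
    proof cases
      case 1
      have "((\<lambda>x. 0) has_real_derivative 0) (at x)"
        by simp
      then have "(?f P has_real_derivative 0) (at x)"
        by (rule has_field_derivative_transform_within_open[of _ _ _ "{..<0}"]) (use 1 in auto)
      then show ?thesis
        using 1 by simp
    next
      case 2
      have "((\<lambda>y. (?f P y - ?f P 0) / (y - 0)) \<longlongrightarrow> 0) (at 0)"
        unfolding filterlim_at_split
      proof
        show "((\<lambda>y. (?f P y - ?f P 0) / (y - 0)) \<longlongrightarrow> 0) (at_left 0)"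
          by (rule tendsto_eventually) (auto simp: eventually_at_filter)
        show "((\<lambda>y. (?f P y - ?f P 0) / (y - 0)) \<longlongrightarrow> 0) (at_right 0)"
          using tendsto_poly_inverse_exp[OF assms, of "pCons 0 P"]
          by (rule Lim_transform_eventually) (auto simp: eventually_at_filter)
      qed
      then show ?thesis
        using 2 by (simp add: has_field_derivative_iff)
    next
      case 3
      have "((\<lambda>x. poly P (1 / x) * exp (- c / x)) has_real_derivative ?f Q x) (at x)"
        using 3 by (auto intro!: derivative_eq_intros simp: Q_def field_simps power2_eq_square)
      then show ?thesis
        by (rule has_field_derivative_transform_within_open[of _ _ _ "{0<..}"]) (use 3 in auto)
    qed
  qed
  then show ?thesis
    unfolding Q_def .
qed

lemma smooth_upto_poly_inverse_exp:
  fixes c :: real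
  assumes "0 < c"
  shows "smooth_upto k (\<lambda>x. if 0 < x then poly P (1 / x) * exp (- c / x) else 0)"
proof (induction k arbitrary: P)
  case 0
  show ?case
    using DERIV_isCont[OF DERIV_poly_inverse_exp[OF assms]] 
    by (auto intro!: continuous_at_imp_continuous_on)
next
  case (Suc k)
  from smooth_upto_SucI[OF DERIV_poly_inverse_exp[OF assms] Suc.IH] show ?case .
qed

text \<open>The parameter \<open>c\<close> controls how fast the bump rises: as \<open>c\<close> tends to \<open>0\<close>, the bump tends to
  the indicator function of the interval.\<close>

definition bump :: "real \<Rightarrow> real \<Rightarrow> real \<Rightarrow> real \<Rightarrow> real" where
  "bump c a b x = (if a < x \<and> x < b then exp (- c / (x - a)) * exp (- c / (b - x)) else 0)"

lemma smooth_upto_bump: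
  assumes "0 < c"
  shows "smooth_upto k (bump c a b)"
proof -
  let ?e = "\<lambda>x. if 0 < x then poly 1 (1 / x) * exp (- c / x) else 0 :: real"
  have "smooth_upto k (\<lambda>x. ?e (1 * x + (- a)) * ?e ((-1) * x + b))"
    by (intro smooth_upto_mult smooth_upto_affine smooth_upto_poly_inverse_exp assms)
  moreover have "(\<lambda>x. ?e (1 * x + (- a)) * ?e ((-1) * x + b)) = bump c a b"
    by (auto simp: bump_def fun_eq_iff)
  ultimately show ?thesis by simp
qed

lemma bump_eq_0: "\<not> (a < x \<and> x < b) \<Longrightarrow> bump c a b x = 0"
  by (simp add: bump_def)

lemma bump_abs_le:
  assumes "0 < c" shows "\<bar>bump c a b x\<bar> \<le> 1"
proof -
  have "exp (- c / (x - a)) * exp (- c / (b - x)) \<le> 1 * 1" if "a < x" "x < b"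
    using that assms by (intro mult_mono) auto
  then show ?thesis
    by (auto simp: bump_def)
qed

lemma bump_tendsto_indicator: "(\<lambda>j. bump (1 / Suc j) a b x) \<longlonglongrightarrow> indicator {a<..<b} x"
proof (cases "a < x \<and> x < b")
  case True
  have "(\<lambda>j. exp (- (1 / Suc j) / (x - a)) * exp (- (1 / Suc j) / (b - x))) \<longlonglongrightarrow> 
      exp (- 0 / (x - a)) * exp (- 0 / (b - x))"
    using True LIMSEQ_Suc[OF lim_1_over_n[where 'a = real]] by (intro tendsto_intros) auto
  then show ?thesis
    using True by (simp add: bump_def)
qed (auto simp: bump_eq_0)

lemma test_functionI:
  assumes "\<And>k. smooth_upto k \<phi>" "-L < a" "b < L" "\<And>x. \<not> (a < x \<and> x < b) \<Longrightarrow> \<phi> x = 0"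
  shows "test_function L \<phi>"
proof -
  have "closure {x. \<phi> x \<noteq> 0} \<subseteq> {a..b}"
  proof (rule closure_minimal)
    show "{x. \<phi> x \<noteq> 0} \<subseteq> {a..b}"
    proof
      fix x assume "x \<in> {x. \<phi> x \<noteq> 0}"
      then have "a < x \<and> x < b"
        using assms(4)[of x] by blast
      then show "x \<in> {a..b}" by simp
    qed
  qed simp
  moreover have "{a..b} \<subseteq> {-L<..<L}"
    using assms(2,3) by auto
  ultimately show ?thesis
    using smooth_upto_imp_Ck[OF assms(1)] unfolding test_function_def by blast
qed

lemma L2_smooth: "smooth_upto k \<phi> \<Longrightarrow> \<phi> \<in> L2 L"
proof (rule L2_continuous, rule continuous_on_subset[OF _ subset_UNIV])
  show "smooth_upto k \<phi> \<Longrightarrow> continuous_on UNIV \<phi>"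
    by (cases k) (auto intro!: continuous_at_imp_continuous_on intro: DERIV_isCont)
qed

text \<open>In the limit \<open>c \<longlongrightarrow> 0\<close> the bumps become indicator functions, so the primitive of \<open>v\<close> is constant.\<close>

lemma fundamental_lemma_bump:
  assumes L: "0 < L" and v: "v \<in> L2 L"
    and zero: "\<And>c a b. 0 < c \<Longrightarrow> -L < a \<Longrightarrow> a < b \<Longrightarrow> b < L \<Longrightarrow> L2_inner L v (bump c a b) = 0"
  shows "AE x in Omega_measure L. v x = 0"
proof (rule prim_eq_0_imp_AE[OF v])
  have inc: "prim L v y = prim L v x" if "-L < x" "x < y" "y < L" for x y
  proof -
    have "(\<lambda>j. \<integral>t. v t * bump (1 / Suc j) x y t \<partial>Omega_measure L) \<longlonglongrightarrow> 
        (\<integral>t. v t * indicator {x<..<y} t \<partial>Omega_measure L)"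
    proof (rule integral_dominated_convergence[where w = "\<lambda>t. \<bar>v t\<bar>"])
      show "(\<lambda>t. v t * indicator {x<..<y} t) \<in> borel_measurable (Omega_measure L)"
        using integrable_mult_L2[OF v L2_indicator] by auto
      show "(\<lambda>t. v t * bump (1 / Suc j) x y t) \<in> borel_measurable (Omega_measure L)" for j
        using integrable_mult_L2[OF v L2_smooth[OF smooth_upto_bump[of "1 / Suc j"]]] by auto
      show "integrable (Omega_measure L) (\<lambda>t. \<bar>v t\<bar>)"
        using L2_integrable[OF v] by simp
      show "AE t in Omega_measure L. (\<lambda>j. v t * bump (1 / Suc j) x y t) \<longlonglongrightarrow> v t * indicator {x<..<y} t"
        by (intro AE_I2 tendsto_intros bump_tendsto_indicator)
      show "AE t in Omega_measure L. norm (v t * bump (1 / Suc j) x y t) \<le> \<bar>v t\<bar>" for j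
        by (intro AE_I2) (simp add: abs_mult mult_left_le bump_abs_le)
    qed
    moreover have "(\<integral>t. v t * bump (1 / Suc j) x y t \<partial>Omega_measure L) = 0" for j
      using zero[of "1 / Suc j" x y] that by (simp add: L2_inner_def)
    ultimately have "L2_inner L v (indicator {x<..<y}) = 0"
      unfolding L2_inner_def by (simp add: LIMSEQ_const_iff)
    moreover have "L2_inner L v (indicator {x<..<y}) = L2_inner L v (indicator {x..<y})"
    proof (rule L2_inner_cong_AE)
      have "AE t in lebesgue. t \<noteq> x"
        by (rule AE_completion) (rule AE_lborel_singleton)
      then have "AE t in Omega_measure L. t \<noteq> x"
        by (subst AE_restrict_space_iff) (auto elim: eventually_mono)
      then show "AE t in Omega_measure L. indicator {x<..<y} t = (indicator {x..<y} t :: real)"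
        by eventually_elim (auto simp: indicator_def)
    qed auto
    ultimately show ?thesis
      using prim_increment[OF v, of x y] that by (simp add: L2_inner_commute)
  qed
  have zero_in: "prim L v x = 0" if x: "-L < x" "x < L" for x
  proof -
    have "(prim L v \<longlongrightarrow> prim L v (-L)) (at_right (-L))"
      using prim_continuous[OF v, of UNIV] 
      by (metis UNIV_I continuous_on_def filterlim_at_split)
    moreover have "\<forall>\<^sub>F y in at_right (-L). prim L v y = prim L v x"
      by (rule eventually_at_rightI[of _ x]) (use x inc in auto)
    ultimately have "((\<lambda>y. prim L v x) \<longlongrightarrow> prim L v (-L)) (at_right (-L))"
      by (rule Lim_transform_eventually)
    then have "prim L v x = prim L v (-L)"
      by (intro tendsto_unique[OF _ tendsto_const]) auto
    then show ?thesis
      by (simp add: prim_eq_0_left)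
  qed
  have zero_L: "prim L v L = 0"
  proof -
    have "(prim L v \<longlongrightarrow> prim L v L) (at_left L)"
      using prim_continuous[OF v, of UNIV] 
      by (metis UNIV_I continuous_on_def filterlim_at_split)
    moreover have "\<forall>\<^sub>F y in at_left L. prim L v y = 0"
      by (rule eventually_at_leftI[of "-L"]) (use L zero_in in auto)
    ultimately have "((\<lambda>y. 0) \<longlongrightarrow> prim L v L) (at_left L)"
      by (rule Lim_transform_eventually)
    then show ?thesis
      by (intro tendsto_unique[OF _ _ tendsto_const]) auto
  qed
  fix x
  show "prim L v x = 0"
    using zero_in[of x] zero_L prim_right[of L x v] prim_right[of L L v] prim_eq_0_left[of x L v]
    by (cases "-L < x"; cases "x < L") auto
qed

text \<open>The source of test functions with a prescribed derivative: the mean value zero makes the primitive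
  vanish to the right of the support, too.\<close>

lemma prim_of_supported:
  assumes ab: "-L < a" "b < L" and \<psi>: "continuous_on UNIV \<psi>" "\<And>x. \<not> (a < x \<and> x < b) \<Longrightarrow> \<psi> x = 0"
    and mean: "(\<integral>x. \<psi> x \<partial>Omega_measure L) = 0"
  shows "(prim L \<psi> has_real_derivative \<psi> x) (at x)"
    and "\<not> (a < x \<and> x < b) \<Longrightarrow> prim L \<psi> x = 0"
proof -
  have left: "prim L \<psi> x = 0" if "x \<le> a" for x
  proof -
    have "prim L \<psi> x = (\<integral>t. 0 \<partial>Omega_measure L)"
      unfolding prim_def L2_inner_def using that \<psi>(2)
      by (intro Bochner_Integration.integral_cong) (auto simp: indicator_def)
    then show ?thesis by simp
  qed
  have right: "prim L \<psi> x = 0" if "b \<le> x" for x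
  proof -
    have "prim L \<psi> x = (\<integral>t. \<psi> t \<partial>Omega_measure L)"
      unfolding prim_def L2_inner_def using that \<psi>(2)
      by (intro Bochner_Integration.integral_cong) (auto simp: indicator_def)
    then show ?thesis by (simp add: mean)
  qed
  show "\<not> (a < x \<and> x < b) \<Longrightarrow> prim L \<psi> x = 0"
    using left right by force
  consider "-L < x \<and> x < L" | "x < a" | "b < x"
    using ab by linarith
  then show "(prim L \<psi> has_real_derivative \<psi> x) (at x)"
  proof cases
    case 1
    then have "at x within {-L..L} = at x"
      by (intro at_within_interior) simp
    then show ?thesis
      using prim_has_real_derivative[of L \<psi> x] continuous_on_subset[OF \<psi>(1), of "{-L..L}"] 1
      by auto
  next
    case 2
    have "((\<lambda>x. 0) has_real_derivative 0) (at x)"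
      by simp
    then have "(prim L \<psi> has_real_derivative 0) (at x)"
      by (rule has_field_derivative_transform_within_open[of _ _ _ "{..<a}"]) (use 2 left in auto)
    then show ?thesis
      using 2 \<psi>(2)[of x] by simp
  next
    case 3
    have "((\<lambda>x. 0) has_real_derivative 0) (at x)"
      by simp
    then have "(prim L \<psi> has_real_derivative 0) (at x)"
      by (rule has_field_derivative_transform_within_open[of _ _ _ "{b<..}"]) (use 3 right in auto)
    then show ?thesis
      using 3 \<psi>(2)[of x] by simp
  qed
qed

text \<open>The lemma of du Bois-Reymond. From each bump a multiple of a fixed bump with the same mean is
  subtracted, so that the difference is the derivative of a test function.\<close>

lemma du_Bois_Reymond:
  assumes L: "0 < L" and y: "y \<in> L2 L"
    and zero: "\<And>\<phi>. test_function L \<phi> \<Longrightarrow> L2_inner L y (deriv \<phi>) = 0"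
  shows "\<exists>k. AE x in Omega_measure L. y x = k"
proof -
  have bumpL2: "0 < c \<Longrightarrow> bump c a b \<in> L2 L" for c a b
    by (rule L2_smooth[OF smooth_upto_bump])
  \<comment> \<open>If all bumps had mean zero, the constant \<open>1\<close> would vanish by the fundamental lemma.\<close>
  obtain c0 a0 b0 where \<rho>: "0 < c0" "-L < a0" "a0 < b0" "b0 < L" 
    "L2_inner L (\<lambda>x. 1) (bump c0 a0 b0) \<noteq> 0"
  proof (rule ccontr)
    assume "\<not> thesis"
    then have "AE x in Omega_measure L. (1::real) = 0"
      using fundamental_lemma_bump[OF L L2_const[of 1]] that by metis
    then have "L2_inner L (\<lambda>x. 1) (\<lambda>x. 1) = L2_inner L (\<lambda>x. 0) (\<lambda>x. 1)"
      by (intro L2_inner_cong_AE) auto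
    then show False
      using L2_norm_const[OF L, of 1] L by (simp add: L2_norm_def L2_inner_def)
  qed
  define \<rho> where "\<rho> = bump c0 a0 b0"
  define k where "k = L2_inner L y \<rho> / L2_inner L (\<lambda>x. 1) \<rho>"
  have \<rho>L2: "\<rho> \<in> L2 L"
    unfolding \<rho>_def by (intro bumpL2 \<rho>)
  have "AE x in Omega_measure L. y x - k = 0"
  proof (rule fundamental_lemma_bump[OF L])
    show "(\<lambda>x. y x - k) \<in> L2 L"
      by (intro L2_diff y L2_const)
    fix c a b :: real assume c: "0 < c" "-L < a" "a < b" "b < L"
    define \<kappa> where "\<kappa> = L2_inner L (\<lambda>x. 1) (bump c a b) / L2_inner L (\<lambda>x. 1) \<rho>"
    define \<psi> where "\<psi> = (\<lambda>x. bump c a b x + - \<kappa> * \<rho> x)"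
    have smooth: "smooth_upto j \<psi>" for j
      unfolding \<psi>_def \<rho>_def by (intro smooth_upto_add smooth_upto_cmult smooth_upto_bump c \<rho>)
    have supp: "\<psi> x = 0" if "\<not> (min a a0 < x \<and> x < max b b0)" for x
      using that by (auto simp: \<psi>_def \<rho>_def bump_def)
    have mean: "(\<integral>x. \<psi> x \<partial>Omega_measure L) = 0"
      using bumpL2[OF c(1), of a b] \<rho>L2 \<rho>(5) L2_integrable
      by (simp add: \<psi>_def \<kappa>_def L2_inner_def \<rho>_def)
    have \<psi>0: "continuous_on UNIV \<psi>"
      using smooth[of 0] by simp
    have ab: "-L < min a a0" "max b b0 < L"
      using c \<rho> by auto
    note F = prim_of_supported[OF ab \<psi>0 supp mean]
    have "smooth_upto j (prim L \<psi>)" for j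
    proof -
      have "smooth_upto (Suc j) (prim L \<psi>)"
        using F(1) smooth[of j] by auto
      then show ?thesis by (rule smooth_upto_SucD)
    qed
    then have "test_function L (prim L \<psi>)"
      using ab F(2) by (rule test_functionI)
    then have "L2_inner L y (deriv (prim L \<psi>)) = 0"
      by (rule zero)
    moreover have "deriv (prim L \<psi>) = \<psi>"
      using F(1) by (auto intro!: DERIV_imp_deriv)
    ultimately have "L2_inner L y (bump c a b) = \<kappa> * L2_inner L y \<rho>"
      using y bumpL2[OF c(1), of a b] L2_cmult[OF \<rho>L2, of \<kappa>]
      unfolding \<psi>_def by (simp add: L2_inner_diff_right L2_inner_cmult_right)
    moreover have "L2_inner L (\<lambda>x. k) (bump c a b) = k * L2_inner L (\<lambda>x. 1) (bump c a b)"
      using L2_inner_cmult_left[of L k "\<lambda>x. 1"] by simp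
    ultimately show "L2_inner L (\<lambda>x. y x - k) (bump c a b) = 0"
      using y bumpL2[OF c(1), of a b] by (simp add: L2_inner_diff_left k_def \<kappa>_def)
  qed
  then show ?thesis by auto
qed

section \<open>Sobolev functions as primitives\<close>

lemma AE_eq_imp_interval_eq:
  assumes L: "0 < L" and p: "continuous_on {-L..L} p" and q: "continuous_on {-L..L} q"
    and AE: "AE x in Omega_measure L. p x = (q x :: real)" and x: "x \<in> {-L..L}"
  shows "p x = q x"
proof -
  define C where "C = {x \<in> {-L..L}. p x - q x = 0}"
  have "closed C"
    unfolding C_def by (intro continuous_closed_preimage_constant continuous_intros p q)
  have "AE x \<in> {-L<..<L} in lebesgue. x \<in> C"
    using AE by (subst (asm) AE_restrict_space_iff) (auto simp: C_def elim!: eventually_mono)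
  from mem_closed_if_AE_lebesgue_open[OF open_greaterThanLessThan \<open>closed C\<close> this] 
  have "{-L<..<L} \<subseteq> C"
    by blast
  then have "closure {-L<..<L} \<subseteq> C"
    using \<open>closed C\<close> by (rule closure_minimal)
  then show ?thesis
    using x L by (auto simp: C_def)
qed

lemma test_function_C1:
  assumes "test_function L \<phi>"
  shows "has_L2_deriv L \<phi> (deriv \<phi>)" "\<phi> (-L) = 0" "\<phi> L = 0"
proof -
  have "Ck 1 \<phi>"
    using assms by (simp add: test_function_def)
  then have d: "\<And>x. \<phi> field_differentiable at x" and c: "continuous_on UNIV (deriv \<phi>)"
    by (auto simp: Ck_def)
  show "has_L2_deriv L \<phi> (deriv \<phi>)"
  proof (rule has_L2_deriv_C1)
    show "continuous_on {-L..L} (deriv \<phi>)"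
      using c by (rule continuous_on_subset) simp
    show "(\<phi> has_real_derivative deriv \<phi> x) (at x within {-L..L})" for x
      using d[of x] by (simp add: field_differentiable_derivI has_field_derivative_at_within)
  qed
  have "{x. \<phi> x \<noteq> 0} \<subseteq> {-L<..<L}"
    using assms closure_subset[of "{x. \<phi> x \<noteq> 0}"] unfolding test_function_def by blast
  then show "\<phi> (-L) = 0" "\<phi> L = 0"
    by auto
qed

lemma has_L2_deriv_imp_weak_deriv:
  assumes L: "0 < L" and P: "has_L2_deriv L P F" and z: "AE x in Omega_measure L. z x = P x"
  shows "has_weak_deriv L z F"
  unfolding has_weak_deriv_def
proof (intro allI impI)
  fix \<phi> assume "test_function L \<phi>"
  note \<phi> = test_function_C1[OF this]
  have "L2_inner L z (deriv \<phi>) = L2_inner L P (deriv \<phi>)"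
    using z by (intro L2_inner_cong_AE) auto
  then show "L2_inner L z (deriv \<phi>) = - L2_inner L F \<phi>"
    using L2_integration_by_parts[OF L P \<phi>(1)] \<phi>(2,3) by simp
qed

text \<open>The converse is the lemma of du Bois-Reymond for the difference of the function and a primitive of
  its weak derivative.\<close>

lemma weak_deriv_imp_has_L2_deriv:
  assumes L: "0 < L" and z: "z \<in> L2 L" and v: "v \<in> L2 L" and weak: "has_weak_deriv L z v"
  shows "\<exists>P. has_L2_deriv L P v \<and> (AE x in Omega_measure L. z x = P x)"
proof -
  have "\<exists>k. AE x in Omega_measure L. z x - prim L v x = k"
  proof (rule du_Bois_Reymond[OF L])
    show "(\<lambda>x. z x - prim L v x) \<in> L2 L"
      by (intro L2_diff z prim_L2 v)
    fix \<phi> assume \<phi>: "test_function L \<phi>"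
    have "has_weak_deriv L (prim L v) v"
      using has_L2_deriv_prim[OF v, of 0] by (intro has_L2_deriv_imp_weak_deriv L) auto
    with weak \<phi> have "L2_inner L z (deriv \<phi>) = - L2_inner L v \<phi>" 
      "L2_inner L (prim L v) (deriv \<phi>) = - L2_inner L v \<phi>"
      by (auto simp: has_weak_deriv_def)
    then show "L2_inner L (\<lambda>x. z x - prim L v x) (deriv \<phi>) = 0"
      using z prim_L2[OF v] has_L2_deriv_L2[OF test_function_C1(1)[OF \<phi>]] 
      by (simp add: L2_inner_diff_left)
  qed
  then obtain k where "AE x in Omega_measure L. z x - prim L v x = k" ..
  then have "AE x in Omega_measure L. z x = k + prim L v x"
    by eventually_elim simp
  with has_L2_deriv_prim[OF v] show ?thesis
    by blast
qed

lemma has_L2_deriv_unique: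
  assumes L: "0 < L" and P: "has_L2_deriv L P F" and Q: "has_L2_deriv L Q G" 
    and AE: "AE x in Omega_measure L. P x = Q x"
  shows "AE x in Omega_measure L. F x = G x"
proof -
  have eq: "P x = Q x" if "x \<in> {-L..L}" for x
    by (rule AE_eq_imp_interval_eq[OF L has_L2_deriv_continuous[OF P] has_L2_deriv_continuous[OF Q] AE that])
  note FG = has_L2_deriv_L2[OF P] has_L2_deriv_L2[OF Q]
  have zero: "prim L (\<lambda>x. F x - G x) x = 0" if "x \<in> {-L..L}" for x
    using has_L2_derivD[OF P that] has_L2_derivD[OF Q that] eq[OF that] eq[of "-L"] L
    by (simp add: prim_diff[OF FG])
  have "AE x in Omega_measure L. F x - G x = 0"
  proof (rule prim_eq_0_imp_AE[OF L2_diff[OF FG]])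
    fix x
    show "prim L (\<lambda>x. F x - G x) x = 0"
      using zero[of x] zero[of L] L prim_eq_0_left[of x L] prim_right[of L x] prim_right[of L L]
      by (cases "x < -L"; cases "L < x") auto
  qed
  then show ?thesis by simp
qed

lemma H1_weak_deriv:
  assumes "z \<in> H1 L"
  shows "weak_deriv L z \<in> L2 L" "has_weak_deriv L z (weak_deriv L z)"
proof -
  have "\<exists>v. v \<in> L2 L \<and> has_weak_deriv L z v"
    using assms by (auto simp: H1_def)
  from someI_ex[OF this] show "weak_deriv L z \<in> L2 L" "has_weak_deriv L z (weak_deriv L z)"
    by (auto simp: weak_deriv_def)
qed

lemma H1_obtain_rep:
  assumes "0 < L" "z \<in> H1 L"
  obtains P where "has_L2_deriv L P (weak_deriv L z)" "AE x in Omega_measure L. z x = P x"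
  using weak_deriv_imp_has_L2_deriv[OF assms(1) _ H1_weak_deriv[OF assms(2)]] assms(2)
  by (auto simp: H1_def)

lemma H1_I:
  assumes "0 < L" "has_L2_deriv L P F" "AE x in Omega_measure L. z x = P x"
  shows "z \<in> H1 L"
  using has_L2_deriv_imp_weak_deriv[OF assms] L2_cong_AE[OF has_L2_deriv_in_L2[OF assms(2)] assms(3)] 
    has_L2_deriv_L2[OF assms(2)]
  by (auto simp: H1_def)

lemma weak_deriv_AE_eq:
  assumes L: "0 < L" and P: "has_L2_deriv L P F" and z: "AE x in Omega_measure L. z x = P x"
  shows "AE x in Omega_measure L. weak_deriv L z x = F x"
proof -
  obtain Q where Q: "has_L2_deriv L Q (weak_deriv L z)" "AE x in Omega_measure L. z x = Q x"
    using H1_obtain_rep[OF L H1_I[OF assms]] .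
  have "AE x in Omega_measure L. Q x = P x"
    using z Q(2) by eventually_elim simp
  then show ?thesis
    by (rule has_L2_deriv_unique[OF L Q(1) P])
qed

lemma H1_L2: "z \<in> H1 L \<Longrightarrow> z \<in> L2 L"
  by (simp add: H1_def)

lemma cont_rep_eq:
  assumes L: "0 < L" and p: "continuous_on {-L..L} p" and z: "AE x in Omega_measure L. z x = p x" 
    and x: "x \<in> {-L..L}"
  shows "cont_rep L z x = p x"
proof -
  have "continuous_on {-L..L} (cont_rep L z) \<and> (AE x in Omega_measure L. z x = cont_rep L z x)"
    unfolding cont_rep_def by (rule someI[where x = p]) (use p z in auto)
  then have c: "continuous_on {-L..L} (cont_rep L z)" and "AE x in Omega_measure L. z x = cont_rep L z x"
    by auto
  from this(2) z have "AE x in Omega_measure L. cont_rep L z x = p x"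
    by eventually_elim simp
  then show ?thesis
    by (rule AE_eq_imp_interval_eq[OF L c p _ x])
qed

lemma cont_deriv_eq:
  assumes L: "0 < L" and z: "AE x in Omega_measure L. z x = p x" 
    and p: "\<And>x. x \<in> {-L..L} \<Longrightarrow> (p has_real_derivative q x) (at x within {-L..L})"
    and x: "x \<in> {-L..L}"
  shows "cont_deriv L z x = q x"
proof -
  have "continuous_on {-L..L} p"
    using p by (rule DERIV_continuous_on)
  then have rep: "cont_rep L z t = p t" if "t \<in> {-L..L}" for t
    using L z that by (intro cont_rep_eq)
  have "(cont_rep L z has_real_derivative q x) (at x within {-L..L})"
    using p[OF x] by (rule has_field_derivative_transform_within[of _ _ _ _ 1]) (use x rep in auto)
  then have "(cont_rep L z has_vector_derivative q x) (at x within {-L..L})"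
    by (simp add: has_real_derivative_iff_has_vector_derivative)
  then show ?thesis
    unfolding cont_deriv_def using L x by (intro vector_derivative_within_closed_interval) auto
qed

text \<open>Variation of constants for \<open>\<phi> - \<phi>'' = v\<close>, with \<open>A\<close> determined by the right boundary condition.\<close>

lemma Neumann_problem_solvable:
  assumes L: "0 < L" and v: "v \<in> L2 L"
  shows "\<exists>\<phi> \<psi>. has_L2_deriv L \<phi> \<psi> \<and> has_L2_deriv L \<psi> (\<lambda>x. \<phi> x - v x) \<and> \<psi> (-L) = 0 \<and> \<psi> L = 0"
proof -
  define c s where "c = prim L (\<lambda>x. cosh x * v x)" and "s = prim L (\<lambda>x. sinh x * v x)"
  have vc: "(\<lambda>x. cosh x * v x) \<in> L2 L" and vs: "(\<lambda>x. sinh x * v x) \<in> L2 L"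
    by (intro L2_mult_continuous v continuous_intros)+
  have c: "has_L2_deriv L c (\<lambda>x. cosh x * v x)" and s: "has_L2_deriv L s (\<lambda>x. sinh x * v x)"
    using has_L2_deriv_prim[OF vc, of 0] has_L2_deriv_prim[OF vs, of 0] by (auto simp: c_def s_def)
  have cosh: "has_L2_deriv L (\<lambda>x. cosh (x + a)) (\<lambda>x. sinh (x + a))" 
    and sinh: "has_L2_deriv L (\<lambda>x. sinh (x + a)) (\<lambda>x. cosh (x + a))" for a :: real
    by (auto intro!: has_L2_deriv_C1 continuous_intros derivative_eq_intros)
  note cosh0 = cosh[of 0, simplified] and sinh0 = sinh[of 0, simplified]
  define A where "A = (cosh L * c L - sinh L * s L) / sinh (2 * L)"
  define \<phi> where "\<phi> x = A * cosh (x + L) - (sinh x * c x - cosh x * s x)" for x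
  define \<psi> where "\<psi> x = A * sinh (x + L) - (cosh x * c x - sinh x * s x)" for x
  have "has_L2_deriv L \<phi> (\<lambda>x. A * sinh (x + L) - ((cosh x * c x + sinh x * (cosh x * v x)) - 
      (sinh x * s x + cosh x * (sinh x * v x))))"
    unfolding \<phi>_def
    by (intro has_L2_deriv_diff has_L2_deriv_cmult has_L2_deriv_mult[OF L] cosh cosh0 sinh0 c s)
  then have 1: "has_L2_deriv L \<phi> \<psi>"
    by (simp add: \<psi>_def [abs_def] algebra_simps)
  have 2: "has_L2_deriv L \<psi> (\<lambda>x. A * cosh (x + L) - ((sinh x * c x + cosh x * (cosh x * v x)) - 
      (cosh x * s x + sinh x * (sinh x * v x))))"
    unfolding \<psi>_def
    by (intro has_L2_deriv_diff has_L2_deriv_cmult has_L2_deriv_mult[OF L] sinh cosh0 sinh0 c s)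
  have "A * cosh (x + L) - ((sinh x * c x + cosh x * (cosh x * v x)) - 
      (cosh x * s x + sinh x * (sinh x * v x))) = \<phi> x - v x" for x
  proof -
    have "cosh x * (cosh x * v x) = v x + sinh x * (sinh x * v x)"
      unfolding mult.assoc[symmetric] using cosh_square_eq[of x] 
      by (simp add: power2_eq_square distrib_right)
    then show ?thesis
      by (simp add: \<phi>_def)
  qed
  with 2 have "has_L2_deriv L \<psi> (\<lambda>x. \<phi> x - v x)"
    by simp
  moreover have "\<psi> (-L) = 0"
    by (simp add: \<psi>_def c_def s_def prim_eq_0_left)
  moreover have "sinh (2 * L) \<noteq> 0"
    using L by simp
  then have "\<psi> L = 0"
    by (simp add: \<psi>_def A_def)
  ultimately show ?thesis
    using 1 by blast
qed

text \<open>The functional \<open>z \<mapsto> (z, v)\<close> of \<open>L\<^sup>2\<close> is represented in \<open>H\<^sup>1\<close> by the solution of the Neumann problem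
  with right-hand side \<open>v\<close>.\<close>

lemma weakly_converges_H1_imp_L2:
  assumes L: "0 < L" and weak: "weakly_converges_in (H1 L) (H1_inner L) z z0" and v: "v \<in> L2 L"
  shows "(\<lambda>m. L2_inner L (z m) v) \<longlonglongrightarrow> L2_inner L z0 v"
proof -
  obtain \<phi> \<psi> where \<phi>: "has_L2_deriv L \<phi> \<psi>" and \<psi>: "has_L2_deriv L \<psi> (\<lambda>x. \<phi> x - v x)" 
    and bd: "\<psi> (-L) = 0" "\<psi> L = 0"
    using Neumann_problem_solvable[OF L v] by blast
  have \<phi>H: "\<phi> \<in> H1 L"
    using L \<phi> by (rule H1_I) simp
  have inner: "H1_inner L y \<phi> = L2_inner L y v" if y: "y \<in> H1 L" for y
  proof -
    obtain P where P: "has_L2_deriv L P (weak_deriv L y)" "AE x in Omega_measure L. y x = P x"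
      using H1_obtain_rep[OF L y] .
    have "L2_inner L (weak_deriv L y) (weak_deriv L \<phi>) = L2_inner L (weak_deriv L y) \<psi>"
      by (intro L2_inner_cong_AE weak_deriv_AE_eq[OF L \<phi>]) auto
    also have "\<dots> = - L2_inner L P (\<lambda>x. \<phi> x - v x)"
      using L2_integration_by_parts[OF L P(1) \<psi>] bd by simp
    also have "L2_inner L P (\<lambda>x. \<phi> x - v x) = L2_inner L y (\<lambda>x. \<phi> x - v x)"
      using P(2) by (intro L2_inner_cong_AE) auto
    finally show ?thesis
      using H1_L2[OF y] H1_L2[OF \<phi>H] v by (simp add: H1_inner_def L2_inner_diff_right)
  qed
  have z: "z m \<in> H1 L" "z0 \<in> H1 L" and lim: "(\<lambda>m. H1_inner L (z m) \<phi>) \<longlonglongrightarrow> H1_inner L z0 \<phi>" for m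
    using weak \<phi>H by (auto simp: weakly_converges_in_def)
  show ?thesis
    using lim by (simp add: inner z)
qed

section \<open>Weak limits of derivatives\<close>

text \<open>The functions whose primitive is close to \<open>p\<close> and on which a functional is at least \<open>c\<close> form a convex
  set; the strong limit from a shrinking sequence of such sets has the primitive \<open>p\<close>. The functional
  serves to identify weak limits later.\<close>

lemma L2_limit_of_primitives:
  assumes L: "0 < L" and q: "\<And>m. q m \<in> L2 L" "\<And>m. L2_norm L (q m) \<le> C"
    and lim: "uniform_limit {-L..L} (\<lambda>m. prim L (q m)) p sequentially"
    and v: "v \<in> L2 L" "\<And>m. c \<le> L2_inner L (q m) v"
  shows "\<exists>r\<in>L2 L. (\<forall>x\<in>{-L..L}. prim L r x = p x) \<and> c \<le> L2_inner L r v"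
proof -
  define A where "A k = {r \<in> L2 L. (\<forall>x\<in>{-L..L}. \<bar>prim L r x - p x\<bar> \<le> 1 / Suc k) \<and> c \<le> L2_inner L r v}" for k
  have "\<exists>s r. r \<in> L2 L \<and> (\<forall>k. s k \<in> A k) \<and> (\<lambda>k. L2_norm L (\<lambda>x. s k x - r x)) \<longlonglongrightarrow> 0"
  proof (rule L2_nested_midpoint_convex[OF L])
    show "A k \<subseteq> L2 L" for k
      by (auto simp: A_def)
    show "A (Suc k) \<subseteq> A k" for k
    proof -
      have "1 / real (Suc (Suc k)) \<le> 1 / real (Suc k)"
        by (intro divide_left_mono) auto
      then show ?thesis
        unfolding A_def using order_trans by blast
    qed
    show "(\<lambda>x. 1/2 * (y x + z x)) \<in> A k" if "y \<in> A k" "z \<in> A k" for k y z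
    proof -
      have yz: "y \<in> L2 L" "z \<in> L2 L"
        using that by (auto simp: A_def)
      have "\<bar>prim L (\<lambda>x. 1/2 * (y x + z x)) x - p x\<bar> \<le> 1 / Suc k" if x: "x \<in> {-L..L}" for x
      proof -
        have "\<bar>prim L y x - p x\<bar> \<le> 1 / Suc k" "\<bar>prim L z x - p x\<bar> \<le> 1 / Suc k"
          using \<open>y \<in> A k\<close> \<open>z \<in> A k\<close> x by (auto simp: A_def)
        moreover have "\<bar>1/2 * (a + b) - d\<bar> \<le> e" if "\<bar>a - d\<bar> \<le> e" "\<bar>b - d\<bar> \<le> e" for a b d e :: real
          using that by (simp add: abs_le_iff field_simps)
        ultimately show ?thesis
          unfolding prim_cmult prim_add[OF yz] by blast
      qed
      moreover have "c \<le> L2_inner L (\<lambda>x. 1/2 * (y x + z x)) v"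
        using that yz v(1) unfolding L2_inner_cmult_left by (simp add: L2_inner_add_left A_def)
      ultimately show ?thesis
        using L2_cmult[OF L2_add[OF yz], of "1/2"] unfolding A_def by blast
    qed
    show "\<exists>z\<in>A k. L2_norm L z \<le> C" for k
    proof -
      have "\<forall>\<^sub>F m in sequentially. \<forall>x\<in>{-L..L}. dist (prim L (q m) x) (p x) < 1 / Suc k"
        using lim by (rule uniform_limitD) simp
      then obtain m where "\<forall>x\<in>{-L..L}. dist (prim L (q m) x) (p x) < 1 / Suc k"
        by (auto simp: eventually_sequentially)
      then have "q m \<in> A k"
        using q v by (auto simp: A_def dist_real_def less_imp_le)
      with q(2) show ?thesis by blast
    qed
  qed
  then obtain s r where r: "r \<in> L2 L" and s: "\<And>k. s k \<in> A k" 
    and sr: "(\<lambda>k. L2_norm L (\<lambda>x. s k x - r x)) \<longlonglongrightarrow> 0"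
    by blast
  have sL: "s k \<in> L2 L" for k
    using s[of k] by (simp add: A_def)
  have inner: "(\<lambda>k. L2_inner L (s k) y) \<longlonglongrightarrow> L2_inner L r y" if y: "y \<in> L2 L" for y
  proof -
    have "(\<lambda>k. L2_inner L (s k) y - L2_inner L r y) \<longlonglongrightarrow> 0"
    proof (rule Lim_null_comparison)
      show "\<forall>\<^sub>F k in sequentially. norm (L2_inner L (s k) y - L2_inner L r y) \<le> 
          L2_norm L (\<lambda>x. s k x - r x) * L2_norm L y"
        using L2_Cauchy_Schwarz[OF L2_diff[OF sL r] y] 
        by (intro always_eventually allI) (simp add: L2_inner_diff_left sL r y)
      show "(\<lambda>k. L2_norm L (\<lambda>x. s k x - r x) * L2_norm L y) \<longlonglongrightarrow> 0"
        using sr by (rule tendsto_mult_left_zero)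
    qed
    then show ?thesis by (rule LIM_zero_cancel)
  qed
  have "prim L r x = p x" if x: "x \<in> {-L..L}" for x
  proof (rule LIMSEQ_unique)
    show "(\<lambda>k. prim L (s k) x) \<longlonglongrightarrow> prim L r x"
      using inner[OF L2_indicator[of "{..<x}"]] by (simp add: prim_def L2_inner_commute)
    have "(\<lambda>k. prim L (s k) x - p x) \<longlonglongrightarrow> 0"
    proof (rule Lim_null_comparison)
      show "\<forall>\<^sub>F k in sequentially. norm (prim L (s k) x - p x) \<le> 1 / Suc k"
        using s x by (auto simp: A_def)
      show "(\<lambda>k. 1 / real (Suc k)) \<longlonglongrightarrow> 0"
        by (rule LIMSEQ_Suc[OF lim_1_over_n])
    qed
    then show "(\<lambda>k. prim L (s k) x) \<longlonglongrightarrow> p x"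
      by (rule LIM_zero_cancel)
  qed
  moreover have "c \<le> L2_inner L r v"
    using inner[OF v(1)] by (rule LIMSEQ_le_const) (use s in \<open>auto simp: A_def\<close>)
  ultimately show ?thesis
    using r by blast
qed

text \<open>A subsequence on which a functional stays away from its value at the limit would produce, by the
  preceding lemma, a second function with the same primitive.\<close>

lemma L2_weak_limit_of_primitives:
  assumes L: "0 < L" and q: "\<And>m. q m \<in> L2 L" "\<And>m. L2_norm L (q m) \<le> C"
    and lim: "uniform_limit {-L..L} (\<lambda>m. prim L (q m)) p sequentially"
  shows "\<exists>r\<in>L2 L. (\<forall>x\<in>{-L..L}. prim L r x = p x) \<and> 
    (\<forall>v\<in>L2 L. (\<lambda>m. L2_inner L (q m) v) \<longlonglongrightarrow> L2_inner L r v)"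
proof -
  obtain r where r: "r \<in> L2 L" "\<And>x. x \<in> {-L..L} \<Longrightarrow> prim L r x = p x"
    using L2_limit_of_primitives[OF L q lim L2_const[of 0], of 0] by (auto simp: L2_inner_def)
  have upper: "\<forall>\<^sub>F m in sequentially. L2_inner L (q m) v < L2_inner L r v + e" 
    if v: "v \<in> L2 L" and e: "0 < e" for v e
  proof (rule ccontr)
    assume "\<not> ?thesis"
    then have "infinite {m. L2_inner L r v + e \<le> L2_inner L (q m) v}"
      unfolding infinite_nat_iff_unbounded_le eventually_sequentially by (auto simp: not_less)
    then obtain k :: "nat \<Rightarrow> nat" where k: "strict_mono k" 
      "\<And>m. L2_inner L r v + e \<le> L2_inner L (q (k m)) v"
      using infinite_enumerate by blast
    have "uniform_limit {-L..L} (\<lambda>m. prim L (q (k m))) p sequentially"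
      using filterlim_compose[OF lim filterlim_subseq[OF k(1)]] .
    from L2_limit_of_primitives[OF L q this v k(2)] obtain r' where r': "r' \<in> L2 L"
      "\<And>x. x \<in> {-L..L} \<Longrightarrow> prim L r' x = p x" "L2_inner L r v + e \<le> L2_inner L r' v"
      by blast
    have "p (-L) = 0"
      using r(2)[of "-L"] L by (simp add: prim_eq_0_left)
    with r r' have p: "has_L2_deriv L p r" "has_L2_deriv L p r'"
      unfolding has_L2_deriv_def by simp_all
    have "AE x in Omega_measure L. r x = r' x"
      by (rule has_L2_deriv_unique[OF L p]) simp
    then have "L2_inner L r v = L2_inner L r' v"
      by (intro L2_inner_cong_AE) auto
    then show False
      using r'(3) e by simp
  qed
  have "(\<lambda>m. L2_inner L (q m) v) \<longlonglongrightarrow> L2_inner L r v" if v: "v \<in> L2 L" for v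
  proof (rule tendstoI)
    fix e :: real assume "0 < e"
    have "\<forall>\<^sub>F m in sequentially. L2_inner L (q m) (\<lambda>x. -1 * v x) < L2_inner L r (\<lambda>x. -1 * v x) + e"
      using upper[OF L2_cmult[OF v] \<open>0 < e\<close>] .
    with upper[OF v \<open>0 < e\<close>] show "\<forall>\<^sub>F m in sequentially. dist (L2_inner L (q m) v) (L2_inner L r v) < e"
      unfolding L2_inner_cmult_right by eventually_elim (auto simp: dist_real_def)
  qed
  with r show ?thesis by blast
qed

section \<open>The nonlinearities\<close>

lemma Ck_1D:
  assumes "Ck 1 h"
  shows "(h has_real_derivative deriv h r) (at r)" "continuous_on UNIV (deriv h)"
  using assms by (auto simp: Ck_def field_differentiable_derivI)

lemma Ck_2D:
  assumes "Ck 2 h"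
  shows "(h has_real_derivative deriv h r) (at r)" 
    "(deriv h has_real_derivative deriv (deriv h) r) (at r)" "continuous_on UNIV (deriv (deriv h))"
proof -
  have *: "\<And>j x. j < 2 \<Longrightarrow> (deriv ^^ j) h field_differentiable at x" 
    "continuous_on UNIV ((deriv ^^ 2) h)"
    using assms by (auto simp: Ck_def)
  show "(h has_real_derivative deriv h r) (at r)" 
    "(deriv h has_real_derivative deriv (deriv h) r) (at r)" "continuous_on UNIV (deriv (deriv h))"
    using *(1)[of 0 r] *(1)[of 1 r] *(2) by (auto simp: field_differentiable_derivI numeral_2_eq_2)
qed

text \<open>The tangent inequality at the end point \<open>b\<close>. It is the form of convexity that bounds difference
  quotients of the energy.\<close>

lemma increment_le_deriv_mult:
  fixes h h' :: "real \<Rightarrow> real"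
  assumes h: "\<And>r. (h has_real_derivative h' r) (at r)" and mono: "mono h'"
  shows "h b - h a \<le> h' b * (b - a)"
proof -
  consider "a = b" | "a < b" | "b < a" by linarith
  then show ?thesis
  proof cases
    case 2
    obtain c where c: "a < c" "c < b" "h b - h a = (b - a) * h' c"
      using MVT2[OF 2 h] by blast
    then have "h' c \<le> h' b"
      using mono by (simp add: monoD)
    then show ?thesis
      using c(3) 2 by (simp add: mult.commute mult_right_mono)
  next
    case 3
    obtain c where c: "b < c" "c < a" "h a - h b = (a - b) * h' c"
      using MVT2[OF 3 h] by blast
    then have "h' b \<le> h' c"
      using mono by (simp add: monoD)
    then have "(a - b) * h' b \<le> (a - b) * h' c"
      using 3 by (intro mult_left_mono) auto
    then show ?thesis
      using c(3) by (simp add: algebra_simps)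
  qed simp
qed

text \<open>For the flux \<open>r \<mapsto> (f\<^sup>\<epsilon>)' r + \<nu>\<^sup>2 r\<close>: its inverse turns regularity of the flux into regularity of the
  derivative of the solution, with the constant \<open>1 / \<nu>\<^sup>2\<close> for all \<open>\<epsilon>\<close>.\<close>

lemma C1_inverse_of_expanding:
  fixes b b' :: "real \<Rightarrow> real"
  assumes k: "0 < k" and b: "\<And>r. (b has_real_derivative b' r) (at r)" "continuous_on UNIV b'" "\<And>r. k \<le> b' r"
  shows "\<exists>c c'. (\<forall>r. c (b r) = r) \<and> (\<forall>y. (c has_real_derivative c' y) (at y)) \<and> 
    continuous_on UNIV c' \<and> (\<forall>y. \<bar>c' y\<bar> \<le> 1 / k)"
proof -
  have expand: "k * (y - x) \<le> b y - b x" if "x \<le> y" for x y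
  proof -
    have "b x - k * x \<le> b y - k * y"
    proof (rule DERIV_nonneg_imp_nondecreasing[OF that])
      show "\<exists>d. ((\<lambda>x. b x - k * x) has_real_derivative d) (at r) \<and> 0 \<le> d" for r
        using DERIV_diff[OF b(1)[of r] DERIV_cmult_Id[of k r UNIV]] b(3)[of r] 
        by (intro exI[of _ "b' r - k"]) auto
    qed
    then show ?thesis by (simp add: algebra_simps)
  qed
  have contb: "isCont b r" for r
    using b(1) by (rule DERIV_isCont)
  have "\<exists>r. b r = y" for y
  proof -
    define R where "R = \<bar>y - b 0\<bar> / k"
    have R: "0 \<le> R" "k * R = \<bar>y - b 0\<bar>"
      using k by (auto simp: R_def)
    have "b (-R) \<le> y" "y \<le> b R"
      using expand[of "-R" 0] expand[of 0 R] R by auto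
    then show ?thesis
      using IVT[of b "-R" y R] contb R(1) by auto
  qed
  then obtain c where c: "\<And>y. b (c y) = y"
    by metis
  have cb: "c (b r) = r" for r
    using expand[of r "c (b r)"] expand[of "c (b r)" r] c[of "b r"] k
    by (cases "r \<le> c (b r)") (auto simp: mult_le_0_iff)
  have lip: "\<bar>c y - c x\<bar> \<le> 1 / k * \<bar>y - x\<bar>" for x y
    using expand[of "c x" "c y"] expand[of "c y" "c x"] k
    by (cases "c x \<le> c y") (auto simp: c field_simps)
  have contc: "isCont c y" for y
    unfolding isCont_def
  proof (rule LIM_zero_cancel, rule Lim_null_comparison)
    show "\<forall>\<^sub>F x in at y. norm (c x - c y) \<le> 1 / k * \<bar>x - y\<bar>"
      using lip by simp
    have "((\<lambda>x. 1 / k * \<bar>x - y\<bar>) \<longlongrightarrow> 1 / k * \<bar>y - y\<bar>) (at y)"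
      by (intro tendsto_intros)
    then show "((\<lambda>x. 1 / k * \<bar>x - y\<bar>) \<longlongrightarrow> 0) (at y)"
      by simp
  qed
  have pos: "0 < b' r" for r
    using b(3)[of r] k by linarith
  have "(c has_real_derivative inverse (b' (c y))) (at y)" for y
    using pos[of "c y"] by (intro DERIV_inverse_function[where f = b and a = "y - 1" and b = "y + 1"] b(1) contc c) auto
  moreover have "continuous_on UNIV (\<lambda>y. inverse (b' (c y)))"
    using pos contc by (intro continuous_intros continuous_on_compose2[OF b(2)] 
        continuous_at_imp_continuous_on) (auto simp: less_imp_neq[symmetric])
  moreover have "\<bar>inverse (b' (c y))\<bar> \<le> 1 / k" for y
    using pos[of "c y"] b(3)[of "c y"] k by (simp add: divide_inverse)
  ultimately show ?thesis
    using cb by (intro exI[of _ c] exI[of _ "\<lambda>y. inverse (b' (c y))"]) auto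
qed

locale nonlinear_data =
  fixes L \<nu> Cg :: real and f Khat K :: "real \<Rightarrow> real \<Rightarrow> real" and g :: "real \<Rightarrow> real"
  assumes L: "0 < L" and \<nu>: "0 < \<nu>"
    and f_ass: "f_assumption f" and g_ass: "g_assumption g Cg" and K_ass: "K_assumption Khat K"
begin

lemma f_0: "f 0 r = \<bar>r\<bar>"
  using f_ass by (simp add: f_assumption_def)

lemma f_at_0: "\<epsilon> \<in> {0..1} \<Longrightarrow> f \<epsilon> 0 = 0" and f_nonneg: "\<epsilon> \<in> {0..1} \<Longrightarrow> 0 \<le> f \<epsilon> r"
  using f_ass unfolding f_assumption_def 
  by (cases "\<epsilon> = 0"; force)+

lemma f_Ck: "\<epsilon> \<in> {0<..1} \<Longrightarrow> Ck 2 (f \<epsilon>)"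
  using f_ass by (simp add: f_assumption_def)

lemmas f_deriv = Ck_2D[OF f_Ck]

lemma f_deriv_mono: 
  assumes "\<epsilon> \<in> {0<..1}" shows "mono (deriv (f \<epsilon>))"
proof (rule monoI)
  fix x y :: real assume "x \<le> y"
  have "convex_on UNIV (f \<epsilon>)"
    using f_ass assms by (simp add: f_assumption_def)
  then have tangent: "deriv (f \<epsilon>) a * (b - a) \<le> f \<epsilon> b - f \<epsilon> a" for a b
    using f_deriv(1)[OF assms] by (intro convex_on_imp_above_tangent[where A = UNIV]) auto
  have "(deriv (f \<epsilon>) y - deriv (f \<epsilon>) x) * (y - x) \<ge> 0"
    using tangent[of x y] tangent[of y x] by (simp add: algebra_simps)
  then show "deriv (f \<epsilon>) x \<le> deriv (f \<epsilon>) y"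
    using \<open>x \<le> y\<close> by (cases "x = y") (auto simp: zero_le_mult_iff)
qed

lemma f_deriv2_nonneg: 
  assumes "\<epsilon> \<in> {0<..1}" shows "0 \<le> deriv (deriv (f \<epsilon>)) r"
  using f_deriv_mono[OF assms] f_deriv(2)[OF assms]
  by (intro mono_on_imp_deriv_nonneg[where A = UNIV and f = "deriv (f \<epsilon>)"]) auto

lemma f_deriv_continuous: "\<epsilon> \<in> {0<..1} \<Longrightarrow> continuous_on S (deriv (f \<epsilon>))"
  using f_deriv(2) by (meson DERIV_isCont continuous_at_imp_continuous_on)

lemma f_deriv_at_0: 
  assumes "\<epsilon> \<in> {0<..1}" shows "deriv (f \<epsilon>) 0 = 0"
  using assms f_nonneg[of \<epsilon>] f_at_0[of \<epsilon>]
  by (intro DERIV_local_min[OF f_deriv(1)[OF assms], of 1 0]) auto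

lemma f_deriv_sign: 
  assumes "\<epsilon> \<in> {0<..1}" shows "0 \<le> deriv (f \<epsilon>) r * r"
  using monoD[OF f_deriv_mono[OF assms], of 0 r] monoD[OF f_deriv_mono[OF assms], of r 0] 
    f_deriv_at_0[OF assms] by (cases "0 \<le> r") (auto intro: mult_nonpos_nonpos)

lemma f_deriv_growth: 
  obtains C where "0 < C" "\<And>\<epsilon> r. \<epsilon> \<in> {0<..1} \<Longrightarrow> \<bar>deriv (f \<epsilon>) r\<bar> \<le> C * (1 + \<bar>r\<bar>)"
  using f_ass unfolding f_assumption_def by blast

lemma f_continuous: 
  assumes "\<epsilon> \<in> {0..1}" shows "continuous_on S (f \<epsilon>)"
proof (cases "\<epsilon> = 0")
  case True
  then show ?thesis
    by (simp add: f_0[abs_def] continuous_intros)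
next
  case False
  with assms have "\<epsilon> \<in> {0<..1}" by auto
  from f_deriv(1)[OF this] show ?thesis
    by (meson DERIV_isCont continuous_at_imp_continuous_on)
qed

text \<open>The linear growth of the derivatives makes the family equi-Lipschitz on bounded sets. This upgrades
  the pointwise convergence in \<open>\<epsilon>\<close> to convergence along converging arguments.\<close>

lemma f_Lipschitz:
  obtains C where "0 < C" "\<And>\<epsilon> R r s. \<epsilon> \<in> {0..1} \<Longrightarrow> \<bar>r\<bar> \<le> R \<Longrightarrow> \<bar>s\<bar> \<le> R \<Longrightarrow>
    \<bar>f \<epsilon> r - f \<epsilon> s\<bar> \<le> C * (1 + R) * \<bar>r - s\<bar>"
proof -
  obtain C where C: "0 < C" "\<And>\<epsilon> r. \<epsilon> \<in> {0<..1} \<Longrightarrow> \<bar>deriv (f \<epsilon>) r\<bar> \<le> C * (1 + \<bar>r\<bar>)"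
    by (rule f_deriv_growth) blast
  have pos: "\<bar>f \<epsilon> r - f \<epsilon> s\<bar> \<le> C * (1 + R) * \<bar>r - s\<bar>" 
    if \<epsilon>: "\<epsilon> \<in> {0<..1}" and "\<bar>r\<bar> \<le> R" "\<bar>s\<bar> \<le> R" for \<epsilon> R r s
  proof -
    have "norm (f \<epsilon> r - f \<epsilon> s) \<le> C * (1 + R) * norm (r - s)"
    proof (rule field_differentiable_bound[of "{-R..R}"])
      show "(f \<epsilon> has_field_derivative deriv (f \<epsilon>) z) (at z within {-R..R})" for z
        using f_deriv(1)[OF \<epsilon>] by (rule has_field_derivative_at_within)
      show "norm (deriv (f \<epsilon>) z) \<le> C * (1 + R)" if "z \<in> {-R..R}" for z
      proof -
        have "C * (1 + \<bar>z\<bar>) \<le> C * (1 + R)"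
          using that C(1) by (intro mult_left_mono) auto
        then show ?thesis
          using C(2)[OF \<epsilon>, of z] by simp
      qed
    qed (use that in auto)
    then show ?thesis by simp
  qed
  show ?thesis
  proof (rule that[of "max C 1"])
    fix \<epsilon> R r s :: real assume *: "\<epsilon> \<in> {0..1}" "\<bar>r\<bar> \<le> R" "\<bar>s\<bar> \<le> R"
    have R: "0 \<le> R"
      using *(2) by linarith
    show "\<bar>f \<epsilon> r - f \<epsilon> s\<bar> \<le> max C 1 * (1 + R) * \<bar>r - s\<bar>"
    proof (cases "\<epsilon> = 0")
      case True
      have "1 * 1 \<le> max C 1 * (1 + R)"
        using R by (intro mult_mono) auto
      then have "1 * \<bar>r - s\<bar> \<le> max C 1 * (1 + R) * \<bar>r - s\<bar>"
        by (intro mult_right_mono) auto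
      then show ?thesis
        using True by (simp add: f_0)
    next
      case False
      have "C * (1 + R) * \<bar>r - s\<bar> \<le> max C 1 * (1 + R) * \<bar>r - s\<bar>"
        using R by (intro mult_right_mono) auto
      then show ?thesis
        using pos[of \<epsilon> r R s] False * by auto
    qed
  qed simp
qed

lemma f_growth:
  obtains C where "0 < C" "\<And>\<epsilon> r. \<epsilon> \<in> {0..1} \<Longrightarrow> f \<epsilon> r \<le> C * (\<bar>r\<bar> + r\<^sup>2)"
proof -
  obtain C where C: "0 < C" "\<And>\<epsilon> R r s. \<epsilon> \<in> {0..1} \<Longrightarrow> \<bar>r\<bar> \<le> R \<Longrightarrow> \<bar>s\<bar> \<le> R \<Longrightarrow>
    \<bar>f \<epsilon> r - f \<epsilon> s\<bar> \<le> C * (1 + R) * \<bar>r - s\<bar>"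
    using f_Lipschitz by blast
  have "f \<epsilon> r \<le> C * (\<bar>r\<bar> + r\<^sup>2)" if "\<epsilon> \<in> {0..1}" for \<epsilon> r
  proof -
    have "f \<epsilon> r \<le> C * (1 + \<bar>r\<bar>) * \<bar>r\<bar>"
      using C(2)[OF that, of r "\<bar>r\<bar>" 0] f_at_0[OF that] by simp
    also have "\<dots> = C * (\<bar>r\<bar> + r\<^sup>2)"
      by (simp add: distrib_left distrib_right power2_eq_square mult.assoc flip: abs_mult)
    finally show ?thesis .
  qed
  with C(1) that show ?thesis by blast
qed

lemma f_integrable:
  assumes "\<epsilon> \<in> {0..1}" "v \<in> L2 L"
  shows "integrable (Omega_measure L) (\<lambda>x. f \<epsilon> (v x))"
proof -
  obtain C where C: "0 < C" "\<And>\<epsilon> r. \<epsilon> \<in> {0..1} \<Longrightarrow> f \<epsilon> r \<le> C * (\<bar>r\<bar> + r\<^sup>2)"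
    using f_growth by blast
  show ?thesis
  proof (rule Bochner_Integration.integrable_bound)
    show "integrable (Omega_measure L) (\<lambda>x. C * (\<bar>v x\<bar> + (v x)\<^sup>2))"
      using L2_integrable[OF assms(2)] assms(2) by (auto simp: L2_def)
    show "(\<lambda>x. f \<epsilon> (v x)) \<in> borel_measurable (Omega_measure L)"
      by (rule measurable_compose[OF L2_measurable[OF assms(2)] 
            borel_measurable_continuous_onI[OF f_continuous[OF assms(1)]]])
    show "AE x in Omega_measure L. norm (f \<epsilon> (v x)) \<le> norm (C * (\<bar>v x\<bar> + (v x)\<^sup>2))"
    proof (rule AE_I2)
      fix x
      show "norm (f \<epsilon> (v x)) \<le> norm (C * (\<bar>v x\<bar> + (v x)\<^sup>2))"
        using C(2)[OF assms(1), of "v x"] f_nonneg[OF assms(1), of "v x"] by simp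
    qed
  qed
qed

lemma f_tendsto:
  assumes \<epsilon>s: "\<And>m. \<epsilon>s m \<in> {0..1}" "\<epsilon>s \<longlonglongrightarrow> \<epsilon>" "\<epsilon> \<in> {0..1}" and r: "r \<longlonglongrightarrow> r0"
  shows "(\<lambda>m. f (\<epsilon>s m) (r m)) \<longlonglongrightarrow> f \<epsilon> r0"
proof -
  have "((\<lambda>\<epsilon>. f \<epsilon> r0) \<longlongrightarrow> f \<epsilon> r0) (at \<epsilon> within {0..1})"
    using f_ass \<epsilon>s(3) by (simp add: f_assumption_def)
  then have "continuous (at \<epsilon> within {0..1}) (\<lambda>\<epsilon>. f \<epsilon> r0)"
    by (simp add: continuous_within)
  then have 1: "(\<lambda>m. f (\<epsilon>s m) r0) \<longlonglongrightarrow> f \<epsilon> r0"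
    by (rule continuous_within_tendsto_compose'[OF _ \<epsilon>s(1,2)])
  obtain R where R: "\<And>m. \<bar>r m\<bar> \<le> R"
    using convergent_imp_Bseq[OF convergentI[OF r]] by (auto simp: Bseq_def)
  have R0: "\<bar>r0\<bar> \<le> R"
    using tendsto_rabs[OF r] by (rule LIMSEQ_le_const2) (use R in auto)
  obtain C where C: "0 < C" "\<And>\<epsilon> R r s. \<epsilon> \<in> {0..1} \<Longrightarrow> \<bar>r\<bar> \<le> R \<Longrightarrow> \<bar>s\<bar> \<le> R \<Longrightarrow>
    \<bar>f \<epsilon> r - f \<epsilon> s\<bar> \<le> C * (1 + R) * \<bar>r - s\<bar>"
    using f_Lipschitz by blast
  have 2: "(\<lambda>m. f (\<epsilon>s m) (r m) - f (\<epsilon>s m) r0) \<longlonglongrightarrow> 0"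
  proof (rule Lim_null_comparison)
    show "\<forall>\<^sub>F m in sequentially. norm (f (\<epsilon>s m) (r m) - f (\<epsilon>s m) r0) \<le> C * (1 + R) * \<bar>r m - r0\<bar>"
      using C(2)[OF \<epsilon>s(1) R R0] by simp
    show "(\<lambda>m. C * (1 + R) * \<bar>r m - r0\<bar>) \<longlonglongrightarrow> 0"
      by (intro tendsto_mult_right_zero tendsto_rabs_zero LIM_zero r)
  qed
  from tendsto_add[OF 1 2] show ?thesis by simp
qed

lemma f_integral_tendsto:
  assumes \<epsilon>s: "\<And>m. \<epsilon>s m \<in> {0..1}" "\<epsilon>s \<longlonglongrightarrow> \<epsilon>" "\<epsilon> \<in> {0..1}" and v: "v \<in> L2 L"
  shows "(\<lambda>m. \<integral>x. f (\<epsilon>s m) (v x) \<partial>Omega_measure L) \<longlonglongrightarrow> (\<integral>x. f \<epsilon> (v x) \<partial>Omega_measure L)"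
proof -
  obtain C where C: "0 < C" "\<And>\<epsilon> r. \<epsilon> \<in> {0..1} \<Longrightarrow> f \<epsilon> r \<le> C * (\<bar>r\<bar> + r\<^sup>2)"
    using f_growth by blast
  show ?thesis
  proof (rule integral_dominated_convergence[where w = "\<lambda>x. C * (\<bar>v x\<bar> + (v x)\<^sup>2)"])
    show "integrable (Omega_measure L) (\<lambda>x. C * (\<bar>v x\<bar> + (v x)\<^sup>2))"
      using L2_integrable[OF v] v by (auto simp: L2_def)
    show "AE x in Omega_measure L. (\<lambda>m. f (\<epsilon>s m) (v x)) \<longlonglongrightarrow> f \<epsilon> (v x)"
      by (intro AE_I2 f_tendsto \<epsilon>s tendsto_const)
    show "AE x in Omega_measure L. norm (f (\<epsilon>s m) (v x)) \<le> C * (\<bar>v x\<bar> + (v x)\<^sup>2)" for m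
      using C(2)[OF \<epsilon>s(1)] f_nonneg[OF \<epsilon>s(1)] by (intro AE_I2) simp
  qed (use f_integrable[OF _ v] \<epsilon>s in auto)
qed

lemma g_continuous: "continuous_on S g"
proof -
  have "Ck 1 g"
    using g_ass by (simp add: g_assumption_def)
  from Ck_1D(1)[OF this] show ?thesis
    by (meson DERIV_isCont continuous_at_imp_continuous_on)
qed

lemma g_one_sided: "- Cg * (a - b)\<^sup>2 \<le> (g a - g b) * (a - b)"
proof -
  have "mono (\<lambda>r. g r + Cg * r)"
    using g_ass by (simp add: g_assumption_def)
  from monoD[OF this, of a b] monoD[OF this, of b a]
  have "0 \<le> ((g a + Cg * a) - (g b + Cg * b)) * (a - b)"
    by (cases "a \<le> b") (auto intro: mult_nonpos_nonpos)
  then show ?thesis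
    by (simp add: algebra_simps power2_eq_square)
qed

lemma Cg_pos: "0 < Cg"
  using g_ass by (simp add: g_assumption_def)

lemma K_deriv:
  assumes "\<delta> \<in> {0<..1}"
  shows "(Khat \<delta> has_real_derivative K \<delta> r) (at r)" 
    "(K \<delta> has_real_derivative deriv (K \<delta>) r) (at r)" "continuous_on UNIV (deriv (K \<delta>))"
    "0 \<le> deriv (K \<delta>) r"
  using K_ass assms Ck_1D[of "K \<delta>"] by (auto simp: K_assumption_def)

lemma K_mono: "\<delta> \<in> {0<..1} \<Longrightarrow> mono (K \<delta>)"
  by (rule monoI, rule DERIV_nonneg_imp_nondecreasing) (use K_deriv(2,4) in blast)+

lemma Khat_at_0: "\<delta> \<in> {0<..1} \<Longrightarrow> r \<in> {-1..1} \<Longrightarrow> Khat \<delta> r = 0"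
  using K_ass unfolding K_assumption_def by blast

lemma K_at_0: 
  assumes "\<delta> \<in> {0<..1}" shows "K \<delta> 0 = 0"
proof (rule DERIV_local_const[OF K_deriv(1)[OF assms], of 1])
  show "\<forall>y. \<bar>0 - y\<bar> < 1 \<longrightarrow> Khat \<delta> 0 = Khat \<delta> y"
    using Khat_at_0[OF assms] by (simp add: abs_if split: if_splits)
qed simp

lemma K_Lipschitz:
  assumes "\<delta> \<in> {0<..1}"
  obtains C where "0 < C" "\<And>r s. \<bar>K \<delta> r - K \<delta> s\<bar> \<le> C * \<bar>r - s\<bar>"
proof -
  obtain C where C: "0 < C" "\<And>r. 0 \<le> deriv (K \<delta>) r \<and> deriv (K \<delta>) r \<le> C"
    using K_ass assms unfolding K_assumption_def by blast
  have "norm (K \<delta> r - K \<delta> s) \<le> C * norm (r - s)" for r s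
    using C(2) K_deriv(2)[OF assms] by (intro field_differentiable_bound[of UNIV]) auto
  with C(1) that show ?thesis by auto
qed

lemma K_continuous: "\<delta> \<in> {0<..1} \<Longrightarrow> continuous_on S (K \<delta>)"
  using K_deriv(2) by (meson DERIV_isCont continuous_at_imp_continuous_on)

lemma Khat_continuous: "\<delta> \<in> {0<..1} \<Longrightarrow> continuous_on S (Khat \<delta>)"
  using K_deriv(1) by (meson DERIV_isCont continuous_at_imp_continuous_on)

lemma Khat_nonneg: 
  assumes "\<delta> \<in> {0<..1}" shows "0 \<le> Khat \<delta> r"
  using increment_le_deriv_mult[OF K_deriv(1)[OF assms] K_mono[OF assms], where a = r and b = 0]
    K_at_0[OF assms] Khat_at_0[OF assms, of 0] by simp

section \<open>The energy\<close>

text \<open>The real value of \<open>Psi\<close> for \<open>\<delta> > 0\<close>, in terms of a representative \<open>P\<close> and its derivative \<open>F\<close>.\<close>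

definition energy_at :: "real \<Rightarrow> real \<Rightarrow> (real \<Rightarrow> real) \<Rightarrow> (real \<Rightarrow> real) \<Rightarrow> real" where
  "energy_at \<epsilon> \<delta> P F = (\<integral>x. f \<epsilon> (F x) \<partial>Omega_measure L) + 
     \<nu>\<^sup>2 / 2 * (L2_norm L F)\<^sup>2 + (\<integral>x. Khat \<delta> (P x) \<partial>Omega_measure L)"

lemma Khat_integral_cong_AE:
  "AE x in Omega_measure L. z x = P x \<Longrightarrow> Khat_integral L Khat \<delta> z = Khat_integral L Khat \<delta> P"
  unfolding Khat_integral_def
  by (intro arg_cong[where f = enn2ereal] nn_integral_cong_AE) (auto elim!: eventually_mono)

lemma Psi_eq:
  assumes P: "has_L2_deriv L P F" and z: "AE x in Omega_measure L. z x = P x" and \<epsilon>: "\<epsilon> \<in> {0..1}"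
  shows "Psi L \<nu> f Khat \<epsilon> \<delta> z = ereal ((\<integral>x. f \<epsilon> (F x) \<partial>Omega_measure L) + 
     \<nu>\<^sup>2 / 2 * (L2_norm L F)\<^sup>2) + Khat_integral L Khat \<delta> P"
proof -
  have zH: "z \<in> H1 L"
    by (rule H1_I[OF L P z])
  have wd: "AE x in Omega_measure L. weak_deriv L z x = F x"
    by (rule weak_deriv_AE_eq[OF L P z])
  have F: "F \<in> L2 L"
    using P by (rule has_L2_deriv_L2)
  have "(\<integral>\<^sup>+x. ennreal (f \<epsilon> (weak_deriv L z x)) \<partial>Omega_measure L) = 
      (\<integral>\<^sup>+x. ennreal (f \<epsilon> (F x)) \<partial>Omega_measure L)"
    using wd by (intro nn_integral_cong_AE) (auto elim!: eventually_mono)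
  also have "\<dots> = ennreal (\<integral>x. f \<epsilon> (F x) \<partial>Omega_measure L)"
    using f_integrable[OF \<epsilon> F] f_nonneg[OF \<epsilon>] by (intro nn_integral_eq_integral) auto
  finally have 1: "enn2ereal (\<integral>\<^sup>+x. ennreal (f \<epsilon> (weak_deriv L z x)) \<partial>Omega_measure L) = 
      ereal (\<integral>x. f \<epsilon> (F x) \<partial>Omega_measure L)"
    using f_nonneg[OF \<epsilon>] by (simp add: enn2ereal_ennreal)
  have 2: "(\<integral>x. (weak_deriv L z x)\<^sup>2 \<partial>Omega_measure L) = (L2_norm L F)\<^sup>2"
    using L2_inner_cong_AE[OF wd wd] unfolding L2_norm_square
    by (simp add: L2_inner_def power2_eq_square)
  show ?thesis
    unfolding Psi_def 1 2 Khat_integral_cong_AE[OF z] using zH by simp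
qed

lemma Khat_integrable:
  assumes "\<delta> \<in> {0<..1}" "continuous_on {-L..L} P"
  shows "integrable (Omega_measure L) (\<lambda>x. Khat \<delta> (P x))"
  by (intro L2_integrable L2_continuous continuous_on_compose2[OF Khat_continuous[OF assms(1)] assms(2)]) auto

lemma Khat_integral_eq:
  assumes "\<delta> \<in> {0<..1}" "continuous_on {-L..L} P"
  shows "Khat_integral L Khat \<delta> P = ereal (\<integral>x. Khat \<delta> (P x) \<partial>Omega_measure L)"
proof -
  have "(\<integral>\<^sup>+x. e2ennreal (Khat_ext Khat \<delta> (P x)) \<partial>Omega_measure L) = 
      (\<integral>\<^sup>+x. ennreal (Khat \<delta> (P x)) \<partial>Omega_measure L)"
    using assms(1) by (simp add: Khat_ext_def e2ennreal_ereal)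
  also have "\<dots> = ennreal (\<integral>x. Khat \<delta> (P x) \<partial>Omega_measure L)"
    using Khat_integrable[OF assms] Khat_nonneg[OF assms(1)] by (intro nn_integral_eq_integral) auto
  finally show ?thesis
    using Khat_nonneg[OF assms(1)] by (simp add: Khat_integral_def enn2ereal_ennreal)
qed

lemma Psi_eq_energy:
  assumes P: "has_L2_deriv L P F" and z: "AE x in Omega_measure L. z x = P x" and "\<epsilon> \<in> {0..1}" "\<delta> \<in> {0<..1}"
  shows "Psi L \<nu> f Khat \<epsilon> \<delta> z = ereal (energy_at \<epsilon> \<delta> P F)"
  unfolding Psi_eq[OF assms(1-3)] Khat_integral_eq[OF assms(4) has_L2_deriv_continuous[OF P]] energy_at_def
  by simp

lemma Psi_dom_I:
  assumes P: "has_L2_deriv L P F" and z: "AE x in Omega_measure L. z x = P x" and "\<epsilon> \<in> {0..1}" "\<delta> \<in> {0<..1}"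
  shows "z \<in> Psi_dom L \<nu> f Khat \<epsilon> \<delta>"
  using Psi_eq_energy[OF assms] H1_L2[OF H1_I[OF L P z]] by (simp add: Psi_dom_def)

lemma Psi_dom_H1: "z \<in> Psi_dom L \<nu> f Khat \<epsilon> \<delta> \<Longrightarrow> z \<in> H1 L"
  by (auto simp: Psi_dom_def Psi_def split: if_splits)

lemma energy_at_bounds:
  assumes "\<epsilon> \<in> {0..1}" "\<delta> \<in> {0<..1}"
  shows "\<nu>\<^sup>2 / 2 * (L2_norm L F)\<^sup>2 \<le> energy_at \<epsilon> \<delta> P F" "0 \<le> energy_at \<epsilon> \<delta> P F"
proof -
  show *: "\<nu>\<^sup>2 / 2 * (L2_norm L F)\<^sup>2 \<le> energy_at \<epsilon> \<delta> P F"
    unfolding energy_at_def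
    using f_nonneg[OF assms(1)] Khat_nonneg[OF assms(2)] 
    by (simp add: add_increasing2 add_increasing integral_nonneg)
  then show "0 \<le> energy_at \<epsilon> \<delta> P F"
    by (rule order_trans[rotated]) simp
qed

end

section \<open>Euler-Lagrange equation and a priori bounds for one time step\<close>

lemma L2_growth_compose:
  assumes b: "continuous_on UNIV b" "\<And>r. \<bar>b r\<bar> \<le> C * (1 + \<bar>r\<bar>)" and v: "v \<in> L2 L"
  shows "(\<lambda>x. b (v x :: real) :: real) \<in> L2 L"
proof (rule L2_dominated)
  show "(\<lambda>x. b (v x)) \<in> borel_measurable (Omega_measure L)"
    by (rule measurable_compose[OF L2_measurable[OF v] borel_measurable_continuous_onI[OF b(1)]])
  show "(\<lambda>x. C * (1 + \<bar>v x\<bar>)) \<in> L2 L"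
    by (intro L2_cmult L2_add L2_const L2_abs v)
  show "AE x in Omega_measure L. \<bar>b (v x)\<bar> \<le> \<bar>C * (1 + \<bar>v x\<bar>)\<bar>"
    using b(2) by (intro AE_I2) (auto intro: order_trans[OF _ abs_ge_self])
qed

text \<open>The passage to the limit in difference quotients, by dominated convergence.\<close>

lemma L2_inner_directional_limit:
  assumes b: "continuous_on UNIV b" "\<And>r. \<bar>b r\<bar> \<le> C * (1 + \<bar>r\<bar>)" and v: "v \<in> L2 L" and w: "w \<in> L2 L"
  shows "(\<lambda>j. L2_inner L (\<lambda>x. b (v x + 1 / Suc j * w x)) w) \<longlonglongrightarrow> L2_inner L (\<lambda>x. b (v x)) w"
  unfolding L2_inner_def
proof (rule integral_dominated_convergence[where w = "\<lambda>x. \<bar>C\<bar> * (1 + \<bar>v x\<bar> + \<bar>w x\<bar>) * \<bar>w x\<bar>"])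
  show "(\<lambda>x. b (v x) * w x) \<in> borel_measurable (Omega_measure L)"
    by (intro borel_measurable_integrable integrable_mult_L2 L2_growth_compose[OF b] v w)
  show "(\<lambda>x. b (v x + 1 / real (Suc j) * w x) * w x) \<in> borel_measurable (Omega_measure L)" for j
    by (intro borel_measurable_integrable integrable_mult_L2 L2_growth_compose[OF b] L2_add L2_cmult v w)
  show "integrable (Omega_measure L) (\<lambda>x. \<bar>C\<bar> * (1 + \<bar>v x\<bar> + \<bar>w x\<bar>) * \<bar>w x\<bar>)"
    by (intro integrable_mult_L2 L2_cmult L2_add L2_const L2_abs v w)
  show "AE x in Omega_measure L. (\<lambda>j. b (v x + 1 / real (Suc j) * w x) * w x) \<longlonglongrightarrow> b (v x) * w x"
  proof (rule AE_I2)
    fix x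
    have "(\<lambda>j. v x + 1 / real (Suc j) * w x) \<longlonglongrightarrow> v x + 0 * w x"
      by (intro tendsto_intros LIMSEQ_Suc[OF lim_1_over_n])
    moreover have "isCont b (v x + 0 * w x)"
      using b(1) by (simp add: continuous_on_eq_continuous_at)
    ultimately have "(\<lambda>j. b (v x + 1 / real (Suc j) * w x)) \<longlonglongrightarrow> b (v x + 0 * w x)"
      by (rule isCont_tendsto_compose[rotated])
    then show "(\<lambda>j. b (v x + 1 / real (Suc j) * w x) * w x) \<longlonglongrightarrow> b (v x) * w x"
      by (intro tendsto_mult tendsto_const) simp
  qed
  show "AE x in Omega_measure L. norm (b (v x + 1 / real (Suc j) * w x) * w x) \<le> 
      \<bar>C\<bar> * (1 + \<bar>v x\<bar> + \<bar>w x\<bar>) * \<bar>w x\<bar>" for j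
  proof (rule AE_I2)
    fix x
    have "1 / real (Suc j) * \<bar>w x\<bar> \<le> 1 * \<bar>w x\<bar>"
      by (intro mult_right_mono) auto
    then have "\<bar>v x + 1 / real (Suc j) * w x\<bar> \<le> \<bar>v x\<bar> + \<bar>w x\<bar>"
      using abs_triangle_ineq[of "v x" "1 / real (Suc j) * w x"] by (simp add: abs_mult)
    then have "\<bar>C\<bar> * (1 + \<bar>v x + 1 / real (Suc j) * w x\<bar>) \<le> \<bar>C\<bar> * (1 + \<bar>v x\<bar> + \<bar>w x\<bar>)"
      by (intro mult_left_mono) auto
    moreover have "\<bar>b (v x + 1 / real (Suc j) * w x)\<bar> \<le> \<bar>C\<bar> * (1 + \<bar>v x + 1 / real (Suc j) * w x\<bar>)"
      by (rule order_trans[OF b(2)]) (intro mult_right_mono, auto)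
    ultimately have "\<bar>b (v x + 1 / real (Suc j) * w x)\<bar> \<le> \<bar>C\<bar> * (1 + \<bar>v x\<bar> + \<bar>w x\<bar>)"
      by linarith
    then show "norm (b (v x + 1 / real (Suc j) * w x) * w x) \<le> \<bar>C\<bar> * (1 + \<bar>v x\<bar> + \<bar>w x\<bar>) * \<bar>w x\<bar>"
      unfolding real_norm_def abs_mult by (rule mult_right_mono) simp
  qed
qed

context nonlinear_data
begin

text \<open>In one implicit time step the previous state and the forcing enter only through the sum \<open>h\<close> of
  both with weights, and \<open>\<kappa>\<close> is the reciprocal of the step size.\<close>

definition step_solution :: "real \<Rightarrow> real \<Rightarrow> real \<Rightarrow> (real \<Rightarrow> real) \<Rightarrow> (real \<Rightarrow> real) \<Rightarrow> bool" where
  "step_solution \<kappa> \<epsilon> \<delta> h w \<longleftrightarrow> w \<in> Psi_dom L \<nu> f Khat \<epsilon> \<delta> \<and>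
     (\<forall>z\<in>Psi_dom L \<nu> f Khat \<epsilon> \<delta>. 
        ereal (L2_inner L (\<lambda>x. \<kappa> * w x + g (w x) - h x) (\<lambda>x. w x - z x)) +
        Psi L \<nu> f Khat \<epsilon> \<delta> w - Psi L \<nu> f Khat \<epsilon> \<delta> z \<le> 0)"

lemma residual_L2:
  assumes "has_L2_deriv L W F" "h \<in> L2 L"
  shows "(\<lambda>x. \<kappa> * W x + g (W x) - h x) \<in> L2 L"
proof -
  have W: "continuous_on {-L..L} W"
    using assms(1) by (rule has_L2_deriv_continuous)
  have "continuous_on {-L..L} (\<lambda>x. \<kappa> * W x + g (W x))"
    by (intro continuous_intros W continuous_on_compose2[OF g_continuous[of UNIV] W]) auto
  then show ?thesis
    by (intro L2_diff assms L2_continuous)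
qed

text \<open>For \<open>\<delta> > 0\<close> the energy is finite on all of \<open>H\<^sup>1\<close>, so every representative is an admissible
  competitor.\<close>

lemma step_solution_inequality:
  assumes \<epsilon>: "\<epsilon> \<in> {0..1}" and \<delta>: "\<delta> \<in> {0<..1}" and sol: "step_solution \<kappa> \<epsilon> \<delta> h w"
    and W: "has_L2_deriv L W F" "AE x in Omega_measure L. w x = W x" and Z: "has_L2_deriv L Z G"
  shows "L2_inner L (\<lambda>x. \<kappa> * W x + g (W x) - h x) (\<lambda>x. W x - Z x) + energy_at \<epsilon> \<delta> W F \<le> energy_at \<epsilon> \<delta> Z G"
proof -
  have "Z \<in> Psi_dom L \<nu> f Khat \<epsilon> \<delta>"
    by (rule Psi_dom_I[OF Z _ \<epsilon> \<delta>]) simp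
  then have "ereal (L2_inner L (\<lambda>x. \<kappa> * w x + g (w x) - h x) (\<lambda>x. w x - Z x)) +
        Psi L \<nu> f Khat \<epsilon> \<delta> w - Psi L \<nu> f Khat \<epsilon> \<delta> Z \<le> 0"
    using sol by (simp add: step_solution_def)
  moreover have "L2_inner L (\<lambda>x. \<kappa> * w x + g (w x) - h x) (\<lambda>x. w x - Z x) = 
      L2_inner L (\<lambda>x. \<kappa> * W x + g (W x) - h x) (\<lambda>x. W x - Z x)"
    by (intro L2_inner_cong_AE) (use W(2) in \<open>auto elim!: eventually_mono\<close>)
  ultimately show ?thesis
    using Psi_eq_energy[OF W \<epsilon> \<delta>] Psi_eq_energy[OF Z _ \<epsilon> \<delta>, of Z] by simp
qed

text \<open>The Euler-Lagrange equation. Convexity bounds the difference quotients of the energy in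
  direction \<open>\<Phi>\<close> from above by derivatives at the shifted points, which converge.\<close>

lemma Euler_Lagrange:
  assumes \<epsilon>: "\<epsilon> \<in> {0<..1}" and \<delta>: "\<delta> \<in> {0<..1}" and h: "h \<in> L2 L" and sol: "step_solution \<kappa> \<epsilon> \<delta> h w"
    and W: "has_L2_deriv L W F" "AE x in Omega_measure L. w x = W x" and \<Phi>: "has_L2_deriv L \<Phi> G"
  shows "L2_inner L (\<lambda>x. \<kappa> * W x + g (W x) - h x + K \<delta> (W x)) \<Phi> + 
    L2_inner L (\<lambda>x. deriv (f \<epsilon>) (F x) + \<nu>\<^sup>2 * F x) G = 0"
proof -
  have \<epsilon>': "\<epsilon> \<in> {0..1}"
    using \<epsilon> by auto
  have F: "F \<in> L2 L"
    using W(1) by (rule has_L2_deriv_L2)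
  let ?a = "\<lambda>x. \<kappa> * W x + g (W x) - h x"
  have a: "?a \<in> L2 L"
    using W(1) h by (rule residual_L2)
  obtain C where C: "0 < C" "\<And>r. \<bar>deriv (f \<epsilon>) r\<bar> \<le> C * (1 + \<bar>r\<bar>)"
    using \<epsilon> by (rule_tac f_deriv_growth) blast
  obtain CK where CK: "0 < CK" "\<And>r s. \<bar>K \<delta> r - K \<delta> s\<bar> \<le> CK * \<bar>r - s\<bar>"
    using K_Lipschitz[OF \<delta>] by blast
  have K_growth: "\<bar>K \<delta> r\<bar> \<le> CK * (1 + \<bar>r\<bar>)" for r
  proof -
    have "CK * \<bar>r\<bar> \<le> CK * (1 + \<bar>r\<bar>)"
      using CK(1) by simp
    then show ?thesis
      using CK(2)[of r 0] K_at_0[OF \<delta>] by simp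
  qed
  note fc = f_deriv_continuous[OF \<epsilon>, of UNIV] and Kc = K_continuous[OF \<delta>, of UNIV]
  have lower: "0 \<le> L2_inner L (\<lambda>x. ?a x + K \<delta> (W x)) \<Phi> + L2_inner L (\<lambda>x. deriv (f \<epsilon>) (F x) + \<nu>\<^sup>2 * F x) G"
    if \<Phi>: "has_L2_deriv L \<Phi> G" for \<Phi> G
  proof -
    have G: "G \<in> L2 L" and \<Phi>L: "\<Phi> \<in> L2 L"
      using \<Phi> by (rule has_L2_deriv_L2, rule has_L2_deriv_in_L2)
    have WL: "W \<in> L2 L"
      using W(1) by (rule has_L2_deriv_in_L2)
    let ?X = "\<lambda>j. L2_inner L ?a \<Phi> + L2_inner L (\<lambda>x. deriv (f \<epsilon>) (F x + 1 / Suc j * G x)) G + 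
      (\<nu>\<^sup>2 * L2_inner L F G + \<nu>\<^sup>2 / 2 * (1 / Suc j) * (L2_norm L G)\<^sup>2) + 
      L2_inner L (\<lambda>x. K \<delta> (W x + 1 / Suc j * \<Phi> x)) \<Phi>"
    have "0 \<le> ?X j" for j
    proof -
      define s where "s = 1 / real (Suc j)"
      have s: "0 < s" 
        by (simp add: s_def)
      let ?Z = "\<lambda>x. W x + s * \<Phi> x" and ?H = "\<lambda>x. F x + s * G x"
      have Z: "has_L2_deriv L ?Z ?H"
        by (intro has_L2_deriv_add has_L2_deriv_cmult W(1) \<Phi>)
      have H: "?H \<in> L2 L" and ZL: "?Z \<in> L2 L"
        using Z by (rule has_L2_deriv_L2, rule has_L2_deriv_in_L2)
      have "(\<lambda>x. W x - ?Z x) = (\<lambda>x. - s * \<Phi> x)"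
        by auto
      then have "- s * L2_inner L ?a \<Phi> + energy_at \<epsilon> \<delta> W F \<le> energy_at \<epsilon> \<delta> ?Z ?H"
        using step_solution_inequality[OF \<epsilon>' \<delta> sol W Z] by (simp only: L2_inner_cmult_right)
      moreover have "(\<integral>x. f \<epsilon> (?H x) \<partial>Omega_measure L) - (\<integral>x. f \<epsilon> (F x) \<partial>Omega_measure L) \<le> 
          s * L2_inner L (\<lambda>x. deriv (f \<epsilon>) (?H x)) G"
      proof -
        have "(\<integral>x. f \<epsilon> (?H x) - f \<epsilon> (F x) \<partial>Omega_measure L) \<le> 
            (\<integral>x. deriv (f \<epsilon>) (?H x) * (s * G x) \<partial>Omega_measure L)"
        proof (rule integral_mono)
          show "integrable (Omega_measure L) (\<lambda>x. f \<epsilon> (?H x) - f \<epsilon> (F x))"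
            by (intro Bochner_Integration.integrable_diff f_integrable \<epsilon>' H F)
          show "integrable (Omega_measure L) (\<lambda>x. deriv (f \<epsilon>) (?H x) * (s * G x))"
            by (intro integrable_mult_L2 L2_growth_compose[OF fc C(2)] H L2_cmult G)
          show "f \<epsilon> (?H x) - f \<epsilon> (F x) \<le> deriv (f \<epsilon>) (?H x) * (s * G x)" for x
            using increment_le_deriv_mult[OF f_deriv(1)[OF \<epsilon>] f_deriv_mono[OF \<epsilon>], where a = "F x" and b = "?H x"] by simp
        qed
        then show ?thesis
          using f_integrable[OF \<epsilon>' H] f_integrable[OF \<epsilon>' F]
          by (simp add: L2_inner_def mult.left_commute[of _ s])
      qed
      moreover have "(\<integral>x. Khat \<delta> (?Z x) \<partial>Omega_measure L) - (\<integral>x. Khat \<delta> (W x) \<partial>Omega_measure L) \<le> 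
          s * L2_inner L (\<lambda>x. K \<delta> (?Z x)) \<Phi>"
      proof -
        note iK = Khat_integrable[OF \<delta> has_L2_deriv_continuous[OF Z]] 
          Khat_integrable[OF \<delta> has_L2_deriv_continuous[OF W(1)]]
        have "(\<integral>x. Khat \<delta> (?Z x) - Khat \<delta> (W x) \<partial>Omega_measure L) \<le> 
            (\<integral>x. K \<delta> (?Z x) * (s * \<Phi> x) \<partial>Omega_measure L)"
        proof (rule integral_mono)
          show "integrable (Omega_measure L) (\<lambda>x. Khat \<delta> (?Z x) - Khat \<delta> (W x))"
            by (intro Bochner_Integration.integrable_diff iK)
          show "integrable (Omega_measure L) (\<lambda>x. K \<delta> (?Z x) * (s * \<Phi> x))"
            by (intro integrable_mult_L2 L2_growth_compose[OF Kc K_growth] ZL L2_cmult \<Phi>L)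
          show "Khat \<delta> (?Z x) - Khat \<delta> (W x) \<le> K \<delta> (?Z x) * (s * \<Phi> x)" for x
            using increment_le_deriv_mult[OF K_deriv(1)[OF \<delta>] K_mono[OF \<delta>], where a = "W x" and b = "?Z x"] by simp
        qed
        then show ?thesis
          using iK by (simp add: L2_inner_def mult.left_commute[of _ s])
      qed
      moreover have "\<nu>\<^sup>2 / 2 * (L2_norm L ?H)\<^sup>2 - \<nu>\<^sup>2 / 2 * (L2_norm L F)\<^sup>2 = 
          s * (\<nu>\<^sup>2 * L2_inner L F G + \<nu>\<^sup>2 / 2 * s * (L2_norm L G)\<^sup>2)"
        unfolding L2_norm_add_square[OF F L2_cmult[OF G]] L2_inner_cmult_right L2_norm_cmult
        by (simp add: algebra_simps power2_eq_square)
      ultimately have "0 \<le> s * (L2_inner L ?a \<Phi> + L2_inner L (\<lambda>x. deriv (f \<epsilon>) (?H x)) G + 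
          (\<nu>\<^sup>2 * L2_inner L F G + \<nu>\<^sup>2 / 2 * s * (L2_norm L G)\<^sup>2) + L2_inner L (\<lambda>x. K \<delta> (?Z x)) \<Phi>)"
        unfolding energy_at_def distrib_left by linarith
      then show ?thesis
        using s unfolding s_def[symmetric] by (simp add: zero_le_mult_iff)
    qed
    moreover have "?X \<longlonglongrightarrow> L2_inner L ?a \<Phi> + L2_inner L (\<lambda>x. deriv (f \<epsilon>) (F x)) G + 
      (\<nu>\<^sup>2 * L2_inner L F G + \<nu>\<^sup>2 / 2 * 0 * (L2_norm L G)\<^sup>2) + L2_inner L (\<lambda>x. K \<delta> (W x)) \<Phi>"
      by (intro tendsto_intros L2_inner_directional_limit[OF fc C(2) F G] 
          L2_inner_directional_limit[OF Kc K_growth WL \<Phi>L] LIMSEQ_Suc[OF lim_1_over_n])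
    ultimately have "0 \<le> L2_inner L ?a \<Phi> + L2_inner L (\<lambda>x. deriv (f \<epsilon>) (F x)) G + 
      (\<nu>\<^sup>2 * L2_inner L F G + \<nu>\<^sup>2 / 2 * 0 * (L2_norm L G)\<^sup>2) + L2_inner L (\<lambda>x. K \<delta> (W x)) \<Phi>"
      by (intro LIMSEQ_le_const) auto
    moreover have "L2_inner L (\<lambda>x. ?a x + K \<delta> (W x)) \<Phi> = L2_inner L ?a \<Phi> + L2_inner L (\<lambda>x. K \<delta> (W x)) \<Phi>"
      by (intro L2_inner_add_left a L2_growth_compose[OF Kc K_growth] WL \<Phi>L)
    moreover have "L2_inner L (\<lambda>x. deriv (f \<epsilon>) (F x) + \<nu>\<^sup>2 * F x) G = 
        L2_inner L (\<lambda>x. deriv (f \<epsilon>) (F x)) G + \<nu>\<^sup>2 * L2_inner L F G"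
      by (subst L2_inner_add_left) 
        (auto intro!: L2_growth_compose[OF fc C(2)] L2_cmult F G simp: L2_inner_cmult_left)
    ultimately show ?thesis by simp
  qed
  have "0 \<le> - (L2_inner L (\<lambda>x. ?a x + K \<delta> (W x)) \<Phi> + L2_inner L (\<lambda>x. deriv (f \<epsilon>) (F x) + \<nu>\<^sup>2 * F x) G)"
    using lower[OF has_L2_deriv_cmult[OF \<Phi>, of "-1"]] unfolding L2_inner_cmult_right by simp
  with lower[OF \<Phi>] show ?thesis
    by simp
qed

text \<open>Testing with all constants and all primitives identifies the flux as a primitive. The flux is an
  expanding function of the derivative of the solution, so this derivative is itself absolutely
  continuous. The penalty is controlled by testing with \<open>K \<delta> (W x)\<close>, because the flux term is then
  nonnegative.\<close>

lemma step_solution_regularity: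
  assumes \<epsilon>: "\<epsilon> \<in> {0<..1}" and \<delta>: "\<delta> \<in> {0<..1}" and h: "h \<in> L2 L" and sol: "step_solution \<kappa> \<epsilon> \<delta> h w"
    and W: "has_L2_deriv L W F" "AE x in Omega_measure L. w x = W x"
  shows "\<exists>q\<in>L2 L. (AE x in Omega_measure L. F x = prim L q x) \<and> 
    L2_norm L q \<le> 2 / \<nu>\<^sup>2 * L2_norm L (\<lambda>x. \<kappa> * W x + g (W x) - h x)"
proof -
  let ?a = "\<lambda>x. \<kappa> * W x + g (W x) - h x"
  let ?R = "\<lambda>x. ?a x + K \<delta> (W x)" and ?\<sigma> = "\<lambda>x. deriv (f \<epsilon>) (F x) + \<nu>\<^sup>2 * F x"
  have F: "F \<in> L2 L"
    using W(1) by (rule has_L2_deriv_L2)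
  have a: "?a \<in> L2 L"
    using W(1) h by (rule residual_L2)
  have KW: "has_L2_deriv L (\<lambda>x. K \<delta> (W x)) (\<lambda>x. deriv (K \<delta>) (W x) * F x)"
    by (rule has_L2_deriv_chain[OF L W(1) K_deriv(2,3)[OF \<delta>]])
  have R: "?R \<in> L2 L"
    by (intro L2_add a has_L2_deriv_in_L2[OF KW])
  obtain C where C: "0 < C" "\<And>r. \<bar>deriv (f \<epsilon>) r\<bar> \<le> C * (1 + \<bar>r\<bar>)"
    using \<epsilon> by (rule_tac f_deriv_growth) blast
  have \<sigma>: "?\<sigma> \<in> L2 L"
    by (intro L2_add L2_cmult F L2_growth_compose[OF f_deriv_continuous[OF \<epsilon>] C(2)])
  note EL = Euler_Lagrange[OF \<epsilon> \<delta> h sol W]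
  have mean: "prim L ?R L = 0"
  proof -
    have "has_L2_deriv L (\<lambda>x. 1) (\<lambda>x. 0)"
      by (rule has_L2_deriv_C1) auto
    from EL[OF this] show ?thesis
      by (simp add: L2_inner_def prim_right)
  qed
  have orth: "L2_inner L (\<lambda>x. ?\<sigma> x - prim L ?R x) G = 0" if G: "G \<in> L2 L" for G
  proof -
    have pG: "has_L2_deriv L (prim L G) G" and pR: "has_L2_deriv L (prim L ?R) ?R"
      using has_L2_deriv_prim[OF G, of 0] has_L2_deriv_prim[OF R, of 0] by simp_all
    have "L2_inner L ?R (prim L G) + L2_inner L (prim L ?R) G = 0"
      using L2_integration_by_parts[OF L pR pG] mean by (simp add: prim_eq_0_left)
    with EL[OF pG] show ?thesis
      using L2_inner_diff_left[OF \<sigma> prim_L2[OF R] G] by simp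
  qed
  have "L2_norm L (\<lambda>x. ?\<sigma> x - prim L ?R x) = 0"
    using orth[OF L2_diff[OF \<sigma> prim_L2[OF R]]] by (simp add: L2_norm_def)
  then have flux: "AE x in Omega_measure L. ?\<sigma> x - prim L ?R x = 0"
    by (rule L2_norm_eq_0_AE[OF L2_diff[OF \<sigma> prim_L2[OF R]]])
  have "\<exists>c c'. (\<forall>r. c (deriv (f \<epsilon>) r + \<nu>\<^sup>2 * r) = r) \<and> (\<forall>y. (c has_real_derivative c' y) (at y)) \<and> 
    continuous_on UNIV c' \<and> (\<forall>y. \<bar>c' y\<bar> \<le> 1 / \<nu>\<^sup>2)"
  proof (rule C1_inverse_of_expanding[where b' = "\<lambda>r. deriv (deriv (f \<epsilon>)) r + \<nu>\<^sup>2"])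
    show "((\<lambda>r. deriv (f \<epsilon>) r + \<nu>\<^sup>2 * r) has_real_derivative deriv (deriv (f \<epsilon>)) r + \<nu>\<^sup>2) (at r)" for r
      using DERIV_add[OF f_deriv(2)[OF \<epsilon>] DERIV_cmult_Id] .
    show "continuous_on UNIV (\<lambda>r. deriv (deriv (f \<epsilon>)) r + \<nu>\<^sup>2)"
      by (intro continuous_intros f_deriv(3)[OF \<epsilon>])
    show "\<nu>\<^sup>2 \<le> deriv (deriv (f \<epsilon>)) r + \<nu>\<^sup>2" for r
      using f_deriv2_nonneg[OF \<epsilon>] by simp
  qed (use \<nu> in simp)
  then obtain c c' where c: "\<And>r. c (deriv (f \<epsilon>) r + \<nu>\<^sup>2 * r) = r" 
    "\<And>y. (c has_real_derivative c' y) (at y)" "continuous_on UNIV c'" "\<And>y. \<bar>c' y\<bar> \<le> 1 / \<nu>\<^sup>2"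
    by blast
  define q where "q = (\<lambda>x. c' (prim L ?R x) * ?R x)"
  have "has_L2_deriv L (prim L ?R) ?R"
    using has_L2_deriv_prim[OF R, of 0] by simp
  then have p: "has_L2_deriv L (\<lambda>x. c (prim L ?R x)) q"
    unfolding q_def by (rule has_L2_deriv_chain[OF L _ c(2,3)])
  have q: "q \<in> L2 L"
    using p by (rule has_L2_deriv_L2)
  have "c 0 = 0"
    using c(1)[of 0] f_deriv_at_0[OF \<epsilon>] by simp
  then have cq: "c (prim L ?R x) = prim L q x" if "x \<in> {-L..L}" for x
    using has_L2_derivD[OF p that] by (simp add: prim_eq_0_left)
  have Fq: "AE x in Omega_measure L. F x = prim L q x"
    using flux AE_space
  proof eventually_elim
    case (elim x)
    then have "c (prim L ?R x) = F x"
      using c(1)[of "F x"] by simp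
    with cq[of x] elim show ?case by simp
  qed
  have "L2_norm L q \<le> 1 / \<nu>\<^sup>2 * L2_norm L ?R"
  proof -
    have "L2_norm L q \<le> L2_norm L (\<lambda>x. 1 / \<nu>\<^sup>2 * ?R x)"
    proof (rule L2_norm_mono[OF L2_measurable[OF q] L2_cmult[OF R]], rule AE_I2)
      fix x
      have "\<bar>q x\<bar> \<le> 1 / \<nu>\<^sup>2 * \<bar>?R x\<bar>"
        unfolding q_def abs_mult by (intro mult_right_mono c(4)) simp
      then show "\<bar>q x\<bar> \<le> \<bar>1 / \<nu>\<^sup>2 * ?R x\<bar>"
        by (simp add: abs_mult)
    qed
    then show ?thesis
      unfolding L2_norm_cmult by simp
  qed
  moreover have "L2_norm L ?R \<le> 2 * L2_norm L ?a"
  proof -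
    let ?k = "\<lambda>x. K \<delta> (W x)"
    have k: "?k \<in> L2 L"
      using KW by (rule has_L2_deriv_in_L2)
    have "0 \<le> L2_inner L ?\<sigma> (\<lambda>x. deriv (K \<delta>) (W x) * F x)"
      unfolding L2_inner_def
    proof (rule Bochner_Integration.integral_nonneg)
      fix x
      have "0 \<le> (deriv (f \<epsilon>) (F x) * F x + \<nu>\<^sup>2 * (F x)\<^sup>2) * deriv (K \<delta>) (W x)"
        by (rule mult_nonneg_nonneg[OF add_nonneg_nonneg[OF f_deriv_sign[OF \<epsilon>]] K_deriv(4)[OF \<delta>]]) simp
      then show "0 \<le> ?\<sigma> x * (deriv (K \<delta>) (W x) * F x)"
        by (simp add: algebra_simps power2_eq_square)
    qed
    then have "L2_inner L ?R ?k \<le> 0"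
      using EL[OF KW] by linarith
    then have "(L2_norm L ?k)\<^sup>2 \<le> - L2_inner L ?a ?k"
      unfolding L2_norm_square using L2_inner_add_left[OF a k k] by linarith
    also have "\<dots> \<le> L2_norm L ?a * L2_norm L ?k"
      using L2_Cauchy_Schwarz[OF a k] by linarith
    finally have "L2_norm L ?k \<le> L2_norm L ?a"
      unfolding power2_eq_square using L2_norm_nonneg[of L ?k] L2_norm_nonneg[of L ?a] 
      by (metis mult_right_le_imp_le order_le_less)
    then show ?thesis
      using L2_norm_triangle[OF a k] by linarith
  qed
  then have "1 / \<nu>\<^sup>2 * L2_norm L ?R \<le> 1 / \<nu>\<^sup>2 * (2 * L2_norm L ?a)"
    by (rule mult_left_mono) simp
  ultimately have "L2_norm L q \<le> 2 / \<nu>\<^sup>2 * L2_norm L ?a"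
    by simp
  with q Fq show ?thesis
    by blast
qed

text \<open>Testing with \<open>0\<close> bounds the solution in \<open>H\<^sup>1\<close>, because the reciprocal \<open>\<kappa>\<close> of the step size
  dominates the negative part of the derivative of \<open>g\<close>.\<close>

lemma step_solution_energy_bound:
  assumes \<epsilon>: "\<epsilon> \<in> {0..1}" and \<delta>: "\<delta> \<in> {0<..1}" and h: "h \<in> L2 L" and sol: "step_solution \<kappa> \<epsilon> \<delta> h w"
    and W: "has_L2_deriv L W F" "AE x in Omega_measure L. w x = W x" and \<kappa>: "1 + Cg \<le> \<kappa>"
  defines "H \<equiv> L2_norm L h + \<bar>g 0\<bar> * sqrt (2 * L)"
  shows "L2_norm L W \<le> H" "energy_at \<epsilon> \<delta> W F \<le> H\<^sup>2"
proof -
  let ?a = "\<lambda>x. \<kappa> * W x + g (W x) - h x"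
  have WL: "W \<in> L2 L"
    using W(1) by (rule has_L2_deriv_in_L2)
  have a: "?a \<in> L2 L"
    using W(1) h by (rule residual_L2)
  have H0: "0 \<le> H"
    using L by (simp add: H_def)
  have zero: "has_L2_deriv L (\<lambda>x. 0) (\<lambda>x. 0)"
    by (rule has_L2_deriv_C1) auto
  have energy_0: "energy_at \<epsilon> \<delta> (\<lambda>x. 0) (\<lambda>x. 0) = 0"
    using f_at_0[OF \<epsilon>] Khat_at_0[OF \<delta>, of 0] by (simp add: energy_at_def L2_norm_const[OF L])
  have "L2_inner L ?a W + energy_at \<epsilon> \<delta> W F \<le> 0"
    using step_solution_inequality[OF \<epsilon> \<delta> sol W zero] energy_0 by simp
  moreover have "L2_inner L (\<lambda>x. W x + (g 0 - h x)) W \<le> L2_inner L ?a W"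
    unfolding L2_inner_def
  proof (rule integral_mono)
    show "integrable (Omega_measure L) (\<lambda>x. (W x + (g 0 - h x)) * W x)"
      by (intro integrable_mult_L2 L2_add L2_diff L2_const WL h)
    show "integrable (Omega_measure L) (\<lambda>x. ?a x * W x)"
      by (intro integrable_mult_L2 a WL)
    fix x
    have "- Cg * (W x)\<^sup>2 \<le> (g (W x) - g 0) * W x"
      using g_one_sided[of "W x" 0] by simp
    moreover have "(1 + Cg) * (W x)\<^sup>2 \<le> \<kappa> * (W x)\<^sup>2"
      using \<kappa> by (intro mult_right_mono) auto
    ultimately show "(W x + (g 0 - h x)) * W x \<le> ?a x * W x"
      by (simp add: algebra_simps power2_eq_square)
  qed
  moreover have "L2_inner L (\<lambda>x. W x + (g 0 - h x)) W = (L2_norm L W)\<^sup>2 - L2_inner L (\<lambda>x. h x - g 0) W"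
    using WL h by (simp add: L2_norm_square L2_inner_add_left L2_inner_diff_left L2_diff)
  moreover have "L2_inner L (\<lambda>x. h x - g 0) W \<le> H * L2_norm L W"
  proof -
    have "L2_inner L (\<lambda>x. h x - g 0) W \<le> L2_norm L (\<lambda>x. h x - g 0) * L2_norm L W"
      using L2_Cauchy_Schwarz[OF L2_diff[OF h L2_const[of "g 0"]] WL] by linarith
    also have "L2_norm L (\<lambda>x. h x - g 0) \<le> H"
      using L2_norm_triangle_diff[OF h L2_const[of "g 0"]] by (simp add: H_def L2_norm_const[OF L])
    finally show ?thesis
      by (simp add: mult_right_mono)
  qed
  ultimately have main: "(L2_norm L W)\<^sup>2 + energy_at \<epsilon> \<delta> W F \<le> H * L2_norm L W"
    by linarith
  have "0 \<le> energy_at \<epsilon> \<delta> W F"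
    using energy_at_bounds(2)[OF \<epsilon> \<delta>] .
  with main have "L2_norm L W * L2_norm L W \<le> H * L2_norm L W"
    by (simp add: power2_eq_square)
  then show WH: "L2_norm L W \<le> H"
    using H0 L2_norm_nonneg[of L W] by (cases "L2_norm L W = 0") auto
  have "energy_at \<epsilon> \<delta> W F \<le> H * L2_norm L W"
    using main zero_le_power2[of "L2_norm L W"] by linarith
  also have "\<dots> \<le> H\<^sup>2"
    unfolding power2_eq_square using WH H0 by (rule mult_left_mono)
  finally show "energy_at \<epsilon> \<delta> W F \<le> H\<^sup>2" .
qed

text \<open>The oscillation is controlled by the derivative, and the mean by the norm.\<close>

lemma has_L2_deriv_sup_bound:
  assumes W: "has_L2_deriv L W F" and x: "x \<in> {-L..L}"
  shows "\<bar>W x\<bar> \<le> L2_norm L W / sqrt (2 * L) + L2_norm L F * sqrt (2 * L)"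
proof -
  have F: "F \<in> L2 L" and WL: "W \<in> L2 L"
    using W by (rule has_L2_deriv_L2, rule has_L2_deriv_in_L2)
  let ?D = "L2_norm L F * sqrt (2 * L)"
  have "\<bar>W x\<bar> * sqrt (2 * L) = L2_norm L (\<lambda>y. W x)"
    by (simp add: L2_norm_const[OF L])
  also have "\<dots> \<le> L2_norm L (\<lambda>y. \<bar>W y\<bar> + ?D)"
  proof (rule L2_norm_mono)
    show "AE y in Omega_measure L. \<bar>W x\<bar> \<le> \<bar>\<bar>W y\<bar> + ?D\<bar>"
    proof (rule AE_I2)
      fix y assume "y \<in> space (Omega_measure L)"
      then have y: "y \<in> {-L..L}" by simp
      have "\<bar>W x - W y\<bar> \<le> L2_norm L F * sqrt \<bar>x - y\<bar>"
        using prim_Hoelder[OF F, of x y] has_L2_derivD[OF W x] has_L2_derivD[OF W y] by argo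
      also have "\<dots> \<le> ?D"
        using x y by (intro mult_left_mono) auto
      finally show "\<bar>W x\<bar> \<le> \<bar>\<bar>W y\<bar> + ?D\<bar>" by linarith
    qed
    show "(\<lambda>y. \<bar>W y\<bar> + ?D) \<in> L2 L"
      by (intro L2_add L2_abs L2_const WL)
  qed simp
  also have "\<dots> \<le> L2_norm L W + ?D * sqrt (2 * L)"
    using L2_norm_triangle[OF L2_abs[OF WL] L2_const[of ?D]] L
    by (simp add: L2_norm_abs L2_norm_const abs_mult)
  finally show ?thesis
    using L by (simp add: field_simps)
qed

text \<open>The \<open>H\<^sup>1\<close> bound gives a bound in the supremum norm, hence one for \<open>g\<close> at the solution, and the
  regularity estimate then bounds the second derivative. The constants do not see \<open>\<epsilon>\<close>, \<open>\<delta>\<close>, and this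
  is what makes solutions for different parameters relatively compact.\<close>

lemma step_solution_H2_bound:
  assumes \<kappa>: "1 + Cg \<le> \<kappa>"
  shows "\<exists>C. \<forall>\<epsilon>\<in>{0<..1}. \<forall>\<delta>\<in>{0<..1}. \<forall>h\<in>L2 L. \<forall>w. L2_norm L h \<le> B \<longrightarrow> step_solution \<kappa> \<epsilon> \<delta> h w \<longrightarrow>
    (\<exists>c q. q \<in> L2 L \<and> L2_norm L q \<le> C \<and> \<bar>c\<bar> \<le> C \<and> 
      (AE x in Omega_measure L. w x = c + prim L (prim L q) x))"
proof -
  define H where "H = B + \<bar>g 0\<bar> * sqrt (2 * L)"
  define D where "D = H / sqrt (2 * L) + 2 * H / \<nu> * sqrt (2 * L)"
  obtain Gm where "\<And>r. r \<in> {-D..D} \<Longrightarrow> \<bar>g r\<bar> \<le> Gm"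
    by (rule continuous_on_Icc_bounded[OF g_continuous]) blast
  then have Gm: "\<And>r. \<bar>r\<bar> \<le> D \<Longrightarrow> \<bar>g r\<bar> \<le> Gm"
    by (simp add: abs_le_iff)
  define A where "A = \<kappa> * H + Gm * sqrt (2 * L) + B"
  have \<kappa>0: "0 \<le> \<kappa>"
    using \<kappa> Cg_pos by linarith
  have main: "\<exists>c q. q \<in> L2 L \<and> L2_norm L q \<le> 2 / \<nu>\<^sup>2 * A \<and> \<bar>c\<bar> \<le> D \<and> 
      (AE x in Omega_measure L. w x = c + prim L (prim L q) x)"
    if \<epsilon>: "\<epsilon> \<in> {0<..1}" and \<delta>: "\<delta> \<in> {0<..1}" and h: "h \<in> L2 L" "L2_norm L h \<le> B" 
      and sol: "step_solution \<kappa> \<epsilon> \<delta> h w" for \<epsilon> \<delta> h w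
  proof -
    have \<epsilon>': "\<epsilon> \<in> {0..1}"
      using \<epsilon> by auto
    have "w \<in> H1 L"
      using sol by (auto simp: step_solution_def dest: Psi_dom_H1)
    then obtain W where W: "has_L2_deriv L W (weak_deriv L w)" "AE x in Omega_measure L. w x = W x"
      using H1_obtain_rep[OF L] by blast
    define F where "F = weak_deriv L w"
    note W = W[folded F_def]
    have F: "F \<in> L2 L" and WL: "W \<in> L2 L"
      using W(1) by (rule has_L2_deriv_L2, rule has_L2_deriv_in_L2)
    let ?H = "L2_norm L h + \<bar>g 0\<bar> * sqrt (2 * L)"
    have HH: "?H \<le> H" "0 \<le> ?H"
      using h(2) L by (auto simp: H_def)
    note eb = step_solution_energy_bound[OF \<epsilon>' \<delta> h(1) sol W \<kappa>]
    have WH: "L2_norm L W \<le> H"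
      using eb(1) HH(1) by linarith
    have "\<nu>\<^sup>2 / 2 * (L2_norm L F)\<^sup>2 \<le> ?H\<^sup>2"
      using energy_at_bounds(1)[OF \<epsilon>' \<delta>] eb(2) by (rule order_trans)
    also have "\<dots> \<le> H\<^sup>2"
      using HH by (intro power_mono) auto
    finally have "\<nu>\<^sup>2 * (L2_norm L F)\<^sup>2 \<le> 4 * H\<^sup>2"
      using zero_le_power2[of H] by linarith
    then have "(\<nu> * L2_norm L F)\<^sup>2 \<le> (2 * H)\<^sup>2"
      by (simp add: power_mult_distrib)
    then have "\<nu> * L2_norm L F \<le> 2 * H"
      by (rule power2_le_imp_le) (use HH in linarith)
    then have FH: "L2_norm L F \<le> 2 * H / \<nu>"
      using \<nu> by (simp add: field_simps)
    have sup: "\<bar>W x\<bar> \<le> D" if "x \<in> {-L..L}" for x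
    proof -
      have "L2_norm L W / sqrt (2 * L) + L2_norm L F * sqrt (2 * L) \<le> D"
        unfolding D_def using WH FH L by (intro add_mono divide_right_mono mult_right_mono) auto
      then show ?thesis
        using has_L2_deriv_sup_bound[OF W(1) that] by linarith
    qed
    let ?a = "\<lambda>x. \<kappa> * W x + g (W x) - h x"
    have gW: "(\<lambda>x. g (W x)) \<in> L2 L"
      by (intro L2_continuous continuous_on_compose2[OF g_continuous[of UNIV] has_L2_deriv_continuous[OF W(1)]]) auto
    have "L2_norm L (\<lambda>x. g (W x)) \<le> L2_norm L (\<lambda>x. Gm)"
    proof (rule L2_norm_mono[OF L2_measurable[OF gW] L2_const], rule AE_I2)
      fix x assume "x \<in> space (Omega_measure L)"
      then have "\<bar>g (W x)\<bar> \<le> Gm"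
        by (intro Gm sup) auto
      then show "\<bar>g (W x)\<bar> \<le> \<bar>Gm\<bar>" by linarith
    qed
    moreover have "0 \<le> Gm"
      using Gm[OF sup[of 0]] L by force
    ultimately have gN: "L2_norm L (\<lambda>x. g (W x)) \<le> Gm * sqrt (2 * L)"
      by (simp add: L2_norm_const[OF L])
    have "L2_norm L ?a \<le> L2_norm L (\<lambda>x. \<kappa> * W x + g (W x)) + L2_norm L h"
      by (intro L2_norm_triangle_diff L2_add L2_cmult WL gW h)
    also have "L2_norm L (\<lambda>x. \<kappa> * W x + g (W x)) \<le> L2_norm L (\<lambda>x. \<kappa> * W x) + L2_norm L (\<lambda>x. g (W x))"
      by (intro L2_norm_triangle L2_cmult WL gW)
    also have "L2_norm L (\<lambda>x. \<kappa> * W x) \<le> \<kappa> * H"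
      unfolding L2_norm_cmult using \<kappa>0 WH by (simp add: mult_left_mono)
    finally have aA: "L2_norm L ?a \<le> A"
      using gN h(2) by (simp add: A_def)
    obtain q where q: "q \<in> L2 L" "AE x in Omega_measure L. F x = prim L q x" 
      "L2_norm L q \<le> 2 / \<nu>\<^sup>2 * L2_norm L ?a"
      using step_solution_regularity[OF \<epsilon> \<delta> h(1) sol W] by blast
    have "L2_norm L q \<le> 2 / \<nu>\<^sup>2 * A"
      by (rule order_trans[OF q(3)]) (use aA in \<open>intro mult_left_mono, auto\<close>)
    moreover have "AE x in Omega_measure L. w x = W (-L) + prim L (prim L q) x"
      using W(2) AE_space
    proof eventually_elim
      case (elim x)
      then have "x \<in> {-L..L}" by simp
      with has_L2_derivD[OF W(1) this] elim(1) prim_cong_AE[OF q(2), of x] show ?case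
        by presburger
    qed
    moreover have "\<bar>W (-L)\<bar> \<le> D"
      using L by (intro sup) auto
    ultimately show ?thesis
      using q(1) by blast
  qed
  have "\<exists>c q. q \<in> L2 L \<and> L2_norm L q \<le> max (2 / \<nu>\<^sup>2 * A) D \<and> \<bar>c\<bar> \<le> max (2 / \<nu>\<^sup>2 * A) D \<and> 
      (AE x in Omega_measure L. w x = c + prim L (prim L q) x)"
    if "\<epsilon> \<in> {0<..1}" "\<delta> \<in> {0<..1}" "h \<in> L2 L" "L2_norm L h \<le> B" "step_solution \<kappa> \<epsilon> \<delta> h w" for \<epsilon> \<delta> h w
  proof -
    from main[OF that] obtain c q where "q \<in> L2 L" "L2_norm L q \<le> 2 / \<nu>\<^sup>2 * A" "\<bar>c\<bar> \<le> D"
      "AE x in Omega_measure L. w x = c + prim L (prim L q) x"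
      by blast
    then show ?thesis
      by (intro exI[of _ c] exI[of _ q]) (simp add: le_max_iff_disj)
  qed
  then show ?thesis
    by blast
qed

end

section \<open>Passage to the limit in one time step\<close>

text \<open>Dominated convergence on the bounded interval.\<close>

lemma L2_norm_tendsto_bounded:
  assumes L: "0 < L" and u: "\<And>m. u m \<in> L2 L" "u0 \<in> L2 L" 
    and bound: "\<And>m x. x \<in> {-L..L} \<Longrightarrow> \<bar>u m x\<bar> \<le> R"
    and lim: "\<And>x. x \<in> {-L..L} \<Longrightarrow> (\<lambda>m. u m x) \<longlonglongrightarrow> u0 x"
  shows "(\<lambda>m. L2_norm L (\<lambda>x. u m x - u0 x)) \<longlonglongrightarrow> 0"
proof -
  have bound0: "\<bar>u0 x\<bar> \<le> R" if "x \<in> {-L..L}" for x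
    using tendsto_rabs[OF lim[OF that]] by (rule LIMSEQ_le_const2) (use bound[OF that] in auto)
  have "(\<lambda>m. \<integral>x. (u m x - u0 x) * (u m x - u0 x) \<partial>Omega_measure L) \<longlonglongrightarrow> (\<integral>x. 0 \<partial>Omega_measure L)"
  proof (rule integral_dominated_convergence[where w = "\<lambda>x. (2 * R) * (2 * R)"])
    show "(\<lambda>x. (u m x - u0 x) * (u m x - u0 x)) \<in> borel_measurable (Omega_measure L)" for m
      by (intro borel_measurable_integrable integrable_mult_L2 L2_diff u)
    show "AE x in Omega_measure L. (\<lambda>m. (u m x - u0 x) * (u m x - u0 x)) \<longlonglongrightarrow> 0"
    proof (rule AE_I2)
      fix x assume "x \<in> space (Omega_measure L)"
      then have "(\<lambda>m. u m x - u0 x) \<longlonglongrightarrow> 0"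
        using LIM_zero[OF lim[of x]] by simp
      then show "(\<lambda>m. (u m x - u0 x) * (u m x - u0 x)) \<longlonglongrightarrow> 0"
        using tendsto_mult_zero by blast
    qed
    show "AE x in Omega_measure L. norm ((u m x - u0 x) * (u m x - u0 x)) \<le> (2 * R) * (2 * R)" for m
    proof (rule AE_I2)
      fix x assume "x \<in> space (Omega_measure L)"
      then have "\<bar>u m x - u0 x\<bar> \<le> 2 * R"
        using bound[of x m] bound0[of x] by force
      then show "norm ((u m x - u0 x) * (u m x - u0 x)) \<le> (2 * R) * (2 * R)"
        unfolding real_norm_def abs_mult by (intro mult_mono) auto
    qed
  qed auto
  then have "(\<lambda>m. sqrt (L2_inner L (\<lambda>x. u m x - u0 x) (\<lambda>x. u m x - u0 x))) \<longlonglongrightarrow> sqrt 0"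
    unfolding L2_inner_def by (intro tendsto_real_sqrt) simp
  then show ?thesis
    by (simp add: L2_norm_def)
qed

lemma L2_strong_imp_weak:
  assumes "\<And>m. u m \<in> L2 L" "u0 \<in> L2 L" "(\<lambda>m. L2_norm L (\<lambda>x. u m x - u0 x)) \<longlonglongrightarrow> 0" "v \<in> L2 L"
  shows "(\<lambda>m. L2_inner L (u m) v) \<longlonglongrightarrow> L2_inner L u0 v"
  using L2_inner_weak_strong[where h = "\<lambda>_. v" and ?h0.0 = v and B = "L2_norm L v", OF _ _ _ _ assms(1-3)] 
    assms(4) by (simp add: L2_inner_commute)

lemma L2_norm_strong_tendsto:
  assumes "\<And>m. u m \<in> L2 L" "u0 \<in> L2 L" "(\<lambda>m. L2_norm L (\<lambda>x. u m x - u0 x)) \<longlonglongrightarrow> 0"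
  shows "(\<lambda>m. L2_norm L (u m)) \<longlonglongrightarrow> L2_norm L u0"
proof -
  have "(\<lambda>m. L2_norm L (u m) - L2_norm L u0) \<longlonglongrightarrow> 0"
  proof (rule Lim_null_comparison[OF always_eventually assms(3)], rule allI)
    fix m
    have "L2_norm L (u m) \<le> L2_norm L (\<lambda>x. u m x - u0 x) + L2_norm L u0"
      using L2_norm_triangle[OF L2_diff[OF assms(1)[of m] assms(2)] assms(2)] by simp
    moreover have "L2_norm L u0 \<le> L2_norm L (u m) + L2_norm L (\<lambda>x. u m x - u0 x)"
      using L2_norm_triangle_diff[OF assms(1)[of m] L2_diff[OF assms(1)[of m] assms(2)]] by simp
    ultimately show "norm (L2_norm L (u m) - L2_norm L u0) \<le> L2_norm L (\<lambda>x. u m x - u0 x)"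
      by simp
  qed
  then show ?thesis by (rule LIM_zero_cancel)
qed

lemma filterlim_subsequence_principle:
  assumes "\<And>k :: nat \<Rightarrow> nat. strict_mono k \<Longrightarrow> \<exists>l :: nat \<Rightarrow> nat. strict_mono l \<and> filterlim (\<lambda>m. X (k (l m))) F sequentially"
  shows "filterlim X F sequentially"
  unfolding filterlim_iff
proof (intro allI impI)
  fix P assume P: "eventually P F"
  show "\<forall>\<^sub>F m in sequentially. P (X m)"
  proof (rule ccontr)
    assume "\<not> ?thesis"
    then have "infinite {m. \<not> P (X m)}"
      unfolding infinite_nat_iff_unbounded_le eventually_sequentially by auto
    then obtain k :: "nat \<Rightarrow> nat" where k: "strict_mono k" "\<And>m. \<not> P (X (k m))"
      using infinite_enumerate by blast
    obtain l :: "nat \<Rightarrow> nat" where "filterlim (\<lambda>m. X (k (l m))) F sequentially"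
      using assms[OF k(1)] by blast
    then have "\<forall>\<^sub>F m in sequentially. P (X (k (l m)))"
      using P by (simp add: filterlim_iff)
    then show False
      using k(2) by simp
  qed
qed

context nonlinear_data
begin

lemma f_compose_tendsto:
  assumes \<epsilon>s: "\<And>m. \<epsilon>s m \<in> {0..1}" "\<epsilon>s \<longlonglongrightarrow> \<epsilon>" "\<epsilon> \<in> {0..1}" 
    and p: "\<And>m. continuous_on {-L..L} (p m)" "continuous_on {-L..L} p0"
    and R: "\<And>m x. x \<in> {-L..L} \<Longrightarrow> \<bar>p m x\<bar> \<le> R" 
    and lim: "\<And>x. x \<in> {-L..L} \<Longrightarrow> (\<lambda>m. p m x) \<longlonglongrightarrow> p0 x"
  shows "(\<lambda>x. f (\<epsilon>s m) (p m x)) \<in> L2 L" "(\<lambda>x. f \<epsilon> (p0 x)) \<in> L2 L"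
    and "(\<lambda>m. L2_norm L (\<lambda>x. f (\<epsilon>s m) (p m x) - f \<epsilon> (p0 x))) \<longlonglongrightarrow> 0"
proof -
  show fL2: "(\<lambda>x. f (\<epsilon>s m) (p m x)) \<in> L2 L" "(\<lambda>x. f \<epsilon> (p0 x)) \<in> L2 L" for m
    by (rule L2_continuous[OF continuous_on_compose2[OF f_continuous[of _ UNIV]]], rule \<epsilon>s, rule p, simp)+
  obtain C where C: "0 < C" "\<And>\<epsilon> r. \<epsilon> \<in> {0..1} \<Longrightarrow> f \<epsilon> r \<le> C * (\<bar>r\<bar> + r\<^sup>2)"
    using f_growth by blast
  have "\<bar>f (\<epsilon>s m) (p m x)\<bar> \<le> C * (R + R\<^sup>2)" if "x \<in> {-L..L}" for m x
  proof -
    have "\<bar>p m x\<bar> + (p m x)\<^sup>2 \<le> R + R\<^sup>2"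
      using R[OF that, of m] power_mono[of "\<bar>p m x\<bar>" R 2] by simp
    then have "C * (\<bar>p m x\<bar> + (p m x)\<^sup>2) \<le> C * (R + R\<^sup>2)"
      using C(1) by simp
    then show ?thesis
      using C(2)[OF \<epsilon>s(1), of m "p m x"] f_nonneg[OF \<epsilon>s(1), of m "p m x"] by simp
  qed
  then show "(\<lambda>m. L2_norm L (\<lambda>x. f (\<epsilon>s m) (p m x) - f \<epsilon> (p0 x))) \<longlonglongrightarrow> 0"
    by (rule L2_norm_tendsto_bounded[OF L fL2 _ f_tendsto[OF \<epsilon>s lim]])
qed

lemma Khat_Mosco:
  assumes "\<And>m. \<delta>s m \<in> {0..1}" "\<delta>s \<longlonglongrightarrow> \<delta>" "\<delta> \<in> {0..1}" "r \<longlonglongrightarrow> r0"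
  shows "Khat_ext Khat \<delta> r0 \<le> liminf (\<lambda>m. Khat_ext Khat (\<delta>s m) (r m))"
proof -
  have "mosco_converges (\<lambda>m. Khat_ext Khat (\<delta>s m)) (Khat_ext Khat \<delta>)"
    using K_ass assms(1-3) unfolding K_assumption_def mosco_continuous_on_def by blast
  moreover have "weakly_converges_in UNIV inner r r0"
    using assms(4) by (auto simp: weakly_converges_in_def intro: tendsto_intros)
  ultimately show ?thesis
    by (simp add: mosco_converges_def)
qed

lemma e2ennreal_mono_continuous: "continuous_on UNIV e2ennreal" "mono e2ennreal"
  by (auto simp: continuous_on_e2ennreal mono_def e2ennreal_mono)

text \<open>Fatou's lemma turns the pointwise Mosco inequality into one for the integrals.\<close>

lemma Khat_integral_liminf:
  assumes \<delta>s: "\<And>m. \<delta>s m \<in> {0<..1}" "\<delta>s \<longlonglongrightarrow> \<delta>" "\<delta> \<in> {0..1}" 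
    and V: "\<And>m. continuous_on {-L..L} (V m)" "\<And>x. x \<in> {-L..L} \<Longrightarrow> (\<lambda>m. V m x) \<longlonglongrightarrow> V0 x"
    and bound: "\<And>m. (\<integral>x. Khat (\<delta>s m) (V m x) \<partial>Omega_measure L) \<le> X m" "X \<longlonglongrightarrow> X0"
  shows "Khat_integral L Khat \<delta> V0 \<le> ereal X0"
proof -
  have \<delta>s': "\<delta>s m \<in> {0..1}" for m
    using \<delta>s(1)[of m] by auto
  have "(\<integral>\<^sup>+x. e2ennreal (Khat_ext Khat \<delta> (V0 x)) \<partial>Omega_measure L) \<le> 
      (\<integral>\<^sup>+x. liminf (\<lambda>m. ennreal (Khat (\<delta>s m) (V m x))) \<partial>Omega_measure L)"
  proof (rule nn_integral_mono)
    fix x assume "x \<in> space (Omega_measure L)"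
    then have "Khat_ext Khat \<delta> (V0 x) \<le> liminf (\<lambda>m. Khat_ext Khat (\<delta>s m) (V m x))"
      by (intro Khat_Mosco \<delta>s' \<delta>s V) auto
    then have "e2ennreal (Khat_ext Khat \<delta> (V0 x)) \<le> e2ennreal (liminf (\<lambda>m. Khat_ext Khat (\<delta>s m) (V m x)))"
      by (rule e2ennreal_mono)
    also have "\<dots> = liminf (\<lambda>m. e2ennreal (Khat_ext Khat (\<delta>s m) (V m x)))"
      by (subst Liminf_compose_continuous_mono[OF e2ennreal_mono_continuous]) simp_all
    also have "\<dots> = liminf (\<lambda>m. ennreal (Khat (\<delta>s m) (V m x)))"
    proof (intro arg_cong[where f = liminf] ext)
      show "e2ennreal (Khat_ext Khat (\<delta>s m) (V m x)) = ennreal (Khat (\<delta>s m) (V m x))" for m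
        using \<delta>s(1)[of m] by (simp add: Khat_ext_def e2ennreal_ereal)
    qed
    finally show "e2ennreal (Khat_ext Khat \<delta> (V0 x)) \<le> liminf (\<lambda>m. ennreal (Khat (\<delta>s m) (V m x)))" .
  qed
  also have "\<dots> \<le> liminf (\<lambda>m. \<integral>\<^sup>+x. ennreal (Khat (\<delta>s m) (V m x)) \<partial>Omega_measure L)"
  proof (rule nn_integral_liminf)
    show "(\<lambda>x. ennreal (Khat (\<delta>s m) (V m x))) \<in> borel_measurable (Omega_measure L)" for m
      using borel_measurable_integrable[OF Khat_integrable[OF \<delta>s(1) V(1)]] by measurable
  qed
  also have "(\<lambda>m. \<integral>\<^sup>+x. ennreal (Khat (\<delta>s m) (V m x)) \<partial>Omega_measure L) = 
      (\<lambda>m. ennreal (\<integral>x. Khat (\<delta>s m) (V m x) \<partial>Omega_measure L))"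
    using Khat_integrable[OF \<delta>s(1) V(1)] Khat_nonneg[OF \<delta>s(1)] 
    by (intro ext nn_integral_eq_integral) auto
  also have "liminf (\<lambda>m. ennreal (\<integral>x. Khat (\<delta>s m) (V m x) \<partial>Omega_measure L)) \<le> liminf (\<lambda>m. ennreal (X m))"
    by (intro Liminf_mono always_eventually allI ennreal_leI bound)
  also have "\<dots> = ennreal X0"
    using bound(2) by (intro lim_imp_Liminf tendsto_ennrealI) auto
  finally have "Khat_integral L Khat \<delta> V0 \<le> enn2ereal (ennreal X0)"
    unfolding Khat_integral_def by (simp add: less_eq_ennreal.rep_eq)
  moreover have "0 \<le> (\<integral>x. Khat (\<delta>s m) (V m x) \<partial>Omega_measure L)" for m
    by (intro Bochner_Integration.integral_nonneg Khat_nonneg \<delta>s)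
  then have "0 \<le> X m" for m
    using bound(1) order_trans by blast
  then have "0 \<le> X0"
    using bound(2) by (intro LIMSEQ_le_const) auto
  ultimately show ?thesis
    by (simp add: enn2ereal_ennreal)
qed

text \<open>The constant sequence is a recovery sequence: for \<open>\<delta> = 0\<close> a function with values in \<open>[-1, 1]\<close> has no
  penalty at all, and for \<open>\<delta> > 0\<close> the penalties converge uniformly on bounded sets.\<close>

lemma Khat_integral_limsup:
  assumes \<delta>s: "\<And>m. \<delta>s m \<in> {0<..1}" "\<delta>s \<longlonglongrightarrow> \<delta>" "\<delta> \<in> {0..1}" 
    and V: "continuous_on {-L..L} V" and k: "Khat_integral L Khat \<delta> V = ereal k" and e: "0 < e"
  shows "\<forall>\<^sub>F m in sequentially. (\<integral>x. Khat (\<delta>s m) (V x) \<partial>Omega_measure L) \<le> k + e"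
proof (cases "\<delta> = 0")
  case True
  have "(\<integral>\<^sup>+x. e2ennreal (Khat_ext Khat \<delta> (V x)) \<partial>Omega_measure L) \<noteq> \<infinity>"
    using k by (metis Khat_integral_def PInfty_neq_ereal(1) enn2ereal_top infinity_ennreal_def)
  moreover have "(\<lambda>x. e2ennreal (Khat_ext Khat \<delta> (V x))) = (\<lambda>x. if V x \<in> {-1..1} then 0 else top)"
    by (auto simp: Khat_ext_def True fun_eq_iff zero_ereal_def e2ennreal_ereal)
  moreover have "(\<lambda>x. if V x \<in> {-1..1} then 0 else top :: ennreal) \<in> borel_measurable (Omega_measure L)"
    using measurable_continuous_on_Omega[OF V] by measurable
  ultimately have "AE x in Omega_measure L. (if V x \<in> {-1..1} then 0 else top :: ennreal) \<noteq> \<infinity>"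
    by (intro nn_integral_noteq_infinite) auto
  then have "AE x in Omega_measure L. Khat (\<delta>s m) (V x) = 0" for m
    by eventually_elim (auto intro!: Khat_at_0[OF \<delta>s(1)] split: if_splits)
  then have "(\<integral>x. Khat (\<delta>s m) (V x) \<partial>Omega_measure L) = 0" for m
    by (rule integral_eq_zero_AE)
  moreover have "0 \<le> ereal k"
    unfolding k[symmetric] Khat_integral_def by (rule enn2ereal_nonneg)
  ultimately show ?thesis
    using e by simp
next
  case False
  with \<delta>s(3) have \<delta>: "\<delta> \<in> {0<..1}" by auto
  obtain R where R: "\<And>x. x \<in> {-L..L} \<Longrightarrow> \<bar>V x\<bar> \<le> R"
    by (rule continuous_on_Icc_bounded[OF V]) blast
  have "uniform_limit {-R..R} Khat (Khat \<delta>) (at \<delta> within {0<..1})"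
    using K_ass \<delta> unfolding K_assumption_def by (metis compact_Icc)
  then have "\<forall>\<^sub>F d in at \<delta> within {0<..1}. \<forall>r\<in>{-R..R}. dist (Khat d r) (Khat \<delta> r) < e / (2 * L)"
    by (rule uniform_limitD) (use e L in simp)
  then obtain \<eta> where \<eta>: "0 < \<eta>" "\<And>d r. d \<in> {0<..1} \<Longrightarrow> d \<noteq> \<delta> \<Longrightarrow> dist d \<delta> < \<eta> \<Longrightarrow> r \<in> {-R..R} \<Longrightarrow> 
      dist (Khat d r) (Khat \<delta> r) < e / (2 * L)"
    unfolding eventually_at by auto
  have "\<forall>\<^sub>F m in sequentially. dist (\<delta>s m) \<delta> < \<eta>"
    using \<delta>s(2) \<eta>(1) by (rule tendstoD)
  then show ?thesis
  proof eventually_elim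
    case (elim m)
    have close: "Khat (\<delta>s m) r \<le> Khat \<delta> r + e / (2 * L)" if "r \<in> {-R..R}" for r
      using \<eta>(2)[OF \<delta>s(1) _ elim that] e L
      by (cases "\<delta>s m = \<delta>") (auto simp: dist_real_def abs_less_iff)
    have "(\<integral>x. Khat (\<delta>s m) (V x) \<partial>Omega_measure L) \<le> (\<integral>x. Khat \<delta> (V x) + e / (2 * L) \<partial>Omega_measure L)"
    proof (rule integral_mono)
      show "integrable (Omega_measure L) (\<lambda>x. Khat (\<delta>s m) (V x))"
        by (rule Khat_integrable[OF \<delta>s(1) V])
      show "integrable (Omega_measure L) (\<lambda>x. Khat \<delta> (V x) + e / (2 * L))"
        by (intro Bochner_Integration.integrable_add Khat_integrable[OF \<delta> V]) simp
      fix x assume "x \<in> space (Omega_measure L)"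
      then have "\<bar>V x\<bar> \<le> R"
        using R[of x] by simp
      then show "Khat (\<delta>s m) (V x) \<le> Khat \<delta> (V x) + e / (2 * L)"
        by (intro close) auto
    qed
    also have "\<dots> = (\<integral>x. Khat \<delta> (V x) \<partial>Omega_measure L) + (\<integral>x. e / (2 * L) \<partial>Omega_measure L)"
      by (intro Bochner_Integration.integral_add Khat_integrable[OF \<delta> V]) simp
    also have "(\<integral>x. e / (2 * L) \<partial>Omega_measure L) = e"
      using L by (simp add: measure_restrict_space)
    also have "(\<integral>x. Khat \<delta> (V x) \<partial>Omega_measure L) = k"
      using k Khat_integral_eq[OF \<delta> V] by simp
    finally show ?case .
  qed
qed

text \<open>Adding the two inequalities, in which each function is tested with the other, cancels the energies
  and leaves the monotone part: \<open>r \<mapsto> \<kappa> r + g r\<close> is strictly increasing because \<open>\<kappa> > Cg\<close>.\<close>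

lemma step_solution_unique:
  assumes \<kappa>: "Cg < \<kappa>" and V: "has_L2_deriv L V F" and W: "has_L2_deriv L W G" and h: "h \<in> L2 L"
    and "L2_inner L (\<lambda>x. \<kappa> * V x + g (V x) - h x) (\<lambda>x. V x - W x) + a - b \<le> 0"
    and "L2_inner L (\<lambda>x. \<kappa> * W x + g (W x) - h x) (\<lambda>x. W x - V x) + b - a \<le> 0"
  shows "AE x in Omega_measure L. V x = W x"
proof -
  let ?d = "\<lambda>x. V x - W x"
  note res = residual_L2[OF V h, of \<kappa>] residual_L2[OF W h, of \<kappa>]
  have d: "?d \<in> L2 L"
    by (intro L2_diff has_L2_deriv_in_L2[OF V] has_L2_deriv_in_L2[OF W])
  have "L2_inner L (\<lambda>x. \<kappa> * W x + g (W x) - h x) (\<lambda>x. W x - V x) = 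
      - L2_inner L (\<lambda>x. \<kappa> * W x + g (W x) - h x) ?d"
    using L2_inner_cmult_right[of L "\<lambda>x. \<kappa> * W x + g (W x) - h x" "-1" ?d] by simp
  then have "L2_inner L (\<lambda>x. (\<kappa> * V x + g (V x) - h x) - (\<kappa> * W x + g (W x) - h x)) ?d \<le> 0"
    using assms(5,6) L2_inner_diff_left[OF res d] by linarith
  moreover have "L2_inner L (\<lambda>x. (\<kappa> - Cg) * ?d x) ?d \<le> 
      L2_inner L (\<lambda>x. (\<kappa> * V x + g (V x) - h x) - (\<kappa> * W x + g (W x) - h x)) ?d"
    unfolding L2_inner_def
  proof (rule integral_mono)
    show "integrable (Omega_measure L) (\<lambda>x. (\<kappa> - Cg) * ?d x * ?d x)"
      by (intro integrable_mult_L2 L2_cmult d)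
    show "integrable (Omega_measure L) (\<lambda>x. ((\<kappa> * V x + g (V x) - h x) - (\<kappa> * W x + g (W x) - h x)) * ?d x)"
      by (intro integrable_mult_L2 L2_diff res d)
    show "(\<kappa> - Cg) * ?d x * ?d x \<le> ((\<kappa> * V x + g (V x) - h x) - (\<kappa> * W x + g (W x) - h x)) * ?d x" for x
      using g_one_sided[of "V x" "W x"] by (simp add: algebra_simps power2_eq_square)
  qed
  ultimately have "(\<kappa> - Cg) * (L2_norm L ?d)\<^sup>2 \<le> 0"
    unfolding L2_norm_square L2_inner_cmult_left by linarith
  then have "L2_norm L ?d = 0"
    using \<kappa> by (simp add: mult_le_0_iff)
  from L2_norm_eq_0_AE[OF d this] show ?thesis
    by simp
qed

text \<open>The limit of the solutions satisfies the limiting inequality tested with the given solution, and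
  this is all that uniqueness requires.\<close>

lemma step_limit:
  assumes \<kappa>: "Cg < \<kappa>" and \<epsilon>: "\<epsilon> \<in> {0..1}" "\<And>m. \<epsilon>s m \<in> {0<..1}" "\<epsilon>s \<longlonglongrightarrow> \<epsilon>" 
    and \<delta>: "\<delta> \<in> {0..1}" "\<And>m. \<delta>s m \<in> {0<..1}" "\<delta>s \<longlonglongrightarrow> \<delta>"
    and h: "\<And>m. hs m \<in> L2 L" "h \<in> L2 L" "\<And>v. v \<in> L2 L \<Longrightarrow> (\<lambda>m. L2_inner L (hs m) v) \<longlonglongrightarrow> L2_inner L h v"
    and sol: "step_solution \<kappa> \<epsilon> \<delta> h w" "\<And>m. step_solution \<kappa> (\<epsilon>s m) (\<delta>s m) (hs m) (ws m)"
    and W: "\<And>m. has_L2_deriv L (W m) (P m)" "\<And>m. AE x in Omega_measure L. ws m x = W m x"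
    and W0: "has_L2_deriv L W0 P0"
    and P: "\<And>m. continuous_on {-L..L} (P m)" "continuous_on {-L..L} P0"
    and bound: "\<And>m x. x \<in> {-L..L} \<Longrightarrow> \<bar>W m x\<bar> \<le> R" "\<And>m x. x \<in> {-L..L} \<Longrightarrow> \<bar>P m x\<bar> \<le> R"
    and lim: "\<And>x. x \<in> {-L..L} \<Longrightarrow> (\<lambda>m. W m x) \<longlonglongrightarrow> W0 x" 
      "\<And>x. x \<in> {-L..L} \<Longrightarrow> (\<lambda>m. P m x) \<longlonglongrightarrow> P0 x"
  shows "AE x in Omega_measure L. w x = W0 x"
proof -
  have \<epsilon>': "\<epsilon>s m \<in> {0..1}" for m
    using \<epsilon>(2)[of m] by auto
  have wdom: "w \<in> Psi_dom L \<nu> f Khat \<epsilon> \<delta>"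
    using sol(1) by (simp add: step_solution_def)
  obtain V where V: "has_L2_deriv L V (weak_deriv L w)" "AE x in Omega_measure L. w x = V x"
    using H1_obtain_rep[OF L Psi_dom_H1[OF wdom]] .
  define F where "F = weak_deriv L w"
  note V = V[folded F_def]
  have L2s: "W m \<in> L2 L" "P m \<in> L2 L" "W0 \<in> L2 L" "P0 \<in> L2 L" "V \<in> L2 L" "F \<in> L2 L" for m
    using W(1) W0 V(1) by (auto dest: has_L2_deriv_L2 has_L2_deriv_in_L2)
  have conts: "continuous_on {-L..L} (W m)" "continuous_on {-L..L} W0" "continuous_on {-L..L} V" for m
    using W(1) W0 V(1) by (auto dest: has_L2_deriv_continuous)
  have gL2: "(\<lambda>x. g (Z x)) \<in> L2 L" if "continuous_on {-L..L} Z" for Z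
    by (intro L2_continuous continuous_on_compose2[OF g_continuous[of UNIV] that]) auto

  define a where "a m = (\<lambda>x. \<kappa> * W m x + g (W m x) - hs m x)" for m
  define a0 where "a0 = (\<lambda>x. \<kappa> * W0 x + g (W0 x) - h x)"
  have aL2: "a m \<in> L2 L" for m
    unfolding a_def using W(1) h(1) by (rule residual_L2)
  have a0L2: "a0 \<in> L2 L"
    unfolding a0_def using W0 h(2) by (rule residual_L2)
  have W_lim: "(\<lambda>m. L2_norm L (\<lambda>x. W m x - W0 x)) \<longlonglongrightarrow> 0"
    by (rule L2_norm_tendsto_bounded[OF L L2s(1,3) bound(1) lim(1)])
  have P_lim: "(\<lambda>m. L2_norm L (\<lambda>x. P m x - P0 x)) \<longlonglongrightarrow> 0"
    by (rule L2_norm_tendsto_bounded[OF L L2s(2,4) bound(2) lim(2)])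
  have g_lim: "(\<lambda>m. L2_norm L (\<lambda>x. g (W m x) - g (W0 x))) \<longlonglongrightarrow> 0"
  proof -
    obtain Gm where Gm: "\<And>r. r \<in> {-R..R} \<Longrightarrow> \<bar>g r\<bar> \<le> Gm"
      by (rule continuous_on_Icc_bounded[OF g_continuous]) blast
    show ?thesis
    proof (rule L2_norm_tendsto_bounded[OF L gL2[OF conts(1)] gL2[OF conts(2)]])
      show "\<bar>g (W m x)\<bar> \<le> Gm" if "x \<in> {-L..L}" for m x
        using bound(1)[OF that, of m] by (intro Gm) auto
      show "(\<lambda>m. g (W m x)) \<longlonglongrightarrow> g (W0 x)" if "x \<in> {-L..L}" for x
        by (rule continuous_on_tendsto_compose[OF g_continuous[of UNIV] lim(1)[OF that]]) simp_all
    qed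
  qed
  have a_weak: "(\<lambda>m. L2_inner L (a m) v) \<longlonglongrightarrow> L2_inner L a0 v" if v: "v \<in> L2 L" for v
  proof -
    have "(\<lambda>m. \<kappa> * L2_inner L (W m) v + L2_inner L (\<lambda>x. g (W m x)) v - L2_inner L (hs m) v) \<longlonglongrightarrow> 
        \<kappa> * L2_inner L W0 v + L2_inner L (\<lambda>x. g (W0 x)) v - L2_inner L h v"
      by (intro tendsto_intros L2_strong_imp_weak[OF L2s(1,3) W_lim v] h(3) v
          L2_strong_imp_weak[OF gL2[OF conts(1)] gL2[OF conts(2)] g_lim v])
    then show ?thesis
      unfolding a_def a0_def
      by (subst (1 2) L2_inner_diff_left, (intro L2_add L2_cmult L2s gL2 conts h v)+)
        (subst (1 2) L2_inner_add_left, (intro L2_cmult L2s gL2 conts v)+, simp add: L2_inner_cmult_left)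
  qed
  obtain B where B: "\<And>m. L2_norm L (a m) \<le> B"
    using L2_weakly_bounded_imp_bounded[OF L aL2] a_weak by (meson convergentI convergent_imp_Bseq)
  have pair_lim: "(\<lambda>m. L2_inner L (a m) (\<lambda>x. W m x - V x)) \<longlonglongrightarrow> L2_inner L a0 (\<lambda>x. W0 x - V x)"
  proof (intro L2_inner_weak_strong[OF aL2 a0L2 a_weak B] L2_diff L2s)
    have "(\<lambda>x. W m x - V x - (W0 x - V x)) = (\<lambda>x. W m x - W0 x)" for m
      by auto
    with W_lim show "(\<lambda>m. L2_norm L (\<lambda>x. W m x - V x - (W0 x - V x))) \<longlonglongrightarrow> 0"
      by simp
  qed

  have P_cont: "continuous_on {-L..L} (P m)" "continuous_on {-L..L} P0" for m
    using P by simp_all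
  note f_lims = f_compose_tendsto[OF \<epsilon>' \<epsilon>(3,1) P_cont bound(2) lim(2)]
  have f_lim: "(\<lambda>m. \<integral>x. f (\<epsilon>s m) (P m x) \<partial>Omega_measure L) \<longlonglongrightarrow> (\<integral>x. f \<epsilon> (P0 x) \<partial>Omega_measure L)"
    using L2_strong_imp_weak[OF f_lims L2_const[of 1]] by (simp add: L2_inner_def)
  \<comment> \<open>The inequality tested with \<open>V\<close> bounds the penalty of \<open>W m\<close> by that of \<open>V\<close> plus the terms collected in \<open>X\<close>.\<close>
  define X where "X m = (\<integral>x. f (\<epsilon>s m) (F x) \<partial>Omega_measure L) + \<nu>\<^sup>2 / 2 * (L2_norm L F)\<^sup>2 - 
    L2_inner L (a m) (\<lambda>x. W m x - V x) - (\<integral>x. f (\<epsilon>s m) (P m x) \<partial>Omega_measure L) - 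
    \<nu>\<^sup>2 / 2 * (L2_norm L (P m))\<^sup>2" for m
  define X0 where "X0 = (\<integral>x. f \<epsilon> (F x) \<partial>Omega_measure L) + \<nu>\<^sup>2 / 2 * (L2_norm L F)\<^sup>2 - 
    L2_inner L a0 (\<lambda>x. W0 x - V x) - (\<integral>x. f \<epsilon> (P0 x) \<partial>Omega_measure L) - \<nu>\<^sup>2 / 2 * (L2_norm L P0)\<^sup>2"
  have X_lim: "X \<longlonglongrightarrow> X0"
    unfolding X_def X0_def
    by (intro tendsto_intros f_integral_tendsto[OF \<epsilon>' \<epsilon>(3,1) L2s(6)] pair_lim f_lim 
        L2_norm_strong_tendsto[OF L2s(2,4) P_lim])
  have X_ge: "(\<integral>x. Khat (\<delta>s m) (W m x) \<partial>Omega_measure L) \<le> (\<integral>x. Khat (\<delta>s m) (V x) \<partial>Omega_measure L) + X m" for m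
    using step_solution_inequality[OF \<epsilon>' \<delta>(2) sol(2) W(1)[of m] W(2)[of m] V(1)] 
    unfolding energy_at_def X_def a_def by linarith

  have "Psi L \<nu> f Khat \<epsilon> \<delta> w < \<infinity>"
    using wdom by (simp add: Psi_dom_def)
  then have "Khat_integral L Khat \<delta> V < \<infinity>"
    unfolding Psi_eq[OF V \<epsilon>(1)] by auto
  moreover have "0 \<le> Khat_integral L Khat \<delta> V"
    by (simp add: Khat_integral_def)
  ultimately obtain k where k: "Khat_integral L Khat \<delta> V = ereal k"
    by (cases "Khat_integral L Khat \<delta> V") auto
  have K_le: "Khat_integral L Khat \<delta> W0 \<le> ereal (k + X0)"
  proof (rule ereal_le_epsilon2)
    fix e :: real assume "0 < e"
    obtain N where N: "\<And>m. N \<le> m \<Longrightarrow> (\<integral>x. Khat (\<delta>s m) (V x) \<partial>Omega_measure L) \<le> k + e"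
      using Khat_integral_limsup[OF \<delta>(2,3,1) conts(3) k \<open>0 < e\<close>] by (auto simp: eventually_sequentially)
    have "Khat_integral L Khat \<delta> W0 \<le> ereal (k + e + X0)"
    proof (rule Khat_integral_liminf[where \<delta>s = "\<lambda>m. \<delta>s (m + N)" and V = "\<lambda>m. W (m + N)" and X = "\<lambda>m. k + e + X (m + N)"])
      show "(\<lambda>m. \<delta>s (m + N)) \<longlonglongrightarrow> \<delta>"
        using \<delta>(3) by (rule LIMSEQ_ignore_initial_segment)
      show "(\<lambda>m. W (m + N) x) \<longlonglongrightarrow> W0 x" if "x \<in> {-L..L}" for x
        using lim(1)[OF that] by (rule LIMSEQ_ignore_initial_segment)
      show "(\<integral>x. Khat (\<delta>s (m + N)) (W (m + N) x) \<partial>Omega_measure L) \<le> k + e + X (m + N)" for m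
        using X_ge[of "m + N"] N[of "m + N"] by simp
      show "(\<lambda>m. k + e + X (m + N)) \<longlonglongrightarrow> k + e + X0"
        by (intro tendsto_intros LIMSEQ_ignore_initial_segment X_lim)
    qed (use \<delta> conts in auto)
    then show "Khat_integral L Khat \<delta> W0 \<le> ereal (k + X0) + ereal e"
      by (simp add: ac_simps)
  qed
  have "0 \<le> Khat_integral L Khat \<delta> W0"
    by (simp add: Khat_integral_def)
  with K_le obtain k0 where k0: "Khat_integral L Khat \<delta> W0 = ereal k0" "k0 \<le> k + X0"
    by (cases "Khat_integral L Khat \<delta> W0") auto

  let ?EV = "(\<integral>x. f \<epsilon> (F x) \<partial>Omega_measure L) + \<nu>\<^sup>2 / 2 * (L2_norm L F)\<^sup>2 + k"
  let ?EW = "(\<integral>x. f \<epsilon> (P0 x) \<partial>Omega_measure L) + \<nu>\<^sup>2 / 2 * (L2_norm L P0)\<^sup>2 + k0"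
  have PsiW: "Psi L \<nu> f Khat \<epsilon> \<delta> W0 = ereal ?EW"
    using Psi_eq[OF W0 _ \<epsilon>(1), of W0 \<delta>] k0(1) by simp
  have PsiV: "Psi L \<nu> f Khat \<epsilon> \<delta> w = ereal ?EV"
    using Psi_eq[OF V \<epsilon>(1), of \<delta>] k by simp
  have "W0 \<in> Psi_dom L \<nu> f Khat \<epsilon> \<delta>"
    using PsiW L2s(3) by (simp add: Psi_dom_def)
  then have "ereal (L2_inner L (\<lambda>x. \<kappa> * w x + g (w x) - h x) (\<lambda>x. w x - W0 x)) + ereal ?EV - ereal ?EW \<le> 0"
    using sol(1) unfolding step_solution_def PsiW[symmetric] PsiV[symmetric] by blast
  moreover have "L2_inner L (\<lambda>x. \<kappa> * w x + g (w x) - h x) (\<lambda>x. w x - W0 x) = 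
      L2_inner L (\<lambda>x. \<kappa> * V x + g (V x) - h x) (\<lambda>x. V x - W0 x)"
    by (intro L2_inner_cong_AE) (use V(2) in \<open>auto elim!: eventually_mono\<close>)
  ultimately have 1: "L2_inner L (\<lambda>x. \<kappa> * V x + g (V x) - h x) (\<lambda>x. V x - W0 x) + ?EV - ?EW \<le> 0"
    by simp
  have 2: "L2_inner L a0 (\<lambda>x. W0 x - V x) + ?EW - ?EV \<le> 0"
    using k0(2) unfolding X0_def by linarith
  have "AE x in Omega_measure L. V x = W0 x"
    by (rule step_solution_unique[OF \<kappa> V(1) W0 h(2) 1 2[unfolded a0_def]])
  with V(2) show ?thesis
    by eventually_elim simp
qed

end

section \<open>Convergence of one time step\<close>

text \<open>By the Neumann condition the derivative of a solution vanishes at \<open>-L\<close>, so that solutions have the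
  form \<open>c + prim (prim q)\<close>.\<close>

lemma has_L2_deriv_double_prim:
  assumes "q \<in> L2 L"
  shows "has_L2_deriv L (\<lambda>x. c + prim L (prim L q) x) (prim L q)" "has_L2_deriv L (prim L q) q"
  using has_L2_deriv_prim[OF prim_L2[OF assms]] has_L2_deriv_prim[OF assms, of 0] by simp_all

lemma prim_tendsto:
  assumes "0 < L" "\<And>m. p m \<in> L2 L" "p0 \<in> L2 L" "(\<lambda>m. L2_norm L (\<lambda>x. p m x - p0 x)) \<longlonglongrightarrow> 0"
  shows "uniform_limit {-L..L} (\<lambda>m. prim L (p m)) (prim L p0) sequentially"
proof (rule uniform_limitI)
  fix e :: real assume "0 < e"
  have "(\<lambda>m. L2_norm L (\<lambda>x. p m x - p0 x) * sqrt (2 * L)) \<longlonglongrightarrow> 0"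
    using assms(4) by (rule tendsto_mult_left_zero)
  then have "\<forall>\<^sub>F m in sequentially. L2_norm L (\<lambda>x. p m x - p0 x) * sqrt (2 * L) < e"
    using \<open>0 < e\<close> by (rule order_tendstoD(2))
  then show "\<forall>\<^sub>F m in sequentially. \<forall>x\<in>{-L..L}. dist (prim L (p m) x) (prim L p0 x) < e"
  proof eventually_elim
    case (elim m)
    show ?case
    proof
      fix x assume "x \<in> {-L..L}"
      from prim_bound[OF L2_diff[OF assms(2)[of m] assms(3)] this] elim
      show "dist (prim L (p m) x) (prim L p0 x) < e"
        unfolding dist_real_def prim_diff[OF assms(2,3)] by linarith
    qed
  qed
qed

lemma double_prim_sup_bound:
  assumes "0 < L" "q \<in> L2 L" "L2_norm L q \<le> C" "\<bar>c\<bar> \<le> C" "x \<in> {-L..L}"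
  shows "\<bar>prim L q x\<bar> \<le> C * sqrt (2 * L)" "\<bar>c + prim L (prim L q) x\<bar> \<le> C + C * sqrt (2 * L) * sqrt (2 * L) * sqrt (2 * L)"
proof -
  have C: "0 \<le> C"
    using assms(4) by linarith
  have *: "\<bar>prim L q y\<bar> \<le> C * sqrt (2 * L)" if "y \<in> {-L..L}" for y
    by (rule order_trans[OF prim_bound[OF assms(2) that] mult_right_mono[OF assms(3)]]) (use assms(1) in simp)
  from this[OF assms(5)] show "\<bar>prim L q x\<bar> \<le> C * sqrt (2 * L)" .
  have "L2_norm L (prim L q) \<le> L2_norm L (\<lambda>x. C * sqrt (2 * L))"
  proof (rule L2_norm_mono[OF L2_measurable[OF prim_L2[OF assms(2)]] L2_const], rule AE_I2)
    fix y assume "y \<in> space (Omega_measure L)"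
    then show "\<bar>prim L q y\<bar> \<le> \<bar>C * sqrt (2 * L)\<bar>"
      using *[of y] by fastforce
  qed
  also have "\<dots> = C * sqrt (2 * L) * sqrt (2 * L)"
    using C assms(1) by (simp add: L2_norm_const abs_mult)
  finally have "L2_norm L (prim L q) * sqrt (2 * L) \<le> C * sqrt (2 * L) * sqrt (2 * L) * sqrt (2 * L)"
    using assms(1) by (intro mult_right_mono) auto
  with prim_bound[OF prim_L2[OF assms(2)] assms(5)] assms(4)
  show "\<bar>c + prim L (prim L q) x\<bar> \<le> C + C * sqrt (2 * L) * sqrt (2 * L) * sqrt (2 * L)"
    by linarith
qed

text \<open>Uniform convergence of first derivatives and bounded weak convergence of second derivatives,
  expressed by the representatives. All convergences of the theorem follow from it.\<close>

definition H2_limit :: "real \<Rightarrow> (nat \<Rightarrow> real \<Rightarrow> real) \<Rightarrow> (real \<Rightarrow> real) \<Rightarrow> bool" where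
  "H2_limit L z z0 \<longleftrightarrow> (\<exists>c q cs qs C. q \<in> L2 L \<and> (AE x in Omega_measure L. z0 x = c + prim L (prim L q) x) \<and>
    (\<forall>m. qs m \<in> L2 L \<and> (AE x in Omega_measure L. z m x = cs m + prim L (prim L (qs m)) x) \<and>
      L2_norm L (qs m) \<le> C \<and> \<bar>cs m\<bar> \<le> C) \<and>
    cs \<longlonglongrightarrow> c \<and> uniform_limit {-L..L} (\<lambda>m. prim L (qs m)) (prim L q) sequentially \<and>
    (\<forall>v\<in>L2 L. (\<lambda>m. L2_inner L (qs m) v) \<longlonglongrightarrow> L2_inner L q v))"

text \<open>Bounded second derivatives make the first derivatives equicontinuous, with modulus
  \<open>C * sqrt \<bar>x - y\<bar>\<close>.\<close>

lemma double_prim_compact: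
  fixes c :: "nat \<Rightarrow> real"
  assumes L: "0 < L" and q: "\<And>m. q m \<in> L2 L" "\<And>m. L2_norm L (q m) \<le> C" and c: "\<And>m. \<bar>c m\<bar> \<le> C"
  obtains k c0 p where "strict_mono (k :: nat \<Rightarrow> nat)" "(\<lambda>m. c (k m)) \<longlonglongrightarrow> c0" "continuous_on {-L..L} p"
    "uniform_limit {-L..L} (\<lambda>m. prim L (q (k m))) p sequentially"
proof -
  have C: "0 \<le> C"
    using c[of 0] by linarith
  obtain p k where p: "continuous_on {-L..L} p" and k: "strict_mono (k :: nat \<Rightarrow> nat)"
    and lim: "\<And>e. 0 < e \<Longrightarrow> \<exists>N. \<forall>n x. n \<ge> N \<and> x \<in> {-L..L} \<longrightarrow> norm (prim L (q (k n)) x - p x) < e"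
  proof (rule Arzela_Ascoli[of "{-L..L}" "\<lambda>n. prim L (q n)" "C * sqrt (2 * L)"])
    show "norm (prim L (q n) x) \<le> C * sqrt (2 * L)" if "x \<in> {-L..L}" for n x
      using double_prim_sup_bound(1)[OF L q c that] by simp
    fix x e :: real assume "x \<in> {-L..L}" and e: "0 < e"
    \<comment> \<open>The summand \<open>1\<close> keeps the denominator positive when \<open>C = 0\<close>.\<close>
    define d where "d = (e / (C + 1))\<^sup>2"
    have "norm (prim L (q n) x - prim L (q n) y) < e" if "norm (x - y) < d" for n y
    proof -
      have "sqrt \<bar>x - y\<bar> < sqrt d"
        using that by simp
      also have "sqrt d = e / (C + 1)"
        using e C by (simp add: d_def)
      finally have *: "sqrt \<bar>x - y\<bar> < e / (C + 1)" .
      have "\<bar>prim L (q n) x - prim L (q n) y\<bar> \<le> L2_norm L (q n) * sqrt \<bar>x - y\<bar>"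
        by (rule prim_Hoelder[OF q(1)])
      also have "\<dots> \<le> (C + 1) * sqrt \<bar>x - y\<bar>"
        using q(2)[of n] by (intro mult_right_mono) auto
      also have "\<dots> < (C + 1) * (e / (C + 1))"
        using * C by (intro mult_strict_left_mono) auto
      also have "\<dots> = e"
        using C by simp
      finally show ?thesis by simp
    qed
    moreover have "0 < d"
      using e C by (simp add: d_def)
    ultimately show "\<exists>d. 0 < d \<and> (\<forall>n y. y \<in> {-L..L} \<and> norm (x - y) < d \<longrightarrow> norm (prim L (q n) x - prim L (q n) y) < e)"
      by blast
  qed auto
  have "bounded (range (\<lambda>m. c (k m)))"
    using c by (auto simp: bounded_iff)
  then obtain c0 l where l: "strict_mono (l :: nat \<Rightarrow> nat)" "((\<lambda>m. c (k m)) \<circ> l) \<longlonglongrightarrow> c0"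
    using bounded_imp_convergent_subsequence by blast
  have "uniform_limit {-L..L} (\<lambda>m. prim L (q (k m))) p sequentially"
  proof (rule uniform_limitI)
    fix e :: real assume "0 < e"
    from lim[OF this] show "\<forall>\<^sub>F m in sequentially. \<forall>x\<in>{-L..L}. dist (prim L (q (k m)) x) (p x) < e"
      unfolding eventually_sequentially dist_norm by blast
  qed
  from filterlim_compose[OF this filterlim_subseq[OF l(1)]] l(2) strict_mono_compose[OF k l(1)] p
  show ?thesis
    using that[of "k \<circ> l" c0 p] by (simp add: o_def)
qed

context nonlinear_data
begin

text \<open>The uniform bound makes every subsequence compact, the limit passage identifies its limit with the
  given solution, and the pair \<open>(c, p)\<close> is determined by the solution. So the whole sequence converges.\<close>

lemma step_convergence:
  assumes \<kappa>: "1 + Cg \<le> \<kappa>" and \<epsilon>: "\<epsilon> \<in> {0..1}" "\<And>m. \<epsilon>s m \<in> {0<..1}" "\<epsilon>s \<longlonglongrightarrow> \<epsilon>" 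
    and \<delta>: "\<delta> \<in> {0..1}" "\<And>m. \<delta>s m \<in> {0<..1}" "\<delta>s \<longlonglongrightarrow> \<delta>"
    and h: "\<And>m. hs m \<in> L2 L" "h \<in> L2 L" "\<And>v. v \<in> L2 L \<Longrightarrow> (\<lambda>m. L2_inner L (hs m) v) \<longlonglongrightarrow> L2_inner L h v"
    and sol: "step_solution \<kappa> \<epsilon> \<delta> h w" "\<And>m. step_solution \<kappa> (\<epsilon>s m) (\<delta>s m) (hs m) (ws m)"
  shows "H2_limit L ws w"
proof -
  have \<kappa>': "Cg < \<kappa>"
    using \<kappa> by simp
  obtain B where B: "\<And>m. L2_norm L (hs m) \<le> B"
    using L2_weakly_bounded_imp_bounded[OF L h(1)] h(3) by (meson convergentI convergent_imp_Bseq)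
  obtain C where C: "\<forall>\<epsilon>\<in>{0<..1}. \<forall>\<delta>\<in>{0<..1}. \<forall>h\<in>L2 L. \<forall>w. L2_norm L h \<le> B \<longrightarrow> step_solution \<kappa> \<epsilon> \<delta> h w \<longrightarrow>
    (\<exists>c q. q \<in> L2 L \<and> L2_norm L q \<le> C \<and> \<bar>c\<bar> \<le> C \<and> 
      (AE x in Omega_measure L. w x = c + prim L (prim L q) x))"
    using step_solution_H2_bound[OF \<kappa>, of B] by blast
  have "\<exists>c q. q \<in> L2 L \<and> L2_norm L q \<le> C \<and> \<bar>c\<bar> \<le> C \<and> 
      (AE x in Omega_measure L. ws m x = c + prim L (prim L q) x)" for m
    using C[THEN bspec, OF \<epsilon>(2)[of m], THEN bspec, OF \<delta>(2)[of m], THEN bspec, OF h(1)[of m], THEN spec] 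
      B[of m] sol(2)[of m] by blast
  then obtain cs qs where qs: "\<And>m. qs m \<in> L2 L" "\<And>m. L2_norm L (qs m) \<le> C" and cs: "\<And>m. \<bar>cs m\<bar> \<le> C"
    and ws: "\<And>m. AE x in Omega_measure L. ws m x = cs m + prim L (prim L (qs m)) x"
    by metis
  have identify: "AE x in Omega_measure L. w x = c + prim L p x" 
    if k: "strict_mono k" and c: "(\<lambda>m. cs (k m)) \<longlonglongrightarrow> c" and p: "continuous_on {-L..L} p" 
      and lim: "uniform_limit {-L..L} (\<lambda>m. prim L (qs (k m))) p sequentially" for k :: "nat \<Rightarrow> nat" and c p
  proof -
    have pL2: "p \<in> L2 L"
      using p by (rule L2_continuous)
    define R where "R = max (C * sqrt (2 * L)) (C + C * sqrt (2 * L) * sqrt (2 * L) * sqrt (2 * L))"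
    have point: "(\<lambda>m. prim L (qs (k m)) x) \<longlonglongrightarrow> p x" if "x \<in> {-L..L}" for x
      using lim that by (rule tendsto_uniform_limitI)
    have "(\<lambda>m. L2_norm L (\<lambda>x. prim L (qs (k m)) x - p x)) \<longlonglongrightarrow> 0"
      by (rule L2_norm_tendsto_bounded[OF L prim_L2[OF qs(1)] pL2 double_prim_sup_bound(1)[OF L qs cs] point])
    note prims = prim_tendsto[OF L prim_L2[OF qs(1)] pL2 this]
    show ?thesis
    proof (rule step_limit[where \<epsilon>s = "\<lambda>m. \<epsilon>s (k m)" and \<delta>s = "\<lambda>m. \<delta>s (k m)" and hs = "\<lambda>m. hs (k m)" 
          and ws = "\<lambda>m. ws (k m)" and W = "\<lambda>m x. cs (k m) + prim L (prim L (qs (k m))) x" 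
          and P = "\<lambda>m. prim L (qs (k m))" and ?P0.0 = p and R = R, OF \<kappa>' \<epsilon>(1) \<epsilon>(2) _ \<delta>(1) \<delta>(2) _ h(1,2) _ sol(1) sol(2)])
      show "(\<lambda>m. \<epsilon>s (k m)) \<longlonglongrightarrow> \<epsilon>" "(\<lambda>m. \<delta>s (k m)) \<longlonglongrightarrow> \<delta>"
        using LIMSEQ_subseq_LIMSEQ[OF \<epsilon>(3) k] LIMSEQ_subseq_LIMSEQ[OF \<delta>(3) k] by (simp_all add: o_def)
      show "(\<lambda>m. L2_inner L (hs (k m)) v) \<longlonglongrightarrow> L2_inner L h v" if "v \<in> L2 L" for v
        using LIMSEQ_subseq_LIMSEQ[OF h(3)[OF that] k] by (simp add: o_def)
      show "has_L2_deriv L (\<lambda>x. cs (k m) + prim L (prim L (qs (k m))) x) (prim L (qs (k m)))" for m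
        by (rule has_L2_deriv_double_prim(1)[OF qs(1)])
      show "AE x in Omega_measure L. ws (k m) x = cs (k m) + prim L (prim L (qs (k m))) x" for m
        by (rule ws)
      show "has_L2_deriv L (\<lambda>x. c + prim L p x) p"
        by (rule has_L2_deriv_prim[OF pL2])
      show "continuous_on {-L..L} (prim L (qs (k m)))" "continuous_on {-L..L} p" for m
        by (rule prim_continuous[OF qs(1)], rule p)
      show "\<bar>cs (k m) + prim L (prim L (qs (k m))) x\<bar> \<le> R" if "x \<in> {-L..L}" for m x
        unfolding R_def using double_prim_sup_bound(2)[OF L qs cs that] by (rule max.coboundedI2)
      show "\<bar>prim L (qs (k m)) x\<bar> \<le> R" if "x \<in> {-L..L}" for m x
        unfolding R_def using double_prim_sup_bound(1)[OF L qs cs that] by (rule max.coboundedI1)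
      show "(\<lambda>m. cs (k m) + prim L (prim L (qs (k m))) x) \<longlonglongrightarrow> c + prim L p x" if "x \<in> {-L..L}" for x
        by (rule tendsto_add[OF c tendsto_uniform_limitI[OF prims that]])
      show "(\<lambda>m. prim L (qs (k m)) x) \<longlonglongrightarrow> p x" if "x \<in> {-L..L}" for x
        using that by (rule point)
    qed
  qed
  obtain k c p where k: "strict_mono (k :: nat \<Rightarrow> nat)" "(\<lambda>m. cs (k m)) \<longlonglongrightarrow> c" and p: "continuous_on {-L..L} p"
    "uniform_limit {-L..L} (\<lambda>m. prim L (qs (k m))) p sequentially"
    using double_prim_compact[OF L qs cs] .
  note wcp = identify[OF k p]
  have sub: "\<exists>l. strict_mono (l :: nat \<Rightarrow> nat) \<and> (\<lambda>m. cs (k' (l m))) \<longlonglongrightarrow> c \<and> 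
      uniform_limit {-L..L} (\<lambda>m. prim L (qs (k' (l m)))) p sequentially" if k': "strict_mono k'" for k' :: "nat \<Rightarrow> nat"
  proof -
    obtain l c' p' where l: "strict_mono (l :: nat \<Rightarrow> nat)" and c': "(\<lambda>m. cs (k' (l m))) \<longlonglongrightarrow> c'" 
      and p': "continuous_on {-L..L} p'" "uniform_limit {-L..L} (\<lambda>m. prim L (qs (k' (l m)))) p' sequentially"
      using double_prim_compact[OF L, of "\<lambda>m. qs (k' m)" C "\<lambda>m. cs (k' m)"] qs cs by blast
    have "AE x in Omega_measure L. w x = c' + prim L p' x"
      using strict_mono_compose[OF k' l] c' p' by (intro identify[of "k' \<circ> l"]) (simp_all add: o_def)
    with wcp have AE: "AE x in Omega_measure L. c' + prim L p' x = c + prim L p x"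
      by eventually_elim simp
    note d = has_L2_deriv_prim[OF L2_continuous[OF p'(1)], of c'] has_L2_deriv_prim[OF L2_continuous[OF p(1)], of c]
    have "c' + prim L p' (-L) = c + prim L p (-L)"
      by (rule AE_eq_imp_interval_eq[OF L d[THEN has_L2_deriv_continuous] AE]) (use L in simp)
    then have "c' = c"
      by (simp add: prim_eq_0_left)
    moreover have "p' x = p x" if "x \<in> {-L..L}" for x
      by (rule AE_eq_imp_interval_eq[OF L p'(1) p(1) has_L2_deriv_unique[OF L d AE] that])
    then have "uniform_limit {-L..L} (\<lambda>m. prim L (qs (k' (l m)))) p sequentially"
      using uniform_limit_cong'[of "{-L..L}" "\<lambda>m. prim L (qs (k' (l m)))" "\<lambda>m. prim L (qs (k' (l m)))" p' p] p'(2) 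
      by blast
    ultimately show ?thesis
      using l c' by blast
  qed
  have cs_lim: "cs \<longlonglongrightarrow> c"
    by (rule filterlim_subsequence_principle) (use sub in blast)
  have qs_lim: "uniform_limit {-L..L} (\<lambda>m. prim L (qs m)) p sequentially"
    by (rule filterlim_subsequence_principle) (use sub in blast)
  obtain q where q: "q \<in> L2 L" "\<And>x. x \<in> {-L..L} \<Longrightarrow> prim L q x = p x" 
    "\<And>v. v \<in> L2 L \<Longrightarrow> (\<lambda>m. L2_inner L (qs m) v) \<longlonglongrightarrow> L2_inner L q v"
    using L2_weak_limit_of_primitives[OF L qs qs_lim] by blast
  have "AE x in Omega_measure L. prim L q x = p x"
    using q(2) by (intro AE_I2) auto
  then have "prim L (prim L q) = prim L p"
    using prim_cong_AE by blast
  with wcp have "AE x in Omega_measure L. w x = c + prim L (prim L q) x"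
    by simp
  moreover have "uniform_limit {-L..L} (\<lambda>m. prim L (qs m)) (prim L q) sequentially"
    using uniform_limit_cong'[of "{-L..L}" "\<lambda>m. prim L (qs m)" "\<lambda>m. prim L (qs m)" p "prim L q"] qs_lim q(2)
    by metis
  ultimately show ?thesis
    unfolding H2_limit_def using q(1,3) qs cs ws cs_lim by blast
qed

end

section \<open>Convergence in all time steps\<close>

lemma double_prim_representation:
  assumes L: "0 < L" and q: "q \<in> L2 L" and z: "AE x in Omega_measure L. z x = c + prim L (prim L q) x"
  shows "AE x in Omega_measure L. weak_deriv L z x = prim L q x"
    and "AE x in Omega_measure L. weak_deriv L (weak_deriv L z) x = q x"
    and "z \<in> H2 L" and "z \<in> C1_closed L"
    and "\<And>x. x \<in> {-L..L} \<Longrightarrow> cont_rep L z x = c + prim L (prim L q) x"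
    and "\<And>x. x \<in> {-L..L} \<Longrightarrow> cont_deriv L z x = prim L q x"
proof -
  note d = has_L2_deriv_double_prim[OF q]
  show wd: "AE x in Omega_measure L. weak_deriv L z x = prim L q x"
    by (rule weak_deriv_AE_eq[OF L d(1) z])
  show "AE x in Omega_measure L. weak_deriv L (weak_deriv L z) x = q x"
    by (rule weak_deriv_AE_eq[OF L d(2) wd])
  show "z \<in> H2 L"
    using H1_I[OF L d(1) z] H1_I[OF L d(2) wd] by (simp add: H2_def)
  have D: "((\<lambda>x. c + prim L (prim L q) x) has_real_derivative prim L q x) (at x within {-L..L})" 
    if "x \<in> {-L..L}" for x
    using DERIV_add[OF DERIV_const prim_has_real_derivative[OF prim_continuous[OF q] that]] by simp
  show "z \<in> C1_closed L"
    unfolding C1_closed_def mem_Collect_eq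
    by (rule exI[of _ "\<lambda>x. c + prim L (prim L q) x"], rule exI[of _ "prim L q"])
      (intro conjI ballI z prim_continuous q D)
  show "cont_rep L z x = c + prim L (prim L q) x" if "x \<in> {-L..L}" for x
    by (rule cont_rep_eq[OF L has_L2_deriv_continuous[OF d(1)] z that])
  show "cont_deriv L z x = prim L q x" if "x \<in> {-L..L}" for x
    by (rule cont_deriv_eq[OF L z D that])
qed

lemma H2_L2:
  assumes "v \<in> H2 L"
  shows "v \<in> L2 L" "weak_deriv L v \<in> L2 L" "weak_deriv L (weak_deriv L v) \<in> L2 L"
proof -
  have v: "v \<in> H1 L" "weak_deriv L v \<in> H1 L"
    using assms by (simp_all add: H2_def)
  show "v \<in> L2 L"
    using v(1) by (rule H1_L2)
  show "weak_deriv L v \<in> L2 L" "weak_deriv L (weak_deriv L v) \<in> L2 L"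
    using v by (auto intro: H1_weak_deriv(1))
qed

lemma H2_limit_consequences:
  assumes L: "0 < L" and lim: "H2_limit L z z0"
  shows "(\<lambda>m. H1_inner L (z m - z0) (z m - z0)) \<longlonglongrightarrow> 0"
    and "converges_in_C1 L z z0"
    and "\<And>v. v \<in> H2 L \<Longrightarrow> (\<lambda>m. H2_inner L (z m) v) \<longlonglongrightarrow> H2_inner L z0 v"
    and "\<And>v. v \<in> L2 L \<Longrightarrow> (\<lambda>m. L2_inner L (z m) v) \<longlonglongrightarrow> L2_inner L z0 v"
    and "\<And>m. z m \<in> H2 L" and "z0 \<in> H2 L"
    and "\<exists>p p0 R. (\<forall>m. continuous_on {-L..L} (p m)) \<and> continuous_on {-L..L} p0 \<and> 
      (\<forall>m. AE x in Omega_measure L. weak_deriv L (z m) x = p m x) \<and> 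
      (AE x in Omega_measure L. weak_deriv L z0 x = p0 x) \<and>
      (\<forall>x\<in>{-L..L}. (\<forall>m. cont_deriv L (z m) x = p m x \<and> \<bar>p m x\<bar> \<le> R) \<and> cont_deriv L z0 x = p0 x \<and> 
        (\<lambda>m. p m x) \<longlonglongrightarrow> p0 x)"
proof -
  obtain c q cs qs C where q: "q \<in> L2 L" and z0: "AE x in Omega_measure L. z0 x = c + prim L (prim L q) x"
    and qs: "\<And>m. qs m \<in> L2 L" and z: "\<And>m. AE x in Omega_measure L. z m x = cs m + prim L (prim L (qs m)) x"
    and C: "\<And>m. L2_norm L (qs m) \<le> C" "\<And>m. \<bar>cs m\<bar> \<le> C" and cs: "cs \<longlonglongrightarrow> c" 
    and p: "uniform_limit {-L..L} (\<lambda>m. prim L (qs m)) (prim L q) sequentially"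
    and weak: "\<And>v. v \<in> L2 L \<Longrightarrow> (\<lambda>m. L2_inner L (qs m) v) \<longlonglongrightarrow> L2_inner L q v"
    using lim unfolding H2_limit_def by blast
  note rm = double_prim_representation[OF L qs z] and r0 = double_prim_representation[OF L q z0]
  show zH2: "z m \<in> H2 L" for m
    by (rule rm(3))
  show z0H2: "z0 \<in> H2 L"
    by (rule r0(3))
  have p_lim: "(\<lambda>m. L2_norm L (\<lambda>x. prim L (qs m) x - prim L q x)) \<longlonglongrightarrow> 0"
    by (rule L2_norm_tendsto_bounded[OF L prim_L2[OF qs] prim_L2[OF q] double_prim_sup_bound(1)[OF L qs C] 
          tendsto_uniform_limitI[OF p]])
  define W where "W m = (\<lambda>x. cs m + prim L (prim L (qs m)) x)" for m
  define W0 where "W0 = (\<lambda>x. c + prim L (prim L q) x)"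
  have W_unif: "uniform_limit {-L..L} W W0 sequentially"
    unfolding W_def W0_def
    by (intro uniform_limit_add prim_tendsto[OF L prim_L2[OF qs] prim_L2[OF q] p_lim])
      (use cs in \<open>simp add: uniform_limit_iff tendsto_iff eventually_mono\<close>)
  have WL2: "W m \<in> L2 L" "W0 \<in> L2 L" for m
    unfolding W_def W0_def by (intro L2_add L2_const prim_L2 qs q)+
  have W_bound: "\<bar>W m x\<bar> \<le> C + C * sqrt (2 * L) * sqrt (2 * L) * sqrt (2 * L)" if "x \<in> {-L..L}" for m x
    unfolding W_def by (rule double_prim_sup_bound(2)[OF L qs C that])
  have W_lim: "(\<lambda>m. L2_norm L (\<lambda>x. W m x - W0 x)) \<longlonglongrightarrow> 0"
    by (rule L2_norm_tendsto_bounded[OF L WL2 W_bound tendsto_uniform_limitI[OF W_unif]])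
  show "(\<lambda>m. H1_inner L (z m - z0) (z m - z0)) \<longlonglongrightarrow> 0"
  proof -
    have "H1_inner L (z m - z0) (z m - z0) = (L2_norm L (\<lambda>x. W m x - W0 x))\<^sup>2 + 
        (L2_norm L (\<lambda>x. prim L (qs m) x - prim L q x))\<^sup>2" for m
    proof -
      have AE: "AE x in Omega_measure L. (z m - z0) x = W m x - W0 x"
        using z[of m] z0 by eventually_elim (simp add: W_def W0_def)
      have wd: "AE x in Omega_measure L. weak_deriv L (z m - z0) x = prim L (qs m) x - prim L q x"
        by (rule weak_deriv_AE_eq[OF L has_L2_deriv_diff[OF has_L2_deriv_double_prim(1)[OF qs] 
                has_L2_deriv_double_prim(1)[OF q]] AE[unfolded W_def W0_def]])
      show ?thesis
        unfolding H1_inner_def L2_norm_square L2_inner_cong_AE[OF AE AE] L2_inner_cong_AE[OF wd wd] ..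
    qed
    moreover have "(\<lambda>m. (L2_norm L (\<lambda>x. W m x - W0 x))\<^sup>2 + 
        (L2_norm L (\<lambda>x. prim L (qs m) x - prim L q x))\<^sup>2) \<longlonglongrightarrow> 0\<^sup>2 + 0\<^sup>2"
      by (intro tendsto_intros W_lim p_lim)
    ultimately show ?thesis by simp
  qed
  show "converges_in_C1 L z z0"
    unfolding converges_in_C1_def
  proof (intro conjI allI rm(4) r0(4))
    show "uniform_limit {-L..L} (\<lambda>m. cont_rep L (z m)) (cont_rep L z0) sequentially"
      by (rule uniform_limit_cong'[THEN iffD2, OF rm(5) r0(5) W_unif[unfolded W_def W0_def]])
    show "uniform_limit {-L..L} (\<lambda>m. cont_deriv L (z m)) (cont_deriv L z0) sequentially"
      by (rule uniform_limit_cong'[THEN iffD2, OF rm(6) r0(6) p])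
  qed
  show L2w: "(\<lambda>m. L2_inner L (z m) v) \<longlonglongrightarrow> L2_inner L z0 v" if v: "v \<in> L2 L" for v
  proof -
    have "L2_inner L (z m) v = L2_inner L (W m) v" "L2_inner L z0 v = L2_inner L W0 v" for m
      using z[of m] z0 by (intro L2_inner_cong_AE; simp add: W_def W0_def)+
    then show ?thesis
      using L2_strong_imp_weak[OF WL2 W_lim v] by simp
  qed
  show "(\<lambda>m. H2_inner L (z m) v) \<longlonglongrightarrow> H2_inner L z0 v" if v: "v \<in> H2 L" for v
  proof -
    have 1: "L2_inner L (weak_deriv L (z m)) (weak_deriv L v) = L2_inner L (prim L (qs m)) (weak_deriv L v)"
      "L2_inner L (weak_deriv L z0) (weak_deriv L v) = L2_inner L (prim L q) (weak_deriv L v)" for m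
      using rm(1)[of m] r0(1) by (intro L2_inner_cong_AE; simp)+
    have 2: "L2_inner L (weak_deriv L (weak_deriv L (z m))) (weak_deriv L (weak_deriv L v)) = 
        L2_inner L (qs m) (weak_deriv L (weak_deriv L v))"
      "L2_inner L (weak_deriv L (weak_deriv L z0)) (weak_deriv L (weak_deriv L v)) = 
        L2_inner L q (weak_deriv L (weak_deriv L v))" for m
      using rm(2)[of m] r0(2) by (intro L2_inner_cong_AE; simp)+
    show ?thesis
      unfolding H2_inner_def H1_inner_def 1 2
      by (intro tendsto_add L2w weak H2_L2[OF v] L2_strong_imp_weak[OF prim_L2[OF qs] prim_L2[OF q] p_lim])
  qed
  show "\<exists>p p0 R. (\<forall>m. continuous_on {-L..L} (p m)) \<and> continuous_on {-L..L} p0 \<and> 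
      (\<forall>m. AE x in Omega_measure L. weak_deriv L (z m) x = p m x) \<and> 
      (AE x in Omega_measure L. weak_deriv L z0 x = p0 x) \<and>
      (\<forall>x\<in>{-L..L}. (\<forall>m. cont_deriv L (z m) x = p m x \<and> \<bar>p m x\<bar> \<le> R) \<and> cont_deriv L z0 x = p0 x \<and> 
        (\<lambda>m. p m x) \<longlonglongrightarrow> p0 x)"
    by (rule exI[of _ "\<lambda>m. prim L (qs m)"], rule exI[of _ "prim L q"], rule exI[of _ "C * sqrt (2 * L)"])
      (intro conjI allI ballI prim_continuous qs q rm(1) r0(1) rm(6) r0(6) double_prim_sup_bound(1)[OF L qs C] 
        tendsto_uniform_limitI[OF p])
qed

context nonlinear_data
begin

text \<open>The inertia term and the forcing are collected into \<open>h\<close>, which makes the inequality of one time step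
  independent of its position in time.\<close>

lemma AC_solution_imp_step_solution:
  assumes AC: "AC_solution L \<nu> Mu f Khat g n \<tau> \<epsilon> \<delta> u w0 w" and i: "i \<in> {1..n}"
    and u: "u i \<in> L2 L" and prev: "(if i = 1 then w0 else w (i - 1)) \<in> L2 L"
  shows "step_solution (1 / \<tau>) \<epsilon> \<delta> (\<lambda>x. Mu * u i x + 1 / \<tau> * (if i = 1 then w0 else w (i - 1)) x) (w i)"
proof -
  define y where "y = (if i = 1 then w0 else w (i - 1))"
  have wdom: "w i \<in> Psi_dom L \<nu> f Khat \<epsilon> \<delta>" and VI: "\<And>z. z \<in> Psi_dom L \<nu> f Khat \<epsilon> \<delta> \<Longrightarrow> 
      ereal (1 / \<tau> * L2_inner L (w i - y) (w i - z) + L2_inner L (\<lambda>x. g (w i x) - Mu * u i x) (w i - z)) +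
        Psi L \<nu> f Khat \<epsilon> \<delta> (w i) - Psi L \<nu> f Khat \<epsilon> \<delta> z \<le> 0"
    using AC i unfolding AC_solution_def y_def by blast+
  have wH1: "w i \<in> H1 L"
    using wdom by (rule Psi_dom_H1)
  then have wL2: "w i \<in> L2 L"
    by (rule H1_L2)
  have yL2: "y \<in> L2 L"
    using prev by (simp add: y_def)
  obtain P where P: "has_L2_deriv L P (weak_deriv L (w i))" "AE x in Omega_measure L. w i x = P x"
    using H1_obtain_rep[OF L wH1] .
  have "(\<lambda>x. g (P x)) \<in> L2 L"
    by (rule L2_continuous[OF continuous_on_compose2[OF g_continuous[of UNIV] has_L2_deriv_continuous[OF P(1)]]]) simp
  then have gL2: "(\<lambda>x. g (w i x)) \<in> L2 L"
    by (rule L2_cong_AE) (use P(2) in \<open>eventually_elim, simp\<close>)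
  have eq: "1 / \<tau> * L2_inner L (w i - y) (w i - z) + L2_inner L (\<lambda>x. g (w i x) - Mu * u i x) (w i - z) = 
      L2_inner L (\<lambda>x. 1 / \<tau> * w i x + g (w i x) - (Mu * u i x + 1 / \<tau> * y x)) (\<lambda>x. w i x - z x)" 
    if z: "z \<in> Psi_dom L \<nu> f Khat \<epsilon> \<delta>" for z
  proof -
    have d: "(\<lambda>x. w i x - z x) \<in> L2 L"
      by (intro L2_diff wL2 H1_L2[OF Psi_dom_H1[OF z]])
    have "1 / \<tau> * L2_inner L (w i - y) (w i - z) + L2_inner L (\<lambda>x. g (w i x) - Mu * u i x) (w i - z) = 
        L2_inner L (\<lambda>x. 1 / \<tau> * (w i x - y x)) (\<lambda>x. w i x - z x) + 
        L2_inner L (\<lambda>x. g (w i x) - Mu * u i x) (\<lambda>x. w i x - z x)"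
      unfolding L2_inner_cmult_left by (simp add: fun_diff_def)
    also have "\<dots> = L2_inner L (\<lambda>x. 1 / \<tau> * (w i x - y x) + (g (w i x) - Mu * u i x)) (\<lambda>x. w i x - z x)"
      by (rule L2_inner_add_left[symmetric]) (intro L2_cmult L2_diff wL2 yL2 gL2 u d)+
    also have "(\<lambda>x. 1 / \<tau> * (w i x - y x) + (g (w i x) - Mu * u i x)) = 
        (\<lambda>x. 1 / \<tau> * w i x + g (w i x) - (Mu * u i x + 1 / \<tau> * y x))"
      by (simp add: fun_eq_iff right_diff_distrib)
    finally show ?thesis .
  qed
  show ?thesis
    unfolding step_solution_def y_def[symmetric]
  proof (intro conjI ballI wdom)
    fix z assume z: "z \<in> Psi_dom L \<nu> f Khat \<epsilon> \<delta>"
    show "ereal (L2_inner L (\<lambda>x. 1 / \<tau> * w i x + g (w i x) - (Mu * u i x + 1 / \<tau> * y x)) (\<lambda>x. w i x - z x)) +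
        Psi L \<nu> f Khat \<epsilon> \<delta> (w i) - Psi L \<nu> f Khat \<epsilon> \<delta> z \<le> 0"
      using VI[OF z] unfolding eq[OF z] .
  qed
qed

lemma f_of_derivative_convergence:
  assumes \<epsilon>: "\<epsilon> \<in> {0..1}" "\<And>m. \<epsilon>s m \<in> {0<..1}" "\<epsilon>s \<longlonglongrightarrow> \<epsilon>" and lim: "H2_limit L z z0"
  shows "converges_in (L2 L) (L2_inner L) (\<lambda>m x. f (\<epsilon>s m) (weak_deriv L (z m) x)) (\<lambda>x. f \<epsilon> (weak_deriv L z0 x))"
    and "x \<in> {-L..L} \<Longrightarrow> (\<lambda>m. f (\<epsilon>s m) (cont_deriv L (z m) x)) \<longlonglongrightarrow> f \<epsilon> (cont_deriv L z0 x)"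
proof -
  obtain p p0 R where p: "\<And>m. continuous_on {-L..L} (p m)" "continuous_on {-L..L} p0"
    and wd: "\<And>m. AE x in Omega_measure L. weak_deriv L (z m) x = p m x" 
      "AE x in Omega_measure L. weak_deriv L z0 x = p0 x"
    and cd: "\<And>m x. x \<in> {-L..L} \<Longrightarrow> cont_deriv L (z m) x = p m x" "\<And>x. x \<in> {-L..L} \<Longrightarrow> cont_deriv L z0 x = p0 x"
    and R: "\<And>m x. x \<in> {-L..L} \<Longrightarrow> \<bar>p m x\<bar> \<le> R" and p_lim: "\<And>x. x \<in> {-L..L} \<Longrightarrow> (\<lambda>m. p m x) \<longlonglongrightarrow> p0 x"
    using H2_limit_consequences(7)[OF L lim] by blast
  have \<epsilon>': "\<epsilon>s m \<in> {0..1}" for m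
    using \<epsilon>(2)[of m] by auto
  have f_lim: "(\<lambda>m. f (\<epsilon>s m) (p m x)) \<longlonglongrightarrow> f \<epsilon> (p0 x)" if "x \<in> {-L..L}" for x
    by (rule f_tendsto[OF \<epsilon>' \<epsilon>(3,1) p_lim[OF that]])
  then show "(\<lambda>m. f (\<epsilon>s m) (cont_deriv L (z m) x)) \<longlonglongrightarrow> f \<epsilon> (cont_deriv L z0 x)" if "x \<in> {-L..L}"
    using that by (simp add: cd)
  note fL2 = f_compose_tendsto(1,2)[OF \<epsilon>' \<epsilon>(3,1) p R p_lim]
  note L2_lim = f_compose_tendsto(3)[OF \<epsilon>' \<epsilon>(3,1) p R p_lim]
  have fAE: "AE x in Omega_measure L. f (\<epsilon>s m) (weak_deriv L (z m) x) = f (\<epsilon>s m) (p m x)" 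
    "AE x in Omega_measure L. f \<epsilon> (weak_deriv L z0 x) = f \<epsilon> (p0 x)" for m
    using wd(1)[of m] wd(2) by (eventually_elim, simp)+
  let ?h = "\<lambda>m x. f (\<epsilon>s m) (weak_deriv L (z m) x)" and ?k = "\<lambda>x. f \<epsilon> (weak_deriv L z0 x)"
  have "sqrt (L2_inner L (?h m - ?k) (?h m - ?k)) = L2_norm L (\<lambda>x. f (\<epsilon>s m) (p m x) - f \<epsilon> (p0 x))" for m
  proof -
    have AE: "AE x in Omega_measure L. (?h m - ?k) x = f (\<epsilon>s m) (p m x) - f \<epsilon> (p0 x)"
      using fAE(1)[of m] fAE(2) by eventually_elim simp
    show ?thesis
      unfolding L2_norm_def L2_inner_cong_AE[OF AE AE] ..
  qed
  then show "converges_in (L2 L) (L2_inner L) ?h ?k"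
    unfolding converges_in_def using L2_cong_AE[OF fL2(1) fAE(1)] L2_cong_AE[OF fL2(2) fAE(2)] L2_lim by simp
qed

end

text \<open>The test vector has \<open>v\<close> in place \<open>i\<close> and \<open>o0\<close>, which stands for zero, elsewhere.\<close>

lemma power_space_weak_component:
  assumes weak: "weakly_converges_in (power_space V n) (power_inner ip n) z z0" and i: "i \<in> {1..n}" 
    and v: "v \<in> V" and zero: "o0 \<in> V" "\<And>y. ip y o0 = 0"
  shows "(\<lambda>m. ip (z m i) v) \<longlonglongrightarrow> ip (z0 i) v"
proof -
  define e where "e j = (if j = i then v else o0)" for j
  have "e \<in> power_space V n"
    using v zero(1) by (auto simp: power_space_def e_def)
  then have "(\<lambda>m. power_inner ip n (z m) e) \<longlonglongrightarrow> power_inner ip n z0 e"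
    using weak by (simp add: weakly_converges_in_def)
  moreover have "power_inner ip n y e = ip (y i) v" for y
  proof -
    have "power_inner ip n y e = (\<Sum>j=1..n. if j = i then ip (y i) v else 0)"
      unfolding power_inner_def e_def by (rule sum.cong) (auto simp: zero(2))
    then show ?thesis
      using i by simp
  qed
  ultimately show ?thesis by simp
qed

theorem theorem2:
  fixes L T \<nu> Mu Cg \<tau> \<epsilon> \<delta> :: real
    and n :: nat
    and f Khat K :: "real \<Rightarrow> real \<Rightarrow> real"
    and g :: "real \<Rightarrow> real"
    and \<epsilon>s \<delta>s :: "nat \<Rightarrow> real"
    and u w :: "nat \<Rightarrow> real \<Rightarrow> real"
    and us ws :: "nat \<Rightarrow> nat \<Rightarrow> real \<Rightarrow> real"
    and w0 :: "real \<Rightarrow> real"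
    and w0s :: "nat \<Rightarrow> real \<Rightarrow> real"
  assumes "0 < L" and "0 < T" and "1 \<le> n" and "0 < \<nu>" and "0 \<le> Mu"
    and "f_assumption f" and "g_assumption g Cg" and "K_assumption Khat K"
    and "\<tau> = T / real n" and "0 < \<tau>" and "\<tau> < 1 / (8 * (Cg + 1))"
    and "\<epsilon> \<in> {0..1}" and "\<delta> \<in> {0..1}"
    and "\<And>m. \<epsilon>s m \<in> {0<..1}" and "\<And>m. \<delta>s m \<in> {0<..1}"
    and "\<epsilon>s \<longlonglongrightarrow> \<epsilon>" and "\<delta>s \<longlonglongrightarrow> \<delta>"
    and "weakly_converges_in (power_space (L2 L) n) (power_inner (L2_inner L) n) us u"
    and "weakly_converges_in (H1 L) (H1_inner L) w0s w0"
    and "(SUP m. Khat_integral L Khat (\<delta>s m) (w0s m)) < \<infinity>"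
    and "AC_solution L \<nu> Mu f Khat g n \<tau> \<epsilon> \<delta> u w0 w"
    and "\<And>m. AC_solution L \<nu> Mu f Khat g n \<tau> (\<epsilon>s m) (\<delta>s m) (us m) (w0s m) (ws m)"
  shows "converges_in (power_space (H1 L) n) (power_inner (H1_inner L) n) ws w \<and>
    (\<forall>i\<in>{1..n}. converges_in_C1 L (\<lambda>m. ws m i) (w i)) \<and>
    weakly_converges_in (power_space (H2 L) n) (power_inner (H2_inner L) n) ws w \<and>
    (\<forall>i\<in>{1..n}.
       converges_in (L2 L) (L2_inner L)
         (\<lambda>m x. f (\<epsilon>s m) (weak_deriv L (ws m i) x)) (\<lambda>x. f \<epsilon> (weak_deriv L (w i) x)) \<and>
       (\<forall>x\<in>{-L..L}.
          (\<lambda>m. f (\<epsilon>s m) (cont_deriv L (ws m i) x)) \<longlonglongrightarrow> f \<epsilon> (cont_deriv L (w i) x)))"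
proof -
  interpret nonlinear_data L \<nu> Cg f Khat K g
    by unfold_locales (use assms in auto)
  have \<kappa>: "1 + Cg \<le> 1 / \<tau>"
  proof -
    have "\<tau> * (8 * (Cg + 1)) < 1"
      using assms(11) Cg_pos by (simp add: field_simps)
    moreover have "\<tau> * (1 + Cg) \<le> \<tau> * (8 * (Cg + 1))"
      using assms(10) Cg_pos by (intro mult_left_mono) auto
    ultimately show ?thesis
      using assms(10) by (simp add: field_simps)
  qed
  have us: "us m i \<in> L2 L" "u i \<in> L2 L" if "i \<in> {1..n}" for m i
    using assms(18) that by (auto simp: weakly_converges_in_def power_space_def)
  have us_weak: "(\<lambda>m. L2_inner L (us m i) v) \<longlonglongrightarrow> L2_inner L (u i) v" if "i \<in> {1..n}" "v \<in> L2 L" for i v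
    by (rule power_space_weak_component[OF assms(18) that L2_const[of 0]]) (simp add: L2_inner_def)
  \<comment> \<open>Weak \<open>L\<^sup>2\<close> convergence of the states is passed on from one step to the next.\<close>
  have steps: "H2_limit L (\<lambda>m. ws m i) (w i)" if "i \<in> {1..n}" for i
    using that
  proof (induction i)
    case 0
    then show ?case by simp
  next
    case (Suc j)
    define y where "y = (if Suc j = 1 then w0 else w (Suc j - 1))"
    define ys where "ys m = (if Suc j = 1 then w0s m else ws m (Suc j - 1))" for m
    have y: "y \<in> L2 L" "\<And>m. ys m \<in> L2 L" "\<And>v. v \<in> L2 L \<Longrightarrow> (\<lambda>m. L2_inner L (ys m) v) \<longlonglongrightarrow> L2_inner L y v"
    proof -
      have "y \<in> L2 L \<and> (\<forall>m. ys m \<in> L2 L) \<and> (\<forall>v\<in>L2 L. (\<lambda>m. L2_inner L (ys m) v) \<longlonglongrightarrow> L2_inner L y v)"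
      proof (cases "j = 0")
        case True
        then show ?thesis
          using weakly_converges_H1_imp_L2[OF L assms(19)] assms(19) H1_L2
          by (auto simp: y_def ys_def weakly_converges_in_def)
      next
        case False
        then have "H2_limit L (\<lambda>m. ws m j) (w j)"
          using Suc by auto
        from H2_limit_consequences(4-6)[OF L this] show ?thesis
          using False H2_L2(1) by (auto simp: y_def ys_def)
      qed
      then show "y \<in> L2 L" "\<And>m. ys m \<in> L2 L" "\<And>v. v \<in> L2 L \<Longrightarrow> (\<lambda>m. L2_inner L (ys m) v) \<longlonglongrightarrow> L2_inner L y v"
        by blast+
    qed
    show ?case
    proof (rule step_convergence[OF \<kappa> assms(12,14,16,13,15,17)])
      show "step_solution (1 / \<tau>) \<epsilon> \<delta> (\<lambda>x. Mu * u (Suc j) x + 1 / \<tau> * y x) (w (Suc j))"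
        unfolding y_def by (rule AC_solution_imp_step_solution[OF assms(21) Suc.prems us(2)[OF Suc.prems] 
              y(1)[unfolded y_def]])
      show "step_solution (1 / \<tau>) (\<epsilon>s m) (\<delta>s m) (\<lambda>x. Mu * us m (Suc j) x + 1 / \<tau> * ys m x) (ws m (Suc j))" for m
        unfolding ys_def by (rule AC_solution_imp_step_solution[OF assms(22) Suc.prems us(1)[OF Suc.prems] 
              y(2)[unfolded ys_def]])
      show "(\<lambda>x. Mu * us m (Suc j) x + 1 / \<tau> * ys m x) \<in> L2 L" for m
        by (intro L2_add L2_cmult us(1)[OF Suc.prems] y(2))
      show "(\<lambda>x. Mu * u (Suc j) x + 1 / \<tau> * y x) \<in> L2 L"
        by (intro L2_add L2_cmult us(2)[OF Suc.prems] y(1))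
      fix v assume v: "v \<in> L2 L"
      have "(\<lambda>m. Mu * L2_inner L (us m (Suc j)) v + 1 / \<tau> * L2_inner L (ys m) v) \<longlonglongrightarrow> 
          Mu * L2_inner L (u (Suc j)) v + 1 / \<tau> * L2_inner L y v"
        by (intro tendsto_intros us_weak[OF Suc.prems v] y(3)[OF v])
      then show "(\<lambda>m. L2_inner L (\<lambda>x. Mu * us m (Suc j) x + 1 / \<tau> * ys m x) v) \<longlonglongrightarrow> 
          L2_inner L (\<lambda>x. Mu * u (Suc j) x + 1 / \<tau> * y x) v"
        unfolding L2_inner_add_left[OF L2_cmult[OF us(1)[OF Suc.prems]] L2_cmult[OF y(2)] v] 
          L2_inner_add_left[OF L2_cmult[OF us(2)[OF Suc.prems]] L2_cmult[OF y(1)] v] L2_inner_cmult_left .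
    qed
  qed
  note conv = H2_limit_consequences[OF L steps]
  have H1: "ws m i \<in> H1 L" "w i \<in> H1 L" if "i \<in> {1..n}" for m i
    using conv(5,6)[OF that] by (auto simp: H2_def)
  show ?thesis
  proof (intro conjI ballI)
    have "(\<lambda>m. sqrt (\<Sum>i=1..n. H1_inner L (ws m i - w i) (ws m i - w i))) \<longlonglongrightarrow> sqrt (\<Sum>i=1..n. 0)"
      by (intro tendsto_intros conv(1))
    then show "converges_in (power_space (H1 L) n) (power_inner (H1_inner L) n) ws w"
      using H1 by (simp add: converges_in_def power_space_def power_inner_def)
    show "weakly_converges_in (power_space (H2 L) n) (power_inner (H2_inner L) n) ws w"
      unfolding weakly_converges_in_def
    proof (intro conjI allI ballI)
      show "ws m \<in> power_space (H2 L) n" "w \<in> power_space (H2 L) n" for m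
        using conv(5,6) by (auto simp: power_space_def)
      fix v assume "v \<in> power_space (H2 L) n"
      then show "(\<lambda>m. power_inner (H2_inner L) n (ws m) v) \<longlonglongrightarrow> power_inner (H2_inner L) n w v"
        unfolding power_inner_def by (intro tendsto_sum conv(3)) (auto simp: power_space_def)
    qed
    fix i assume i: "i \<in> {1..n}"
    show "converges_in_C1 L (\<lambda>m. ws m i) (w i)"
      by (rule conv(2)[OF i])
    show "converges_in (L2 L) (L2_inner L)
        (\<lambda>m x. f (\<epsilon>s m) (weak_deriv L (ws m i) x)) (\<lambda>x. f \<epsilon> (weak_deriv L (w i) x))"
      by (rule f_of_derivative_convergence(1)[OF assms(12,14,16) steps[OF i]])
    show "(\<lambda>m. f (\<epsilon>s m) (cont_deriv L (ws m i) x)) \<longlonglongrightarrow> f \<epsilon> (cont_deriv L (w i) x)" if "x \<in> {-L..L}" for x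
      by (rule f_of_derivative_convergence(2)[OF assms(12,14,16) steps[OF i] that])
  qed
qed

end
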